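(* Let $k\ge1$ and $(\lambda_1,\dots,\lambda_k)\in\mathbb{R}^k$. Then the condition $$\lambda_i<\gamma_H\ \text{ for all }i=1,\dots,k\quad\text{and}\quad\sum_{i=1}^k\lambda_i<\gamma_H$$ is necessary and sufficient for the existence of a configuration of poles $(a_1,\dots,a_k)$, with $a_1,\dots,a_k\in\mathbb{R}^N$ and $a_i\neq a_j$ for $i\ne j$, such that the quadratic form $Q_{\lambda_1,\dots,\lambda_k,a_1,\dots,a_k}$ (associated to the operator $(-\Delta)^s-\sum_{i=1}^k\frac{\lambda_i}{|x-a_i|^{2s}}$) is positive definite.
   Context: Let $s\in(0,1)$ and let $N\ge1$ be an integer with $N>2s$. Functions are real-valued. $\mathcal{D}^{s,2}(\mathbb{R}^N)$ is the completion of $C_c^\infty(\mathbb{R}^N)$ with respect to the norm $\|u\|_{\mathcal{D}^{s,2}(\mathbb{R}^N)}^2=\frac12 C(N,s)\int_{\mathbb{R}^{2N}}\frac{|u(x)-u(y)|^2}{|x-y|^{N+2s}}\,dx\,dy$, where $C(N,s)=\pi^{-N/2}2^{2s}\frac{\Gamma(\frac{N+2s}{2})}{\Gamma(2-s)}s(1-s)$. Let $\gamma_H=2^{2s}\frac{\Gamma^2(\frac{N+2s}{4})}{\Gamma^2(\frac{N-2s}{4})}$ be the optimal constant in the fractional Hardy inequality $\gamma_H\int_{\mathbb{R}^N}\frac{|u|^2}{|x|^{2s}}dx\le\|u\|^2_{\mathcal{D}^{s,2}(\mathbb{R}^N)}$, $u\in\mathcal{D}^{s,2}(\mathbb{R}^N)$.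 For $u\in\mathcal{D}^{s,2}(\mathbb{R}^N)$ put $Q_{\lambda_1,\dots,\lambda_k,a_1,\dots,a_k}(u)=\|u\|^2_{\mathcal{D}^{s,2}(\mathbb{R}^N)}-\sum_{i=1}^k\lambda_i\int_{\mathbb{R}^N}\frac{|u(x)|^2}{|x-a_i|^{2s}}\,dx$. This quadratic form is called positive definite if $\inf_{u\in\mathcal{D}^{s,2}(\mathbb{R}^N)\setminus\{0\}}\frac{Q_{\lambda_1,\dots,\lambda_k,a_1,\dots,a_k}(u)}{\|u\|^2_{\mathcal{D}^{s,2}(\mathbb{R}^N)}}>0$. *)

theory Defs
  imports "HOL-Analysis.Analysis"
begin

fun C_k :: "nat \<Rightarrow> ('a::euclidean_space \<Rightarrow> real) \<Rightarrow> bool" where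
  "C_k 0 f \<longleftrightarrow> continuous_on UNIV f"
| "C_k (Suc k) f \<longleftrightarrow>
     f differentiable_on UNIV \<and> (\<forall>v. C_k k (\<lambda>x. frechet_derivative f (at x) v))"

definition C_c_infinity :: "('a::euclidean_space \<Rightarrow> real) set" where
  "C_c_infinity = {f. (\<forall>k. C_k k f) \<and> compact (closure {x. f x \<noteq> 0})}"

definition C_Ns :: "nat \<Rightarrow> real \<Rightarrow> real" where
  "C_Ns N s = pi powr (- real N / 2) * 2 powr (2 * s)
     * (Gamma ((real N + 2 * s) / 2) / Gamma (2 - s)) * s * (1 - s)"

definition gamma_H :: "nat \<Rightarrow> real \<Rightarrow> real" where
  "gamma_H N s = 2 powr (2 * s)
     * (Gamma ((real N + 2 * s) / 4))\<^sup>2 / (Gamma ((real N - 2 * s) / 4))\<^sup>2"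

(* The Bochner integral returns 0 for a non-integrable integrand; this does not occur for
   u in Ds2 s below, where the integral is finite. *)
definition Ds2_norm :: "real \<Rightarrow> (real ^ 'n \<Rightarrow> real) \<Rightarrow> real" where
  "Ds2_norm s u = sqrt (1 / 2 * C_Ns CARD('n) s *
     (LINT (x, y)|(lborel \<Otimes>\<^sub>M lborel).
        \<bar>u x - u y\<bar>\<^sup>2 / norm (x - y) powr (real CARD('n) + 2 * s)))"

(* The completion of the test functions, realised as a space of functions. For N > 2s a
   Cauchy sequence of test functions converges in L^(2N/(N-2s)) by the fractional Sobolev
   inequality, so a subsequence converges almost everywhere; by Fatou's lemma two such
   sequences have the same a.e. limit iff they represent the same element of the completion,
   and the norm of that element is Ds2_norm of the limit. Elements of Ds2 s are
   representatives: functions equal almost everywhere are the same element. *)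
definition Ds2 :: "real \<Rightarrow> (real ^ 'n \<Rightarrow> real) set" where
  "Ds2 s = {u \<in> borel_measurable borel. \<exists>\<phi>. (\<forall>n. \<phi> n \<in> C_c_infinity) \<and>
     (\<forall>e>0. \<exists>M. \<forall>m\<ge>M. \<forall>n\<ge>M. Ds2_norm s (\<lambda>x. \<phi> m x - \<phi> n x) < e) \<and>
     (AE x in lborel. (\<lambda>n. \<phi> n x) \<longlonglongrightarrow> u x)}"

definition Q_form ::
  "real \<Rightarrow> nat \<Rightarrow> (nat \<Rightarrow> real) \<Rightarrow> (nat \<Rightarrow> real ^ 'n) \<Rightarrow> (real ^ 'n \<Rightarrow> real) \<Rightarrow> real" where
  "Q_form s k lam a u = (Ds2_norm s u)\<^sup>2
     - (\<Sum>i=1..k. lam i * (LINT x|lborel. \<bar>u x\<bar>\<^sup>2 / norm (x - a i) powr (2 * s)))"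

(* The infimum is taken in ereal, so that it is meaningful without a boundedness proof. *)
definition Q_positive_definite ::
  "real \<Rightarrow> nat \<Rightarrow> (nat \<Rightarrow> real) \<Rightarrow> (nat \<Rightarrow> real ^ 'n) \<Rightarrow> bool" where
  "Q_positive_definite s k lam a \<longleftrightarrow>
     (INF u \<in> {u \<in> Ds2 s. \<not> (AE x in lborel. u x = 0)}.
        ereal (Q_form s k lam a u / (Ds2_norm s u)\<^sup>2)) > 0"

end

theory Submission imports Defs
begin

text \<open>
  The proof avoids the Fourier transform. With \<open>\<alpha> = N/2 - s\<close> and \<open>u = |x|^(-\<alpha>) v\<close>, the ground state representation
  expresses \<open>||u||\<^sup>2 - \<gamma>\<^sub>H \<integral> u\<^sup>2/|x|^(2s)\<close> as a weighted Gagliardo double integral of \<open>v\<close>. It is obtained by writing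
  the singular kernel as a superposition of Gaussians, for which all integrals converge absolutely and
  the divergent diagonal terms cancel before the superposition is taken; this also yields the constant \<open>\<gamma>\<^sub>H\<close>
  through Beta integrals. It gives the Hardy inequality, and its sharpness on cut-offs \<open>v\<close> that vary slowly in \<open>ln |x|\<close>.

  Sufficiency: poles are added one at a time, each new attractive pole so far away that a cut-off slowly varying
  in \<open>ln |x|\<close> separates it from the others at small cost in energy. Near the old poles the induction hypothesis
  applies; far from them they act as a single pole at the origin, and the Hardy inequality suffices.
  Necessity: almost optimal functions for the Hardy inequality, concentrated either near one pole or far from
  all poles, see only \<open>\<lambda>\<^sub>i\<close> or only the sum of all \<open>\<lambda>\<^sub>i\<close>.
\<close>

section \<open>Radial and Gaussian integrals\<close>


text \<open>The identities live in \<open>ennreal\<close>, where subtraction is of no use: the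
  ground state formula is carried as an equation between sums of nonnegative terms, and finite
  summands are cancelled. This is where square integrability and a finite Hardy integral come in.
  The induction over poles multiplies by cut-offs that are merely Lipschitz in
  \<open>ln (norm x)\<close>. It therefore runs on bounded functions of bounded support and finite
  energy, a class closed under such products; the completion is reached afterwards by limits of test
  functions. The logarithmic scale is forced: energy and Hardy integral scale alike, so cutting off
  over a fixed ratio of radii costs a fixed fraction of the energy, however large the radii. Slope
  \<open>d\<close> in \<open>ln (norm x)\<close> costs a fraction of order \<open>d^2\<close>, which
  is small once the transition runs over a long range of radii. The cut-offs are the cosine and sine
  of one angle, so their squares add up to 1 and Hardy integrals split without error.\<close>

lemma nn_integral_cong_off_point:
  fixes c :: "'a::euclidean_space"
  assumes "\<And>x. x \<noteq> c \<Longrightarrow> f x = g x"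
  shows "(\<integral>\<^sup>+x. f x \<partial>lborel) = (\<integral>\<^sup>+x. g x \<partial>lborel)"
  by (rule nn_integral_cong_AE, rule AE_mp[OF AE_lborel_singleton[of c]]) (auto intro!: AE_I2 assms)

lemma nn_integral_mono_off_point:
  fixes c :: "'a::euclidean_space"
  assumes "\<And>x. x \<noteq> c \<Longrightarrow> f x \<le> g x"
  shows "(\<integral>\<^sup>+x. f x \<partial>lborel) \<le> (\<integral>\<^sup>+x. g x \<partial>lborel)"
  by (rule nn_integral_mono_AE, rule AE_mp[OF AE_lborel_singleton[of c]]) (auto intro!: AE_I2 assms)

text \<open>For \<open>r \<ge> 0\<close> both measures give \<open>{..r}\<close> the volume of the
  ball of radius \<open>sqrt r\<close>, and half-lines generate the Borel sets. The squared norm is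
  the variable because Gaussians and powers of the norm are functions of
  \<open>z \<bullet> z\<close>.\<close>

lemma distr_inner_self_lborel:
  defines "n \<equiv> real DIM('a::euclidean_space)"
  shows "distr (lborel :: 'a measure) borel (\<lambda>z. z \<bullet> z) =
    density lborel (\<lambda>q. ennreal (pi powr (n / 2) / Gamma (n / 2) * q powr (n / 2 - 1)) * indicator {0..} q)"
    (is "?M = ?D")
proof -
  have n: "n > 0" by (simp add: n_def)
  define K where "K = pi powr (n / 2) / Gamma (n / 2)"
  have K: "K > 0" using n by (simp add: K_def Gamma_real_pos)
  have "n / 2 \<notin> \<int>\<^sub>\<le>\<^sub>0"
    using n by (auto elim!: nonpos_Ints_cases)
  then have "Gamma (n / 2 + 1) = n / 2 * Gamma (n / 2)"
    by (rule Gamma_plus1)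
  then have vol: "unit_ball_vol n = K * (2 / n)"
    by (simp only: unit_ball_vol_def K_def) (use n in simp)
  have eq: "emeasure ?M {..r} = emeasure ?D {..r}" for r :: real
  proof (cases "r \<ge> 0")
    case True
    have "emeasure ?M {..r} = emeasure (lborel :: 'a measure) ((\<lambda>z. z \<bullet> z) -` {..r} \<inter> space lborel)"
      by (rule emeasure_distr) auto
    also have "(\<lambda>z. z \<bullet> z) -` {..r} \<inter> space lborel = (cball 0 (sqrt r) :: 'a set)"
      using True by (auto simp: norm_eq_sqrt_inner)
    also have "emeasure lborel \<dots> = ennreal (unit_ball_vol n * sqrt r ^ DIM('a))"
      using True by (simp add: emeasure_cball n_def)
    also have "sqrt r ^ DIM('a) = r powr (n / 2)"
    proof (cases "r = 0")
      case False
      then show ?thesis using True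
        by (simp add: n_def powr_half_sqrt[symmetric] powr_powr powr_realpow[symmetric])
    qed auto
    also have "unit_ball_vol n * r powr (n / 2) = K * (r powr (n / 2 - 1 + 1) / (n / 2 - 1 + 1))"
      by (simp add: vol)
    also have "ennreal \<dots> = (\<integral>\<^sup>+q. ennreal (K * q powr (n / 2 - 1)) * indicator {0..r} q \<partial>lborel)"
    proof (rule nn_integral_has_integral_lebesgue'[symmetric])
      show "((\<lambda>q. K * q powr (n / 2 - 1)) has_integral K * (r powr (n / 2 - 1 + 1) / (n / 2 - 1 + 1))) {0..r}"
        using n True by (intro has_integral_mult_right has_integral_powr_from_0) auto
    qed (use K in auto)
    also have "\<dots> = (\<integral>\<^sup>+q. (ennreal (K * q powr (n / 2 - 1)) * indicator {0..} q) * indicator {..r} q \<partial>lborel)"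
      by (intro nn_integral_cong) (auto split: split_indicator)
    also have "\<dots> = emeasure ?D {..r}"
      unfolding K_def by (subst emeasure_density) auto
    finally show ?thesis .
  next
    case False
    have "(\<lambda>z. z \<bullet> z) -` {..r} \<inter> space lborel = ({} :: 'a set)"
      using False by (auto intro: order_trans[OF inner_ge_zero])
    moreover have "emeasure ?D {..r} = (\<integral>\<^sup>+q. 0 \<partial>(lborel :: real measure))"
      by (subst emeasure_density, measurable, rule nn_integral_cong)
        (use False in \<open>auto split: split_indicator\<close>)
    ultimately show ?thesis by (simp add: emeasure_distr)
  qed
  show ?thesis
  proof (rule measure_eqI_generator_eq[where E = "range (\<lambda>a::real. {..a})" and \<Omega> = UNIV
        and A = "\<lambda>i. {..real i}"])
    show "Int_stable (range (\<lambda>a::real. {..a}))"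
      by (auto simp: Int_stable_def)
    show "emeasure ?M {..real i} \<noteq> \<infinity>" for i
    proof -
      have "(\<lambda>z. z \<bullet> z) -` {..real i} \<inter> space lborel = (cball 0 (sqrt i) :: 'a set)"
        by (auto simp: norm_eq_sqrt_inner)
      then show ?thesis by (simp add: emeasure_distr emeasure_cball)
    qed
    show "(\<Union>i. {..real i}) = UNIV" by (auto intro: real_arch_simple)
    show "sets ?M = sigma_sets UNIV (range atMost)"
      by (simp add: borel_eq_atMost)
    show "sets ?D = sigma_sets UNIV (range atMost)"
      by (simp add: borel_eq_atMost)
  qed (use eq in auto)
qed

lemma nn_integral_radial:
  fixes f :: "real \<Rightarrow> ennreal"
  assumes [measurable]: "f \<in> borel_measurable borel"
  shows "(\<integral>\<^sup>+z. f (z \<bullet> z) \<partial>(lborel :: 'a::euclidean_space measure)) =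
    (\<integral>\<^sup>+q\<in>{0<..}. ennreal (pi powr (real DIM('a) / 2) / Gamma (real DIM('a) / 2)
        * q powr (real DIM('a) / 2 - 1)) * f q \<partial>lborel)"
proof -
  have "(\<integral>\<^sup>+z. f (z \<bullet> z) \<partial>(lborel :: 'a measure)) = (\<integral>\<^sup>+q. f q \<partial>distr (lborel :: 'a measure) borel (\<lambda>z. z \<bullet> z))"
    by (simp add: nn_integral_distr)
  also have "\<dots> = (\<integral>\<^sup>+q. ennreal (pi powr (real DIM('a) / 2) / Gamma (real DIM('a) / 2) * q powr (real DIM('a) / 2 - 1))
      * indicator {0..} q * f q \<partial>lborel)"
    unfolding distr_inner_self_lborel by (subst nn_integral_density) auto
  also have "\<dots> = (\<integral>\<^sup>+q\<in>{0<..}. ennreal (pi powr (real DIM('a) / 2) / Gamma (real DIM('a) / 2) * q powr (real DIM('a) / 2 - 1)) * f q \<partial>lborel)"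
    by (rule nn_integral_cong_off_point[where c = 0])
      (auto split: split_indicator)
  finally show ?thesis .
qed

text \<open>Read from right to left, this writes a negative power of \<open>t\<close> as a
  superposition of exponentials. It is the source of the Gaussian decompositions of both the ground
  state and the kernel.\<close>

lemma nn_integral_Gamma_exp:
  fixes a t :: real
  assumes "a > 0" "t > 0"
  shows "(\<integral>\<^sup>+p\<in>{0<..}. ennreal (p powr (a - 1) * exp (- (t * p))) \<partial>lborel) = ennreal (Gamma a / t powr a)"
proof -
  have "ennreal (Gamma a) = (\<integral>\<^sup>+p\<in>{0<..}. ennreal (p powr (a - 1) * exp (- p)) \<partial>lborel)"
    unfolding Gamma_conv_nn_integral_real[OF assms(1)]
    by (rule nn_integral_cong_off_point[where c = 0])
      (auto split: split_indicator simp: exp_minus divide_inverse)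
  also have "\<dots> = ennreal \<bar>t\<bar> * (\<integral>\<^sup>+p\<in>{0<..}. ennreal ((t * p) powr (a - 1) * exp (- (t * p))) \<partial>lborel)"
    using assms by (subst nn_integral_real_affine[where c = t and t = 0])
      (auto intro!: arg_cong2[where f = "(*)"] nn_integral_cong split: split_indicator simp: zero_less_mult_iff)
  also have "\<dots> = (\<integral>\<^sup>+p. ennreal (t powr a) * (ennreal (p powr (a - 1) * exp (- (t * p))) * indicator {0<..} p) \<partial>lborel)"
    using assms by (subst nn_integral_cmult[symmetric])
      (auto intro!: nn_integral_cong split: split_indicator simp: powr_mult ennreal_mult[symmetric] powr_diff powr_one)
  also have "\<dots> = ennreal (t powr a) * (\<integral>\<^sup>+p\<in>{0<..}. ennreal (p powr (a - 1) * exp (- (t * p))) \<partial>lborel)"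
    by (subst nn_integral_cmult) auto
  finally have *: "ennreal (Gamma a) = ennreal (t powr a) * (\<integral>\<^sup>+p\<in>{0<..}. ennreal (p powr (a - 1) * exp (- (t * p))) \<partial>lborel)" .
  have "ennreal (Gamma a / t powr a) = ennreal (inverse (t powr a)) * ennreal (Gamma a)"
    using assms by (simp add: ennreal_mult[symmetric] Gamma_real_pos less_imp_le divide_inverse mult.commute)
  also have "\<dots> = (\<integral>\<^sup>+p\<in>{0<..}. ennreal (p powr (a - 1) * exp (- (t * p))) \<partial>lborel)"
    unfolding * using assms by (simp add: mult.assoc[symmetric] ennreal_mult[symmetric])
  finally show ?thesis by simp
qed

lemma nn_integral_gaussian:
  assumes "t > 0"
  shows "(\<integral>\<^sup>+z. ennreal (exp (- (t * (z \<bullet> z)))) \<partial>(lborel :: 'a::euclidean_space measure)) =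
    ennreal ((pi / t) powr (real DIM('a) / 2))"
proof -
  let ?n = "real DIM('a)"
  have "(\<integral>\<^sup>+z. ennreal (exp (- (t * (z \<bullet> z)))) \<partial>(lborel :: 'a measure)) =
    (\<integral>\<^sup>+q. ennreal (pi powr (?n / 2) / Gamma (?n / 2)) * (ennreal (q powr (?n / 2 - 1) * exp (- (t * q))) * indicator {0<..} q) \<partial>lborel)"
    by (subst nn_integral_radial)
      (auto intro!: nn_integral_cong split: split_indicator simp: ennreal_mult[symmetric] Gamma_real_pos less_imp_le)
  also have "\<dots> = ennreal (pi powr (?n / 2) / Gamma (?n / 2)) * ennreal (Gamma (?n / 2) / t powr (?n / 2))"
    using assms by (subst nn_integral_cmult) (auto simp: nn_integral_Gamma_exp)
  also have "\<dots> = ennreal ((pi / t) powr (?n / 2))"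
    using assms by (subst ennreal_mult[symmetric])
      (auto simp: Gamma_real_pos less_imp_le powr_divide Gamma_eq_zero_iff)
  finally show ?thesis .
qed

lemma nn_integral_lborel_affine:
  fixes f :: "'a::euclidean_space \<Rightarrow> ennreal"
  assumes [measurable]: "f \<in> borel_measurable borel" and c: "c \<noteq> 0"
  shows "(\<integral>\<^sup>+x. f x \<partial>lborel) = ennreal (\<bar>c\<bar> ^ DIM('a)) * (\<integral>\<^sup>+x. f (t + c *\<^sub>R x) \<partial>lborel)"
  by (subst lborel_affine[OF c, of t])
    (simp add: nn_integral_density nn_integral_distr nn_integral_cmult)

lemma nn_integral_lborel_translate:
  fixes f :: "'a::euclidean_space \<Rightarrow> ennreal"
  assumes [measurable]: "f \<in> borel_measurable borel"
  shows "(\<integral>\<^sup>+x. f (x - a) \<partial>lborel) = (\<integral>\<^sup>+x. f x \<partial>lborel)"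
  using nn_integral_lborel_affine[of "\<lambda>x. f (x - a)" 1 a] by simp


text \<open>Links absolute integrability with nonnegative integrals, so that a substitution theorem
  for absolutely integrable functions also serves for integrals that may be infinite.\<close>

lemma absolutely_integrable_on_iff_nn_integral:
  fixes f :: "real \<Rightarrow> real"
  assumes [measurable]: "set_borel_measurable lborel S f" and nn: "\<And>x. x \<in> S \<Longrightarrow> f x \<ge> 0"
  shows "f absolutely_integrable_on S \<longleftrightarrow> (\<integral>\<^sup>+x\<in>S. ennreal (f x) \<partial>lborel) < \<infinity>"
    and "f absolutely_integrable_on S \<Longrightarrow> (\<integral>\<^sup>+x\<in>S. ennreal (f x) \<partial>lborel) = ennreal (integral S f)"
proof -
  have m: "(\<lambda>x. indicator S x *\<^sub>R f x) \<in> borel_measurable lborel"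
    using assms(1) by (simp add: set_borel_measurable_def)
  have "(\<integral>\<^sup>+x. ennreal (norm (indicator S x *\<^sub>R f x)) \<partial>lebesgue) = (\<integral>\<^sup>+x\<in>S. ennreal (f x) \<partial>lborel)"
    unfolding nn_integral_completion
    by (rule nn_integral_cong) (auto split: split_indicator simp: nn)
  then show "f absolutely_integrable_on S \<longleftrightarrow> (\<integral>\<^sup>+x\<in>S. ennreal (f x) \<partial>lborel) < \<infinity>"
    unfolding set_integrable_def integrable_iff_bounded using m
    by (simp add: measurable_completion)
  assume "f absolutely_integrable_on S"
  then have "(f has_integral integral S f) S"
    by (simp add: absolutely_integrable_on_def integrable_integral)
  then show "(\<integral>\<^sup>+x\<in>S. ennreal (f x) \<partial>lborel) = ennreal (integral S f)"
    by (rule nn_integral_has_integral_lebesgue'[rotated]) (use nn in auto)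
qed

text \<open>Absolute integrability of the two sides is equivalent, so the integrals agree when
  finite and are infinite together otherwise. The transformed integrand \<open>h\<close> is an
  argument of its own: it is measurable everywhere, but has to match the substitution on
  \<open>S\<close> only.\<close>

lemma nn_integral_change_of_variables:
  fixes f g g' :: "real \<Rightarrow> real"
  assumes S: "S \<in> sets borel" and T: "T \<in> sets borel" and gS: "g ` S = T"
    and der: "\<And>x. x \<in> S \<Longrightarrow> (g has_field_derivative g' x) (at x within S)"
    and inj: "inj_on g S"
    and fm: "f \<in> borel_measurable borel" and hm: "h \<in> borel_measurable borel"
    and f0: "\<And>x. x \<in> T \<Longrightarrow> f x \<ge> 0"
    and h: "\<And>x. x \<in> S \<Longrightarrow> h x = \<bar>g' x\<bar> * f (g x)"
  shows "(\<integral>\<^sup>+x\<in>S. ennreal (h x) \<partial>lborel) = (\<integral>\<^sup>+x\<in>T. ennreal (f x) \<partial>lborel)"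
proof -
  have SL: "S \<in> sets lebesgue" using S by auto
  have mf: "set_borel_measurable lborel T f" and mh: "set_borel_measurable lborel S h"
    using S T fm hm by (auto simp: set_borel_measurable_def)
  have h0: "h x \<ge> 0" if "x \<in> S" for x using that f0[of "g x"] h[OF that] gS by auto
  have eqh: "(\<lambda>x. \<bar>g' x\<bar> * f (g x)) absolutely_integrable_on S \<longleftrightarrow> h absolutely_integrable_on S"
    by (rule set_integrable_cong) (auto simp: h)
  have eqi: "integral S (\<lambda>x. \<bar>g' x\<bar> * f (g x)) = integral S h"
    by (rule integral_cong) (auto simp: h)
  note cv = has_absolute_integral_change_of_variables_1'[OF SL der inj, of f, unfolded eqh eqi gS]
  have iff: "h absolutely_integrable_on S \<longleftrightarrow> f absolutely_integrable_on T"
    using cv by blast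
  show ?thesis
  proof (cases "h absolutely_integrable_on S")
    case True
    moreover have "integral T f = integral S h" using cv True by blast
    ultimately show ?thesis
      using absolutely_integrable_on_iff_nn_integral(2)[OF mf f0] absolutely_integrable_on_iff_nn_integral(2)[OF mh h0] iff
      by simp
  next
    case False
    then show ?thesis
      using absolutely_integrable_on_iff_nn_integral(1)[OF mf f0] absolutely_integrable_on_iff_nn_integral(1)[OF mh h0] iff
      by (simp add: less_top[symmetric])
  qed
qed

lemma nn_integral_gaussian_product:
  fixes x :: "'a::euclidean_space"
  assumes "p > 0" "t > 0"
  shows "(\<integral>\<^sup>+y. ennreal (exp (- (p * (y \<bullet> y))) * exp (- (t * ((x - y) \<bullet> (x - y))))) \<partial>lborel) =
    ennreal ((pi / (p + t)) powr (real DIM('a) / 2) * exp (- (p * t / (p + t) * (x \<bullet> x))))"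
proof -
  \<comment> \<open>The minimiser in \<open>y\<close> of the exponent; completing the square there
    leaves a Gaussian in \<open>x\<close> of rate \<open>p * t / (p + t)\<close>.\<close>
  define m where "m = (t / (p + t)) *\<^sub>R x"
  have sq: "p * (y \<bullet> y) + t * ((x - y) \<bullet> (x - y)) = (p + t) * ((y - m) \<bullet> (y - m)) + p * t / (p + t) * (x \<bullet> x)" for y
  proof -
    have "(p + t) * ((y - m) \<bullet> (y - m)) = (p + t) * (y \<bullet> y) - 2 * t * (x \<bullet> y) + t\<^sup>2 / (p + t) * (x \<bullet> x)"
      unfolding m_def using assms
      by (simp add: inner_diff_left inner_diff_right inner_commute[of y x] power2_eq_square divide_simps) algebra
    moreover have "t\<^sup>2 / (p + t) + p * t / (p + t) = t"
      using assms by (simp add: power2_eq_square divide_simps) algebra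
    then have "t\<^sup>2 / (p + t) * (x \<bullet> x) + p * t / (p + t) * (x \<bullet> x) = t * (x \<bullet> x)"
      by (metis distrib_right)
    ultimately show ?thesis
      by (simp add: inner_diff_left inner_diff_right inner_commute[of y x] algebra_simps)
  qed
  have "(\<integral>\<^sup>+y. ennreal (exp (- (p * (y \<bullet> y))) * exp (- (t * ((x - y) \<bullet> (x - y))))) \<partial>lborel) =
    (\<integral>\<^sup>+y. ennreal (exp (- (p * t / (p + t) * (x \<bullet> x)))) * ennreal (exp (- ((p + t) * ((y - m) \<bullet> (y - m))))) \<partial>lborel)"
  proof (intro nn_integral_cong)
    fix y
    have "exp (- (p * (y \<bullet> y))) * exp (- (t * ((x - y) \<bullet> (x - y)))) = exp (- (p * (y \<bullet> y) + t * ((x - y) \<bullet> (x - y))))"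
      by (simp add: exp_add[symmetric])
    also have "\<dots> = exp (- (p * t / (p + t) * (x \<bullet> x))) * exp (- ((p + t) * ((y - m) \<bullet> (y - m))))"
      unfolding sq by (simp add: exp_add[symmetric])
    finally show "ennreal (exp (- (p * (y \<bullet> y))) * exp (- (t * ((x - y) \<bullet> (x - y))))) =
      ennreal (exp (- (p * t / (p + t) * (x \<bullet> x)))) * ennreal (exp (- ((p + t) * ((y - m) \<bullet> (y - m)))))"
      by (simp add: ennreal_mult)
  qed
  also have "\<dots> = ennreal (exp (- (p * t / (p + t) * (x \<bullet> x)))) * (\<integral>\<^sup>+y. ennreal (exp (- ((p + t) * (y \<bullet> y)))) \<partial>(lborel::'a measure))"
    by (subst nn_integral_cmult) (auto simp: nn_integral_lborel_translate[of "\<lambda>y. ennreal (exp (- ((p + t) * (y \<bullet> y))))"])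
  also have "\<dots> = ennreal ((pi / (p + t)) powr (real DIM('a) / 2) * exp (- (p * t / (p + t) * (x \<bullet> x))))"
    using assms by (simp add: nn_integral_gaussian ennreal_mult[symmetric] mult.commute)
  finally show ?thesis .
qed

text \<open>The power \<open>(y \<bullet> y) powr (- a)\<close> is a superposition of Gaussians of
  rate \<open>p\<close> with weight \<open>p powr (a - 1)\<close>. Averaging turns the rate
  \<open>p\<close> into \<open>q = p * t / (p + t)\<close>, which stays below \<open>t\<close>. So
  the effect of the averaging is the truncation to \<open>q < t\<close>, a factor in
  \<open>1 - q / t\<close> and the Gaussian mass.\<close>

lemma nn_integral_riesz_gaussian:
  fixes x :: "'a::euclidean_space"
  assumes a: "a > 0" and ab: "a + b = real DIM('a) / 2" and t: "t > 0"
  shows "(\<integral>\<^sup>+y. ennreal (Gamma a * (y \<bullet> y) powr (- a) * exp (- (t * ((x - y) \<bullet> (x - y))))) \<partial>lborel) =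
    ennreal ((pi / t) powr (real DIM('a) / 2)) *
      (\<integral>\<^sup>+q\<in>{0<..<t}. ennreal (q powr (a - 1) * (1 - q / t) powr (b - 1) * exp (- (q * (x \<bullet> x)))) \<partial>lborel)"
proof -
  let ?n = "real DIM('a)"
  have "(\<integral>\<^sup>+y. ennreal (Gamma a * (y \<bullet> y) powr (- a) * exp (- (t * ((x - y) \<bullet> (x - y))))) \<partial>lborel) =
    (\<integral>\<^sup>+y. (\<integral>\<^sup>+p. ennreal (p powr (a - 1) * exp (- (p * (y \<bullet> y))) * exp (- (t * ((x - y) \<bullet> (x - y))))) * indicator {0<..} p \<partial>lborel) \<partial>lborel)"
  proof (rule nn_integral_cong_off_point[where c = 0])
    fix y :: 'a assume "y \<noteq> 0"
    then have y: "y \<bullet> y > 0" by simp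
    have "ennreal (Gamma a * (y \<bullet> y) powr (- a) * exp (- (t * ((x - y) \<bullet> (x - y))))) =
      ennreal (Gamma a / (y \<bullet> y) powr a) * ennreal (exp (- (t * ((x - y) \<bullet> (x - y)))))"
      using a by (simp add: ennreal_mult[symmetric] powr_minus_divide Gamma_real_pos less_imp_le)
    also have "ennreal (Gamma a / (y \<bullet> y) powr a) = (\<integral>\<^sup>+p\<in>{0<..}. ennreal (p powr (a - 1) * exp (- ((y \<bullet> y) * p))) \<partial>lborel)"
      using a y by (simp add: nn_integral_Gamma_exp)
    also have "\<dots> * ennreal (exp (- (t * ((x - y) \<bullet> (x - y))))) =
      (\<integral>\<^sup>+p. ennreal (p powr (a - 1) * exp (- (p * (y \<bullet> y))) * exp (- (t * ((x - y) \<bullet> (x - y))))) * indicator {0<..} p \<partial>lborel)"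
      by (subst nn_integral_multc[symmetric])
        (auto intro!: nn_integral_cong split: split_indicator simp: ennreal_mult[symmetric] mult.commute[of "y \<bullet> y"])
    finally show "ennreal (Gamma a * (y \<bullet> y) powr (- a) * exp (- (t * ((x - y) \<bullet> (x - y))))) = \<dots>" .
  qed
  also have "\<dots> = (\<integral>\<^sup>+p. (\<integral>\<^sup>+y. ennreal (p powr (a - 1) * exp (- (p * (y \<bullet> y))) * exp (- (t * ((x - y) \<bullet> (x - y))))) * indicator {0<..} p \<partial>lborel) \<partial>lborel)"
    by (rule lborel_pair.Fubini') measurable
  also have "\<dots> = (\<integral>\<^sup>+p\<in>{0<..}. ennreal (p powr (a - 1) * ((pi / (p + t)) powr (?n / 2) * exp (- (p * t / (p + t) * (x \<bullet> x))))) \<partial>lborel)"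
  proof (rule nn_integral_cong)
    fix p :: real
    show "(\<integral>\<^sup>+y. ennreal (p powr (a - 1) * exp (- (p * (y \<bullet> y))) * exp (- (t * ((x - y) \<bullet> (x - y))))) * indicator {0<..} p \<partial>lborel) =
      ennreal (p powr (a - 1) * ((pi / (p + t)) powr (?n / 2) * exp (- (p * t / (p + t) * (x \<bullet> x))))) * indicator {0<..} p"
    proof (cases "p > 0")
      case True
      have "(\<integral>\<^sup>+y. ennreal (p powr (a - 1)) * ennreal (exp (- (p * (y \<bullet> y))) * exp (- (t * ((x - y) \<bullet> (x - y))))) \<partial>lborel)
        = ennreal (p powr (a - 1)) * ennreal ((pi / (p + t)) powr (?n / 2) * exp (- (p * t / (p + t) * (x \<bullet> x))))"
        using True t by (subst nn_integral_cmult) (auto simp: nn_integral_gaussian_product)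
      then show ?thesis using True by (simp add: ennreal_mult[symmetric] mult.assoc)
    qed simp
  qed
  also have "\<dots> = (\<integral>\<^sup>+q\<in>{0<..<t}. ennreal ((pi / t) powr (?n / 2) * (q powr (a - 1) * (1 - q / t) powr (b - 1) * exp (- (q * (x \<bullet> x))))) \<partial>lborel)"
  \<comment> \<open>The substitution inverts \<open>q = p * t / (p + t)\<close> and maps
    \<open>{0<..<t}\<close> onto \<open>{0<..}\<close>.\<close>
  proof (rule nn_integral_change_of_variables[symmetric, where g = "\<lambda>q. q * t / (t - q)" and g' = "\<lambda>q. t\<^sup>2 / (t - q)\<^sup>2"])
    show "(\<lambda>q. q * t / (t - q)) ` {0<..<t} = {0<..}"
    proof (intro equalityI subsetI)
      fix p :: real assume "p \<in> {0<..}"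
      then have p: "p > 0" by simp
      have "t - p * t / (p + t) = t * t / (p + t)" using p t by (simp add: field_simps)
      then have "p = (p * t / (p + t)) * t / (t - p * t / (p + t))"
        using p t by simp
      moreover have "p * t / (p + t) \<in> {0<..<t}"
        using p t by (auto simp: field_simps)
      ultimately show "p \<in> (\<lambda>q. q * t / (t - q)) ` {0<..<t}" by blast
    qed (use t in auto)
    show "inj_on (\<lambda>q. q * t / (t - q)) {0<..<t}"
    proof (rule inj_onI)
      fix u v assume "u \<in> {0<..<t}" "v \<in> {0<..<t}" "u * t / (t - u) = v * t / (t - v)"
      then have "u * t * (t - v) = v * t * (t - u)" by (simp add: frac_eq_eq)
      then have "t * t * (u - v) = 0" by algebra
      then show "u = v" using t by simp
    qed
    fix q assume q: "q \<in> {0<..<t}"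
    show "((\<lambda>q. q * t / (t - q)) has_real_derivative t\<^sup>2 / (t - q)\<^sup>2) (at q within {0<..<t})"
      using q by (auto intro!: derivative_eq_intros simp: power2_eq_square field_simps)
    have pos: "q > 0" "t - q > 0" using q by auto
    define d where "d = t - q"
    have d: "d > 0" using q by (simp add: d_def)
    have 1: "q * t / d + t = t * (t / d)" "1 - q / t = d / t" "q * t / d * t / (t * (t / d)) = q"
      using q t d by (auto simp: d_def field_simps)
    \<comment> \<open>All factors are rewritten as exponentials, so the claim becomes linear in
      \<open>ln q\<close>, \<open>ln t\<close>, \<open>ln d\<close> and \<open>ln pi\<close>. The
      relation of \<open>a + b\<close> to the dimension is what makes the powers of \<open>d\<close>
      match.\<close>
    have eq: "t\<^sup>2 / d\<^sup>2 * ((q * t / d) powr (a - 1) * (pi / (t * (t / d))) powr (?n / 2))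
       = (pi / t) powr (?n / 2) * (q powr (a - 1) * (d / t) powr (b - 1))"
    proof -
      have "t\<^sup>2 / d\<^sup>2 = exp (2 * ln t - 2 * ln d)"
        using t d by (simp add: exp_diff exp_double)
      moreover have "(q * t / d) powr (a - 1) = exp ((a - 1) * (ln q + ln t - ln d))"
        using t d pos by (simp add: powr_def ln_mult ln_div)
      moreover have "(pi / (t * (t / d))) powr (?n / 2) = exp ((a + b) * (ln pi - 2 * ln t + ln d))"
        using t d pos by (simp add: powr_def ln_mult ln_div ab algebra_simps)
      moreover have "(pi / t) powr (?n / 2) = exp ((a + b) * (ln pi - ln t))"
        using t d pos by (simp add: powr_def ln_div ab)
      moreover have "q powr (a - 1) = exp ((a - 1) * ln q)" "(d / t) powr (b - 1) = exp ((b - 1) * (ln d - ln t))"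
        using t d pos by (simp_all add: powr_def ln_div)
      ultimately show ?thesis
        by (simp add: exp_add[symmetric]) (simp add: algebra_simps)
    qed
    have "(pi / t) powr (?n / 2) * (q powr (a - 1) * (d / t) powr (b - 1) * exp (- (q * (x \<bullet> x)))) =
      ((pi / t) powr (?n / 2) * (q powr (a - 1) * (d / t) powr (b - 1))) * exp (- (q * (x \<bullet> x)))"
      by (simp only: mult.assoc)
    also have "\<dots> = \<bar>t\<^sup>2 / d\<^sup>2\<bar> * ((q * t / d) powr (a - 1) * ((pi / (t * (t / d))) powr (?n / 2) * exp (- (q * (x \<bullet> x)))))"
      unfolding eq[symmetric] abs_of_nonneg[OF divide_nonneg_nonneg[OF zero_le_power2 zero_le_power2]]
      by (simp only: mult.assoc)
    finally show "(pi / t) powr (?n / 2) * (q powr (a - 1) * (1 - q / t) powr (b - 1) * exp (- (q * (x \<bullet> x)))) =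
      \<bar>t\<^sup>2 / (t - q)\<^sup>2\<bar> * ((q * t / (t - q)) powr (a - 1) * ((pi / (q * t / (t - q) + t)) powr (?n / 2) *
        exp (- (q * t / (t - q) * t / (q * t / (t - q) + t) * (x \<bullet> x)))))"
      unfolding d_def[symmetric] 1 .
  qed (use t in auto)
  also have "\<dots> = ennreal ((pi / t) powr (?n / 2)) *
      (\<integral>\<^sup>+q\<in>{0<..<t}. ennreal (q powr (a - 1) * (1 - q / t) powr (b - 1) * exp (- (q * (x \<bullet> x)))) \<partial>lborel)"
    by (subst nn_integral_cmult[symmetric])
      (auto intro!: nn_integral_cong split: split_indicator simp: ennreal_mult[symmetric])
  finally show ?thesis .
qed


section \<open>Beta integrals of the cut-off factors over the Gaussian time\<close>

lemma nn_integral_Beta_real: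
  assumes "a > 0" "b > (0::real)"
  shows "(\<integral>\<^sup>+z\<in>{0<..<1}. ennreal (z powr (a - 1) * (1 - z) powr (b - 1)) \<partial>lborel) = ennreal (Beta a b)"
proof (rule nn_integral_has_integral_lebesgue')
  show "((\<lambda>z. z powr (a - 1) * (1 - z) powr (b - 1)) has_integral Beta a b) {0<..<1}"
    using has_integral_Beta_real[OF assms] by (simp add: has_integral_Icc_iff_Ioo)
qed auto

lemma Beta_real_nonneg: "a > 0 \<Longrightarrow> b > (0::real) \<Longrightarrow> Beta a b \<ge> 0"
  unfolding Beta_def by (simp add: Gamma_real_pos less_imp_le)

text \<open>Substituting \<open>z = q / t\<close> gives a Beta integral, and \<open>q powr s\<close>
  is the scaling factor. The extra \<open>q / t\<close> makes the integral converge for large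
  \<open>t\<close>, because \<open>s < 1\<close>.\<close>

lemma nn_integral_powr_Beta_cutoff:
  fixes q s b :: real
  assumes q: "q > 0" and s: "s < 1" and b: "b > 0"
  shows "(\<integral>\<^sup>+t\<in>{0<..}. ennreal (t powr (s - 1) * (q / t * max 0 (1 - q / t) powr (b - 1))) \<partial>lborel) =
    ennreal (q powr s * Beta (1 - s) b)"
proof -
  have "(\<integral>\<^sup>+t\<in>{0<..}. ennreal (t powr (s - 1) * (q / t * max 0 (1 - q / t) powr (b - 1))) \<partial>lborel) =
    (\<integral>\<^sup>+t\<in>{q<..}. ennreal (t powr (s - 1) * (q / t * (1 - q / t) powr (b - 1))) \<partial>lborel)"
  proof (intro nn_integral_cong)
    fix t
    consider "t \<le> 0" | "0 < t" "t \<le> q" | "t > q" by linarith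
    then show "ennreal (t powr (s - 1) * (q / t * max 0 (1 - q / t) powr (b - 1))) * indicator {0<..} t =
      ennreal (t powr (s - 1) * (q / t * (1 - q / t) powr (b - 1))) * indicator {q<..} t"
    proof cases
      case 2
      then have "max 0 (1 - q / t) = 0" by (simp add: field_simps max_def)
      with 2 show ?thesis by simp
    next
      case 3
      then have "max 0 (1 - q / t) = 1 - q / t" using q by (simp add: field_simps max_def)
      with 3 q show ?thesis by simp
    qed (use q in auto)
  qed
  also have "\<dots> = (\<integral>\<^sup>+z\<in>{0<..<1}. ennreal (q powr s * (z powr ((1 - s) - 1) * (1 - z) powr (b - 1))) \<partial>lborel)"
  proof (rule nn_integral_change_of_variables[symmetric, where g = "\<lambda>z. q / z" and g' = "\<lambda>z. - q / z\<^sup>2"])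
    show "(\<lambda>z. q / z) ` {0<..<1} = {q<..}"
    proof (intro equalityI subsetI)
      fix p assume "p \<in> {q<..}"
      then have "q / p \<in> {0<..<1}" "p = q / (q / p)" using q by (auto simp: field_simps)
      then show "p \<in> (\<lambda>z. q / z) ` {0<..<1}" by blast
    qed (use q in \<open>auto simp: field_simps\<close>)
    show "inj_on (\<lambda>z. q / z) {0<..<1}" using q by (auto simp: inj_on_def)
    fix z :: real assume z: "z \<in> {0<..<1}"
    then show "((\<lambda>z. q / z) has_real_derivative - q / z\<^sup>2) (at z within {0<..<1})"
      by (auto intro!: derivative_eq_intros simp: power2_eq_square)
    have z0: "z > 0" using z by simp
    have "\<bar>- q / z\<^sup>2\<bar> * ((q / z) powr (s - 1) * z) = q powr s * z powr (- s)"
    proof -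
      have "\<bar>- q / z\<^sup>2\<bar> * z = exp (ln q - ln z)" using q z0 by (simp add: exp_diff power2_eq_square)
      moreover have "(q / z) powr (s - 1) = exp ((s - 1) * (ln q - ln z))" using q z0 by (simp add: powr_def ln_div)
      moreover have "q powr s * z powr (- s) = exp (s * ln q - s * ln z)" using q z0 by (simp add: powr_def exp_add[symmetric])
      moreover have "exp (ln q - ln z) * exp ((s - 1) * (ln q - ln z)) = exp (s * ln q - s * ln z)"
        by (simp add: exp_add[symmetric] algebra_simps)
      ultimately show ?thesis by (metis mult.assoc mult.commute)
    qed
    then show "q powr s * (z powr ((1 - s) - 1) * (1 - z) powr (b - 1)) =
      \<bar>- q / z\<^sup>2\<bar> * ((q / z) powr (s - 1) * (q / (q / z) * (1 - q / (q / z)) powr (b - 1)))"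
      using q by (simp add: mult.assoc[symmetric])
  qed (use q in \<open>auto simp: field_simps\<close>)
  also have "\<dots> = (\<integral>\<^sup>+z. ennreal (q powr s) * (ennreal (z powr ((1 - s) - 1) * (1 - z) powr (b - 1)) * indicator {0<..<1} z) \<partial>lborel)"
    by (intro nn_integral_cong) (auto split: split_indicator simp: ennreal_mult[symmetric])
  also have "\<dots> = ennreal (q powr s * Beta (1 - s) b)"
    using s b by (subst nn_integral_cmult, measurable, subst nn_integral_Beta_real) (auto simp: ennreal_mult Beta_real_nonneg)
  finally show ?thesis .
qed

text \<open>The difference from 1 is the integral of its derivative over \<open>y < q / t\<close>.
  Exchanging the order leaves a power integral in \<open>t\<close> and a Beta integral in
  \<open>y\<close>. Small \<open>t\<close> calls for \<open>s > 0\<close>, large \<open>t\<close>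
  for \<open>s < 1\<close>.\<close>

lemma nn_integral_powr_one_minus_cutoff:
  fixes q s b :: real
  assumes q: "q > 0" and s: "0 < s" "s < 1" and b: "b > 0"
  shows "(\<integral>\<^sup>+t\<in>{0<..}. ennreal (t powr (s - 1) * (1 - max 0 (1 - q / t) powr b)) \<partial>lborel) =
    ennreal (q powr s * (b / s * Beta (1 - s) b))"
proof -
  have inner: "ennreal (1 - max 0 (1 - q / t) powr b) = (\<integral>\<^sup>+y\<in>{0..min 1 (q / t)}. ennreal (b * (1 - y) powr (b - 1)) \<partial>lborel)"
    if t: "t > 0" for t
  proof -
    define c where "c = min 1 (q / t)"
    have c: "0 < c" "c \<le> 1" using q t by (auto simp: c_def)
    have "((\<lambda>y. b * (1 - y) powr (b - 1)) has_integral (- ((1 - c) powr b) - (- ((1 - 0) powr b)))) {0..c}"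
    proof (rule fundamental_theorem_of_calculus_interior)
      show "continuous_on {0..c} (\<lambda>y. - ((1 - y) powr b))"
        using b c by (intro continuous_intros continuous_on_powr') auto
      show "((\<lambda>y. - ((1 - y) powr b)) has_vector_derivative b * (1 - y) powr (b - 1)) (at y)" if "y \<in> {0<..<c}" for y
        unfolding has_real_derivative_iff_has_vector_derivative[symmetric]
        using that c by (auto intro!: derivative_eq_intros)
    qed (use c in auto)
    moreover have "1 - c = max 0 (1 - q / t)" by (auto simp: c_def)
    ultimately show ?thesis
      using b by (subst nn_integral_has_integral_lebesgue') (auto simp: c_def)
  qed
  have "(\<integral>\<^sup>+t\<in>{0<..}. ennreal (t powr (s - 1) * (1 - max 0 (1 - q / t) powr b)) \<partial>lborel) =
    (\<integral>\<^sup>+t. (\<integral>\<^sup>+y. ennreal (t powr (s - 1) * (b * (1 - y) powr (b - 1)) * (indicator {0<..} t * indicator {0<..<1} y * indicator {..q} (y * t))) \<partial>lborel) \<partial>lborel)"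
  proof (intro nn_integral_cong)
    fix t :: real
    show "ennreal (t powr (s - 1) * (1 - max 0 (1 - q / t) powr b)) * indicator {0<..} t =
      (\<integral>\<^sup>+y. ennreal (t powr (s - 1) * (b * (1 - y) powr (b - 1)) * (indicator {0<..} t * indicator {0<..<1} y * indicator {..q} (y * t))) \<partial>lborel)"
    proof (cases "t > 0")
      case True
      have le1: "max 0 (1 - q / t) powr b \<le> 1"
        using q True b by (intro powr_le1) auto
      have "ennreal (t powr (s - 1) * (1 - max 0 (1 - q / t) powr b)) =
        ennreal (t powr (s - 1)) * (\<integral>\<^sup>+y\<in>{0..min 1 (q / t)}. ennreal (b * (1 - y) powr (b - 1)) \<partial>lborel)"
        using inner[OF True] le1 by (simp add: ennreal_mult)
      also have "\<dots> = (\<integral>\<^sup>+y. ennreal (t powr (s - 1)) * (ennreal (b * (1 - y) powr (b - 1)) * indicator {0..min 1 (q / t)} y) \<partial>lborel)"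
        by (subst nn_integral_cmult) auto
      also have "\<dots> = (\<integral>\<^sup>+y. ennreal (t powr (s - 1) * (b * (1 - y) powr (b - 1)) * (indicator {0<..} t * indicator {0<..<1} y * indicator {..q} (y * t))) \<partial>lborel)"
      proof (rule nn_integral_cong_off_point[where c = 0])
        fix y :: real assume "y \<noteq> 0"
        then show "ennreal (t powr (s - 1)) * (ennreal (b * (1 - y) powr (b - 1)) * indicator {0..min 1 (q / t)} y) =
          ennreal (t powr (s - 1) * (b * (1 - y) powr (b - 1)) * (indicator {0<..} t * indicator {0<..<1} y * indicator {..q} (y * t)))"
          using True b by (cases "y = 1") (auto split: split_indicator simp: ennreal_mult[symmetric] field_simps)
      qed
      finally show ?thesis using True by simp
    qed simp
  qed
  also have "\<dots> = (\<integral>\<^sup>+y. (\<integral>\<^sup>+t. ennreal (t powr (s - 1) * (b * (1 - y) powr (b - 1)) * (indicator {0<..} t * indicator {0<..<1} y * indicator {..q} (y * t))) \<partial>lborel) \<partial>lborel)"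
    by (rule lborel_pair.Fubini') measurable
  also have "\<dots> = (\<integral>\<^sup>+y. ennreal (q powr s * (b / s)) * (ennreal (y powr ((1 - s) - 1) * (1 - y) powr (b - 1)) * indicator {0<..<1} y) \<partial>lborel)"
  proof (intro nn_integral_cong)
    fix y :: real
    show "(\<integral>\<^sup>+t. ennreal (t powr (s - 1) * (b * (1 - y) powr (b - 1)) * (indicator {0<..} t * indicator {0<..<1} y * indicator {..q} (y * t))) \<partial>lborel)
      = ennreal (q powr s * (b / s)) * (ennreal (y powr ((1 - s) - 1) * (1 - y) powr (b - 1)) * indicator {0<..<1} y)"
    proof (cases "y \<in> {0<..<1}")
      case True
      have "(\<integral>\<^sup>+t. ennreal (t powr (s - 1) * (b * (1 - y) powr (b - 1)) * (indicator {0<..} t * indicator {0<..<1} y * indicator {..q} (y * t))) \<partial>lborel)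
        = (\<integral>\<^sup>+t. ennreal (b * (1 - y) powr (b - 1)) * (ennreal (t powr (s - 1)) * indicator {0..q / y} t) \<partial>lborel)"
      proof (rule nn_integral_cong_off_point[where c = 0])
        fix t :: real assume "t \<noteq> 0"
        then show "ennreal (t powr (s - 1) * (b * (1 - y) powr (b - 1)) * (indicator {0<..} t * indicator {0<..<1} y * indicator {..q} (y * t))) =
          ennreal (b * (1 - y) powr (b - 1)) * (ennreal (t powr (s - 1)) * indicator {0..q / y} t)"
          using True b by (auto split: split_indicator simp: ennreal_mult[symmetric] field_simps)
      qed
      also have "\<dots> = ennreal (b * (1 - y) powr (b - 1)) * (\<integral>\<^sup>+t\<in>{0..q / y}. ennreal (t powr (s - 1)) \<partial>lborel)"
        by (subst nn_integral_cmult) auto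
      also have "(\<integral>\<^sup>+t\<in>{0..q / y}. ennreal (t powr (s - 1)) \<partial>lborel) = ennreal ((q / y) powr (s - 1 + 1) / (s - 1 + 1))"
        using s q True by (intro nn_integral_has_integral_lebesgue' has_integral_powr_from_0) auto
      finally show ?thesis
        using True s b q by (simp add: ennreal_mult[symmetric] powr_divide powr_minus_divide mult_ac)
    qed simp
  qed
  also have "\<dots> = ennreal (q powr s * (b / s)) * ennreal (Beta (1 - s) b)"
    using s b by (subst nn_integral_cmult, measurable, subst nn_integral_Beta_real) auto
  also have "\<dots> = ennreal (q powr s * (b / s * Beta (1 - s) b))"
    using s b by (simp add: ennreal_mult[symmetric] Beta_real_nonneg mult.assoc)
  finally show ?thesis .
qed

text \<open>
  The first integral is, up to normalisation, the Gaussian average of the ground state at time \<open>t\<close>. The identity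
  \<open>(1 - z)^(b - 1) + (1 - (1 - z)^b) = 1 + z (1 - z)^(b - 1)\<close> behind the lemma replaces it by the ground state
  and two nonnegative corrections that are integrable against \<open>t^(s - 1)\<close>.
\<close>

lemma nn_integral_cutoff_decomposition:
  fixes a b r t :: real
  assumes a: "a > 0" and b: "b > 0" and r: "r > 0" and t: "t > 0"
  shows "(\<integral>\<^sup>+q\<in>{0<..<t}. ennreal (q powr (a - 1) * (1 - q / t) powr (b - 1) * exp (- (q * r))) \<partial>lborel)
    + (\<integral>\<^sup>+q\<in>{0<..}. ennreal (q powr (a - 1) * exp (- (r * q)) * (1 - max 0 (1 - q / t) powr b)) \<partial>lborel)
    = ennreal (Gamma a * r powr (- a))
    + (\<integral>\<^sup>+q\<in>{0<..}. ennreal (q powr (a - 1) * exp (- (r * q)) * (q / t * max 0 (1 - q / t) powr (b - 1))) \<partial>lborel)"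
proof -
  have 1: "max 0 (1 - q / t) powr b \<le> 1" if "q > 0" for q
    using that t b by (intro powr_le1) auto
  have "ennreal (Gamma a * r powr (- a)) = (\<integral>\<^sup>+q\<in>{0<..}. ennreal (q powr (a - 1) * exp (- (r * q))) \<partial>lborel)"
    using a r by (simp add: nn_integral_Gamma_exp powr_minus_divide)
  then have "ennreal (Gamma a * r powr (- a))
    + (\<integral>\<^sup>+q\<in>{0<..}. ennreal (q powr (a - 1) * exp (- (r * q)) * (q / t * max 0 (1 - q / t) powr (b - 1))) \<partial>lborel)
    = (\<integral>\<^sup>+q. ennreal (q powr (a - 1) * exp (- (r * q))) * indicator {0<..} q +
       ennreal (q powr (a - 1) * exp (- (r * q)) * (q / t * max 0 (1 - q / t) powr (b - 1))) * indicator {0<..} q \<partial>lborel)"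
    by (subst nn_integral_add) auto
  also have "\<dots> = (\<integral>\<^sup>+q. ennreal (q powr (a - 1) * (1 - q / t) powr (b - 1) * exp (- (q * r))) * indicator {0<..<t} q
     + ennreal (q powr (a - 1) * exp (- (r * q)) * (1 - max 0 (1 - q / t) powr b)) * indicator {0<..} q \<partial>lborel)"
  proof (intro nn_integral_cong)
    fix q :: real
    consider "q \<le> 0" | "0 < q" "q < t" | "0 < q" "q \<ge> t" by linarith
    then show "ennreal (q powr (a - 1) * exp (- (r * q))) * indicator {0<..} q +
       ennreal (q powr (a - 1) * exp (- (r * q)) * (q / t * max 0 (1 - q / t) powr (b - 1))) * indicator {0<..} q
      = ennreal (q powr (a - 1) * (1 - q / t) powr (b - 1) * exp (- (q * r))) * indicator {0<..<t} q
     + ennreal (q powr (a - 1) * exp (- (r * q)) * (1 - max 0 (1 - q / t) powr b)) * indicator {0<..} q"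
    proof cases
      case 2
      then have m: "max 0 (1 - q / t) = 1 - q / t" using t by (simp add: field_simps max_def)
      have D: "q / t * (1 - q / t) powr (b - 1) = (1 - q / t) powr (b - 1) - (1 - q / t) powr b"
      proof -
        have "(1 - q / t) powr b = (1 - q / t) * (1 - q / t) powr (b - 1)"
          using 2 t by (subst powr_mult_base) auto
        then show ?thesis by (simp add: algebra_simps)
      qed
      have "q powr (a - 1) * exp (- (r * q)) + q powr (a - 1) * exp (- (r * q)) * (q / t * (1 - q / t) powr (b - 1))
        = q powr (a - 1) * (1 - q / t) powr (b - 1) * exp (- (q * r)) + q powr (a - 1) * exp (- (r * q)) * (1 - (1 - q / t) powr b)"
        unfolding D by (simp add: algebra_simps)
      with 2 t 1[of q] show ?thesis unfolding m
        by (simp add: ennreal_plus[symmetric] del: ennreal_plus)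
    next
      case 3
      \<comment> \<open>For \<open>q \<ge> t\<close> the averaged integrand is absent and both
        cut-off factors vanish. This includes \<open>q = t\<close> with \<open>b \<le> 1\<close>,
        since \<open>0 powr (b - 1)\<close> is 0 by convention.\<close>
      then have "max 0 (1 - q / t) = 0" using t by (simp add: field_simps max_def)
      with 3 show ?thesis by simp
    qed auto
  qed
  also have "\<dots> = (\<integral>\<^sup>+q\<in>{0<..<t}. ennreal (q powr (a - 1) * (1 - q / t) powr (b - 1) * exp (- (q * r))) \<partial>lborel)
    + (\<integral>\<^sup>+q\<in>{0<..}. ennreal (q powr (a - 1) * exp (- (r * q)) * (1 - max 0 (1 - q / t) powr b)) \<partial>lborel)"
    by (subst nn_integral_add) auto
  finally show ?thesis by simp
qed

text \<open>Integrating in \<open>t\<close> first contributes \<open>q powr s\<close>, which raises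
  the Gamma weight from \<open>a\<close> to \<open>a + s\<close>. Multiplied by the inverse of the
  ground state, the resulting power of \<open>r\<close> becomes the Hardy weight.\<close>

lemma nn_integral_cutoff_product:
  fixes F :: "real \<Rightarrow> real \<Rightarrow> real"
  assumes [measurable]: "case_prod F \<in> borel_measurable (borel \<Otimes>\<^sub>M borel)"
    and F0: "\<And>q t. q > 0 \<Longrightarrow> t > 0 \<Longrightarrow> F q t \<ge> 0" and a: "a > 0" and s: "s > 0" and r: "r > 0" and K: "K \<ge> 0"
    and F: "\<And>q. q > 0 \<Longrightarrow> (\<integral>\<^sup>+t\<in>{0<..}. ennreal (t powr (s - 1) * F q t) \<partial>lborel) = ennreal (q powr s * K)"
  shows "(\<integral>\<^sup>+t\<in>{0<..}. ennreal (t powr (s - 1)) * (\<integral>\<^sup>+q\<in>{0<..}. ennreal (q powr (a - 1) * exp (- (r * q)) * F q t) \<partial>lborel) \<partial>lborel)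
    = ennreal (Gamma (a + s) * r powr (- (a + s)) * K)"
proof -
  have "(\<integral>\<^sup>+t\<in>{0<..}. ennreal (t powr (s - 1)) * (\<integral>\<^sup>+q\<in>{0<..}. ennreal (q powr (a - 1) * exp (- (r * q)) * F q t) \<partial>lborel) \<partial>lborel)
    = (\<integral>\<^sup>+t. (\<integral>\<^sup>+q. ennreal (q powr (a - 1) * exp (- (r * q)) * (t powr (s - 1) * F q t)) * (indicator {0<..} q * indicator {0<..} t) \<partial>lborel) \<partial>lborel)"
    by (intro nn_integral_cong, subst nn_integral_cmult[symmetric], measurable, subst nn_integral_multc[symmetric], measurable)
      (auto intro!: nn_integral_cong split: split_indicator simp: ennreal_mult[symmetric] F0 mult_ac)
  also have "\<dots> = (\<integral>\<^sup>+q. (\<integral>\<^sup>+t. ennreal (q powr (a - 1) * exp (- (r * q)) * (t powr (s - 1) * F q t)) * (indicator {0<..} q * indicator {0<..} t) \<partial>lborel) \<partial>lborel)"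
    by (rule lborel_pair.Fubini') measurable
  also have "\<dots> = (\<integral>\<^sup>+q. ennreal K * (ennreal (q powr (a + s - 1) * exp (- (r * q))) * indicator {0<..} q) \<partial>lborel)"
  proof (intro nn_integral_cong)
    fix q :: real
    show "(\<integral>\<^sup>+t. ennreal (q powr (a - 1) * exp (- (r * q)) * (t powr (s - 1) * F q t)) * (indicator {0<..} q * indicator {0<..} t) \<partial>lborel)
      = ennreal K * (ennreal (q powr (a + s - 1) * exp (- (r * q))) * indicator {0<..} q)"
    proof (cases "q > 0")
      case True
      have "(\<integral>\<^sup>+t. ennreal (q powr (a - 1) * exp (- (r * q)) * (t powr (s - 1) * F q t)) * (indicator {0<..} q * indicator {0<..} t) \<partial>lborel)
        = (\<integral>\<^sup>+t. ennreal (q powr (a - 1) * exp (- (r * q))) * (ennreal (t powr (s - 1) * F q t) * indicator {0<..} t) \<partial>lborel)"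
        using True by (intro nn_integral_cong) (auto split: split_indicator simp: ennreal_mult[symmetric] F0)
      also have "\<dots> = ennreal (q powr (a - 1) * exp (- (r * q))) * ennreal (q powr s * K)"
        using True by (subst nn_integral_cmult) (auto simp: F)
      finally show ?thesis using True K
        by (simp add: ennreal_mult[symmetric] powr_add powr_diff mult_ac)
    qed simp
  qed
  also have "\<dots> = ennreal K * ennreal (Gamma (a + s) / r powr (a + s))"
    using a s r by (subst nn_integral_cmult) (auto simp: nn_integral_Gamma_exp)
  also have "\<dots> = ennreal (Gamma (a + s) * r powr (- (a + s)) * K)"
    using a s r K unfolding powr_minus_divide
    by (subst ennreal_mult[symmetric]) (auto simp: Gamma_real_pos less_imp_le mult.commute)
  finally show ?thesis .
qed


section \<open>The ground state representation\<close>

definition frac_energy :: "real \<Rightarrow> ('a::euclidean_space \<Rightarrow> real) \<Rightarrow> ennreal" where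
  "frac_energy s u = (\<integral>\<^sup>+x. \<integral>\<^sup>+y. ennreal ((u x - u y)\<^sup>2 / norm (x - y) powr (real DIM('a) + 2 * s)) \<partial>lborel \<partial>lborel)"

definition hardy_integral :: "real \<Rightarrow> 'a::euclidean_space \<Rightarrow> ('a \<Rightarrow> real) \<Rightarrow> ennreal" where
  "hardy_integral s p u = (\<integral>\<^sup>+x. ennreal ((u x)\<^sup>2 / norm (x - p) powr (2 * s)) \<partial>lborel)"

lemma norm_powr_eq_inner_powr: "norm (z::'a::real_inner) powr (2 * c) = (z \<bullet> z) powr c"
  by (cases "z = 0") (simp_all add: powr_powr[symmetric] powr_numeral power2_norm_eq_inner)

lemma norm_powr_eq_inner_powr': "norm (z::'a::real_inner) powr c = (z \<bullet> z) powr (c / 2)"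
  using norm_powr_eq_inner_powr[of z "c / 2"] by simp

text \<open>The singular kernel is an integral of Gaussians over their rate \<open>t\<close>. On the
  diagonal the quotient is 0 by the convention for division while the Gaussians do not decay, which
  is why \<open>k x x = 0\<close> is assumed.\<close>

lemma nn_integral_kernel_subordination:
  fixes k :: "'a::euclidean_space \<Rightarrow> 'a \<Rightarrow> real"
  assumes [measurable]: "case_prod k \<in> borel_measurable (borel \<Otimes>\<^sub>M borel)"
    and k0: "\<And>x y. k x y \<ge> 0" and kd: "\<And>x. k x x = 0" and c: "c > 0"
  shows "ennreal (Gamma (c / 2)) * (\<integral>\<^sup>+x. \<integral>\<^sup>+y. ennreal (k x y / norm (x - y) powr c) \<partial>lborel \<partial>lborel) =
    (\<integral>\<^sup>+t\<in>{0<..}. ennreal (t powr (c / 2 - 1)) *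
      (\<integral>\<^sup>+x. \<integral>\<^sup>+y. ennreal (k x y * exp (- (t * ((x - y) \<bullet> (x - y))))) \<partial>lborel \<partial>lborel) \<partial>lborel)"
proof -
  have "ennreal (Gamma (c / 2)) * (\<integral>\<^sup>+x. \<integral>\<^sup>+y. ennreal (k x y / norm (x - y) powr c) \<partial>lborel \<partial>lborel)
    = (\<integral>\<^sup>+x. \<integral>\<^sup>+y. ennreal (Gamma (c / 2)) * ennreal (k x y / norm (x - y) powr c) \<partial>lborel \<partial>lborel)"
    by (simp add: nn_integral_cmult)
  also have "\<dots> = (\<integral>\<^sup>+x. \<integral>\<^sup>+y. (\<integral>\<^sup>+t. ennreal (t powr (c / 2 - 1)) * ennreal (k x y * exp (- (t * ((x - y) \<bullet> (x - y))))) * indicator {0<..} t \<partial>lborel) \<partial>lborel \<partial>lborel)"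
  proof (intro nn_integral_cong)
    fix x y :: 'a
    show "ennreal (Gamma (c / 2)) * ennreal (k x y / norm (x - y) powr c) =
      (\<integral>\<^sup>+t. ennreal (t powr (c / 2 - 1)) * ennreal (k x y * exp (- (t * ((x - y) \<bullet> (x - y))))) * indicator {0<..} t \<partial>lborel)"
    proof (cases "x = y")
      case False
      then have xy: "(x - y) \<bullet> (x - y) > 0" by simp
      have "ennreal (Gamma (c / 2)) * ennreal (k x y / norm (x - y) powr c) =
        ennreal (k x y) * ennreal (Gamma (c / 2) / ((x - y) \<bullet> (x - y)) powr (c / 2))"
        using c k0 by (simp add: ennreal_mult[symmetric] Gamma_real_pos less_imp_le norm_powr_eq_inner_powr' mult.commute)
      also have "\<dots> = ennreal (k x y) * (\<integral>\<^sup>+t\<in>{0<..}. ennreal (t powr (c / 2 - 1) * exp (- (((x - y) \<bullet> (x - y)) * t))) \<partial>lborel)"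
        using c xy by (simp add: nn_integral_Gamma_exp)
      also have "\<dots> = (\<integral>\<^sup>+t. ennreal (t powr (c / 2 - 1)) * ennreal (k x y * exp (- (t * ((x - y) \<bullet> (x - y))))) * indicator {0<..} t \<partial>lborel)"
        by (subst nn_integral_cmult[symmetric])
          (auto intro!: nn_integral_cong split: split_indicator simp: ennreal_mult[symmetric] k0 mult_ac)
      finally show ?thesis .
    qed (simp add: kd)
  qed
  also have "\<dots> = (\<integral>\<^sup>+x. \<integral>\<^sup>+t. (\<integral>\<^sup>+y. ennreal (t powr (c / 2 - 1)) * ennreal (k x y * exp (- (t * ((x - y) \<bullet> (x - y))))) * indicator {0<..} t \<partial>lborel) \<partial>lborel \<partial>lborel)"
    by (intro nn_integral_cong, rule lborel_pair.Fubini') measurable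
  also have "\<dots> = (\<integral>\<^sup>+t. \<integral>\<^sup>+x. (\<integral>\<^sup>+y. ennreal (t powr (c / 2 - 1)) * ennreal (k x y * exp (- (t * ((x - y) \<bullet> (x - y))))) * indicator {0<..} t \<partial>lborel) \<partial>lborel \<partial>lborel)"
    by (rule lborel_pair.Fubini') measurable
  also have "\<dots> = (\<integral>\<^sup>+t\<in>{0<..}. ennreal (t powr (c / 2 - 1)) *
      (\<integral>\<^sup>+x. \<integral>\<^sup>+y. ennreal (k x y * exp (- (t * ((x - y) \<bullet> (x - y))))) \<partial>lborel \<partial>lborel) \<partial>lborel)"
    by (simp add: nn_integral_cmult nn_integral_multc)
  finally show ?thesis .
qed

lemma ennreal_add_left_cancel_finite:
  "(c::ennreal) < \<infinity> \<Longrightarrow> x + c = y + c \<Longrightarrow> x = y"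
  by (metis add.commute ennreal_add_left_cancel less_irrefl infinity_ennreal_def)

context
  fixes s a b :: real and u :: "'a::euclidean_space \<Rightarrow> real"
  assumes s: "0 < s" "s < 1" and a: "a > 0" and ba: "b = a + s" and ab: "a + b = real DIM('a) / 2"
    and um [measurable]: "u \<in> borel_measurable borel"
    and L2: "(\<integral>\<^sup>+x. ennreal ((u x)\<^sup>2) \<partial>lborel) < \<infinity>"
begin

text \<open>The hypotheses amount to \<open>a = (N - 2 * s) / 4\<close> and
  \<open>b = (N + 2 * s) / 4\<close>. So \<open>wt\<close> is the ground state, of homogeneity
  \<open>- (N / 2 - s)\<close>, and \<open>vt\<close> is \<open>u\<close> divided by it;
  \<open>cut1\<close> and \<open>cut2\<close> are the two corrections in
  \<open>nn_integral_cutoff_decomposition\<close>.\<close>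

private definition "wt x = (x \<bullet> x :: real) powr (- a)" for x :: 'a
private definition "vt x = u x * (x \<bullet> x) powr a" for x :: 'a
private definition "gk t x y = exp (- (t * ((x - y) \<bullet> (x - y))))" for t :: real and x y :: 'a
private definition "cut1 r t = (\<integral>\<^sup>+q\<in>{0<..}. ennreal (q powr (a - 1) * exp (- (r * q)) * (1 - max 0 (1 - q / t) powr b)) \<partial>lborel)" for r t :: real
private definition "cut2 r t = (\<integral>\<^sup>+q\<in>{0<..}. ennreal (q powr (a - 1) * exp (- (r * q)) * (q / t * max 0 (1 - q / t) powr (b - 1))) \<partial>lborel)" for r t :: real

private lemma b: "b > 0" using a ba s by simp

private lemma meas [measurable]:
  "wt \<in> borel_measurable borel" "vt \<in> borel_measurable borel"
  "case_prod (gk t) \<in> borel_measurable (borel \<Otimes>\<^sub>M borel)"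
  "case_prod cut1 \<in> borel_measurable (borel \<Otimes>\<^sub>M borel)"
  "case_prod cut2 \<in> borel_measurable (borel \<Otimes>\<^sub>M borel)"
  unfolding wt_def vt_def gk_def cut1_def cut2_def by measurable

private lemma gauss_wt:
  assumes t: "t > 0"
  shows "ennreal (Gamma a) * (\<integral>\<^sup>+y. ennreal (wt y * gk t x y) \<partial>lborel) =
    ennreal ((pi / t) powr (real DIM('a) / 2)) *
      (\<integral>\<^sup>+q\<in>{0<..<t}. ennreal (q powr (a - 1) * (1 - q / t) powr (b - 1) * exp (- (q * (x \<bullet> x)))) \<partial>lborel)"
proof -
  have "ennreal (Gamma a) * (\<integral>\<^sup>+y. ennreal (wt y * gk t x y) \<partial>lborel) =
     (\<integral>\<^sup>+y. ennreal (Gamma a * (y \<bullet> y) powr (- a) * exp (- (t * ((x - y) \<bullet> (x - y))))) \<partial>lborel)"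
    using a by (subst nn_integral_cmult[symmetric])
      (auto simp: wt_def gk_def ennreal_mult[symmetric] Gamma_real_pos less_imp_le mult.assoc)
  then show ?thesis using nn_integral_riesz_gaussian[OF a ab t, of x] by simp
qed

private lemma gauss_mass:
  assumes t: "t > 0"
  shows "(\<integral>\<^sup>+y. ennreal (gk t x y) \<partial>lborel) = ennreal ((pi / t) powr (real DIM('a) / 2))"
proof -
  have "(\<integral>\<^sup>+y. ennreal (gk t x y) \<partial>lborel) = (\<integral>\<^sup>+y. ennreal (exp (- (t * ((y - x) \<bullet> (y - x))))) \<partial>lborel)"
    by (intro nn_integral_cong) (simp add: gk_def inner_diff_left inner_diff_right inner_commute)
  also have "\<dots> = (\<integral>\<^sup>+y. ennreal (exp (- (t * (y \<bullet> y)))) \<partial>(lborel :: 'a measure))"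
    by (rule nn_integral_lborel_translate[of "\<lambda>y. ennreal (exp (- (t * (y \<bullet> y))))"]) measurable
  finally show ?thesis using nn_integral_gaussian[OF t, where 'a = 'a] by simp
qed

private lemma gk_sym: "gk t x y = gk t y x"
  by (simp add: gk_def inner_diff_left inner_diff_right inner_commute)

text \<open>The expressions \<open>(u x - u y)^2\<close> and
  \<open>wt x * wt y * (vt x - vt y)^2\<close> have the same mixed term, so they differ only by
  multiples of \<open>(u x)^2\<close> and \<open>(u y)^2\<close>. Against a Gaussian the plain
  squares give the mass of \<open>u\<close>, and the weighted ones give the Gaussian average of the
  ground state, which is then compared with the ground state itself.\<close>

private lemma fixed_time:
  assumes t: "t > 0"
  shows "ennreal (Gamma a) * (\<integral>\<^sup>+x. \<integral>\<^sup>+y. ennreal ((u x - u y)\<^sup>2 * gk t x y) \<partial>lborel \<partial>lborel)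
      + 2 * ennreal ((pi / t) powr (real DIM('a) / 2)) * (\<integral>\<^sup>+x. ennreal ((u x)\<^sup>2 * (x \<bullet> x) powr a) * cut2 (x \<bullet> x) t \<partial>lborel)
    = ennreal (Gamma a) * (\<integral>\<^sup>+x. \<integral>\<^sup>+y. ennreal (wt x * wt y * (vt x - vt y)\<^sup>2 * gk t x y) \<partial>lborel \<partial>lborel)
      + 2 * ennreal ((pi / t) powr (real DIM('a) / 2)) * (\<integral>\<^sup>+x. ennreal ((u x)\<^sup>2 * (x \<bullet> x) powr a) * cut1 (x \<bullet> x) t \<partial>lborel)"
    (is "?\<Gamma> * ?E + 2 * ?c * ?B = ?\<Gamma> * ?R + 2 * ?c * ?A")
proof -
  define U where "U = (\<integral>\<^sup>+x. ennreal ((u x)\<^sup>2) \<partial>lborel)"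
  define Phi where "Phi x = (\<integral>\<^sup>+q\<in>{0<..<t}. ennreal (q powr (a - 1) * (1 - q / t) powr (b - 1) * exp (- (q * (x \<bullet> x)))) \<partial>lborel)" for x :: 'a
  define P where "P = (\<integral>\<^sup>+x. ennreal ((u x)\<^sup>2 * (x \<bullet> x) powr a) * Phi x \<partial>lborel)"
  have [measurable]: "Phi \<in> borel_measurable borel" unfolding Phi_def by measurable
  have pw: "ennreal ((u x - u y)\<^sup>2 * gk t x y) + (ennreal ((u x)\<^sup>2 * (x \<bullet> x) powr a) * ennreal (wt y * gk t x y)
      + ennreal ((u y)\<^sup>2 * (y \<bullet> y) powr a) * ennreal (wt x * gk t x y))
    = (ennreal ((u x)\<^sup>2 * gk t x y) + ennreal ((u y)\<^sup>2 * gk t x y)) + ennreal (wt x * wt y * (vt x - vt y)\<^sup>2 * gk t x y)"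
    if "x \<noteq> 0" "y \<noteq> 0" for x y
  proof -
    define X Y where "X = (x \<bullet> x) powr a" and "Y = (y \<bullet> y) powr a"
    have XY: "X > 0" "Y > 0" "wt x = inverse X" "wt y = inverse Y" "vt x = u x * X" "vt y = u y * Y"
      using that by (auto simp: X_def Y_def wt_def vt_def powr_minus)
    have g: "gk t x y > 0" by (simp add: gk_def)
    have "(u x - u y)\<^sup>2 + (u x)\<^sup>2 * X * inverse Y + (u y)\<^sup>2 * Y * inverse X
       = (u x)\<^sup>2 + (u y)\<^sup>2 + inverse X * inverse Y * (u x * X - u y * Y)\<^sup>2"
      using XY(1,2) by (simp add: field_simps power2_eq_square)
    then have "((u x - u y)\<^sup>2 + (u x)\<^sup>2 * X * inverse Y + (u y)\<^sup>2 * Y * inverse X) * gk t x y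
       = ((u x)\<^sup>2 + (u y)\<^sup>2 + inverse X * inverse Y * (u x * X - u y * Y)\<^sup>2) * gk t x y" by simp
    then have "(u x - u y)\<^sup>2 * gk t x y + ((u x)\<^sup>2 * X * (inverse Y * gk t x y) + (u y)\<^sup>2 * Y * (inverse X * gk t x y))
       = ((u x)\<^sup>2 * gk t x y + (u y)\<^sup>2 * gk t x y) + inverse X * inverse Y * (u x * X - u y * Y)\<^sup>2 * gk t x y"
      by (simp add: algebra_simps)
    then show ?thesis
      unfolding XY X_def[symmetric] Y_def[symmetric] using g XY(1,2)
      by (simp add: ennreal_mult[symmetric] ennreal_plus[symmetric] del: ennreal_plus)
  qed
  have swap: "(\<integral>\<^sup>+x. \<integral>\<^sup>+y. h y * ennreal (k x y) \<partial>lborel \<partial>lborel) = (\<integral>\<^sup>+x. h x * (\<integral>\<^sup>+y. ennreal (k y x) \<partial>lborel) \<partial>lborel)"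
    if [measurable]: "h \<in> borel_measurable borel" "case_prod k \<in> borel_measurable (borel \<Otimes>\<^sub>M borel)" for h :: "'a \<Rightarrow> ennreal" and k :: "'a \<Rightarrow> 'a \<Rightarrow> real"
    by (subst lborel_pair.Fubini') (simp_all add: nn_integral_cmult)
  have borel_measurable_u2: "(\<lambda>x. ennreal ((u x)\<^sup>2)) \<in> borel_measurable borel" by measurable
  have e1: "ennreal ((u z)\<^sup>2 * gk t x y) = ennreal ((u z)\<^sup>2) * ennreal (gk t x y)" for x y z
    by (simp add: ennreal_mult gk_def)
  have "(\<integral>\<^sup>+x. \<integral>\<^sup>+y. (ennreal ((u x - u y)\<^sup>2 * gk t x y) + (ennreal ((u x)\<^sup>2 * (x \<bullet> x) powr a) * ennreal (wt y * gk t x y)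
      + ennreal ((u y)\<^sup>2 * (y \<bullet> y) powr a) * ennreal (wt x * gk t x y))) \<partial>lborel \<partial>lborel)
    = (\<integral>\<^sup>+x. \<integral>\<^sup>+y. (ennreal ((u x)\<^sup>2 * gk t x y) + ennreal ((u y)\<^sup>2 * gk t x y)) + ennreal (wt x * wt y * (vt x - vt y)\<^sup>2 * gk t x y) \<partial>lborel \<partial>lborel)"
  proof (rule nn_integral_cong_off_point[where c = 0])
    fix x :: 'a assume "x \<noteq> 0"
    then show "(\<integral>\<^sup>+y. (ennreal ((u x - u y)\<^sup>2 * gk t x y) + (ennreal ((u x)\<^sup>2 * (x \<bullet> x) powr a) * ennreal (wt y * gk t x y)
      + ennreal ((u y)\<^sup>2 * (y \<bullet> y) powr a) * ennreal (wt x * gk t x y))) \<partial>lborel)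
      = (\<integral>\<^sup>+y. (ennreal ((u x)\<^sup>2 * gk t x y) + ennreal ((u y)\<^sup>2 * gk t x y)) + ennreal (wt x * wt y * (vt x - vt y)\<^sup>2 * gk t x y) \<partial>lborel)"
      by (intro nn_integral_cong_off_point[where c = 0] pw)
  qed
  also have "(\<integral>\<^sup>+x. \<integral>\<^sup>+y. (ennreal ((u x - u y)\<^sup>2 * gk t x y) + (ennreal ((u x)\<^sup>2 * (x \<bullet> x) powr a) * ennreal (wt y * gk t x y)
      + ennreal ((u y)\<^sup>2 * (y \<bullet> y) powr a) * ennreal (wt x * gk t x y))) \<partial>lborel \<partial>lborel)
    = ?E + ((\<integral>\<^sup>+x. ennreal ((u x)\<^sup>2 * (x \<bullet> x) powr a) * (\<integral>\<^sup>+y. ennreal (wt y * gk t x y) \<partial>lborel) \<partial>lborel)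
      + (\<integral>\<^sup>+x. ennreal ((u x)\<^sup>2 * (x \<bullet> x) powr a) * (\<integral>\<^sup>+y. ennreal (wt y * gk t y x) \<partial>lborel) \<partial>lborel))"
    by (simp add: nn_integral_add nn_integral_cmult swap)
  also have "(\<integral>\<^sup>+x. \<integral>\<^sup>+y. (ennreal ((u x)\<^sup>2 * gk t x y) + ennreal ((u y)\<^sup>2 * gk t x y)) + ennreal (wt x * wt y * (vt x - vt y)\<^sup>2 * gk t x y) \<partial>lborel \<partial>lborel)
    = (U * ?c + U * ?c) + ?R"
  proof -
    have "(\<integral>\<^sup>+x. \<integral>\<^sup>+y. ennreal ((u x)\<^sup>2) * ennreal (gk t x y) \<partial>lborel \<partial>lborel) = U * ?c"
      by (simp add: nn_integral_cmult gauss_mass[OF t] U_def nn_integral_multc)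
    moreover have "(\<integral>\<^sup>+x. \<integral>\<^sup>+y. ennreal ((u y)\<^sup>2) * ennreal (gk t x y) \<partial>lborel \<partial>lborel) = U * ?c"
      unfolding swap[OF borel_measurable_u2 meas(3)]
      by (subst gk_sym) (simp add: gauss_mass[OF t] U_def nn_integral_multc)
    ultimately show ?thesis
      unfolding e1 by (simp add: nn_integral_add)
  qed
  finally have id1: "?E + ((\<integral>\<^sup>+x. ennreal ((u x)\<^sup>2 * (x \<bullet> x) powr a) * (\<integral>\<^sup>+y. ennreal (wt y * gk t x y) \<partial>lborel) \<partial>lborel)
      + (\<integral>\<^sup>+x. ennreal ((u x)\<^sup>2 * (x \<bullet> x) powr a) * (\<integral>\<^sup>+y. ennreal (wt y * gk t y x) \<partial>lborel) \<partial>lborel)) = (U * ?c + U * ?c) + ?R" .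
  have cP: "?\<Gamma> * (\<integral>\<^sup>+x. ennreal ((u x)\<^sup>2 * (x \<bullet> x) powr a) * (\<integral>\<^sup>+y. ennreal (wt y * gk t x y) \<partial>lborel) \<partial>lborel) = ?c * P"
  proof -
    have "?\<Gamma> * (\<integral>\<^sup>+x. ennreal ((u x)\<^sup>2 * (x \<bullet> x) powr a) * (\<integral>\<^sup>+y. ennreal (wt y * gk t x y) \<partial>lborel) \<partial>lborel)
      = (\<integral>\<^sup>+x. ennreal ((u x)\<^sup>2 * (x \<bullet> x) powr a) * (?\<Gamma> * (\<integral>\<^sup>+y. ennreal (wt y * gk t x y) \<partial>lborel)) \<partial>lborel)"
      by (subst nn_integral_cmult[symmetric]) (auto simp: mult_ac)
    also have "\<dots> = ?c * P"
      unfolding gauss_wt[OF t] P_def Phi_def[symmetric]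
      by (subst nn_integral_cmult[symmetric]) (auto simp: mult_ac)
    finally show ?thesis .
  qed
  have cP': "?\<Gamma> * (\<integral>\<^sup>+x. ennreal ((u x)\<^sup>2 * (x \<bullet> x) powr a) * (\<integral>\<^sup>+y. ennreal (wt y * gk t y x) \<partial>lborel) \<partial>lborel) = ?c * P"
    by (subst gk_sym) (rule cP)
  have "?\<Gamma> * ?E + (?c * P + ?c * P) = ?\<Gamma> * ((U * ?c + U * ?c) + ?R)"
    unfolding id1[symmetric] distrib_left cP cP' ..
  also have "\<dots> = 2 * ?c * (?\<Gamma> * U) + ?\<Gamma> * ?R"
    by (simp only: distrib_left mult_2[symmetric] mult_ac)
  finally have id2: "?\<Gamma> * ?E + 2 * ?c * P = 2 * ?c * (?\<Gamma> * U) + ?\<Gamma> * ?R"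
    by (simp only: mult_2[symmetric] mult.assoc)
  \<comment> \<open>\<open>P\<close> pairs the square of \<open>u\<close> with the averaged ground
    state. Trading the average for the ground state gives back the mass \<open>U\<close>, up to the
    two corrections.\<close>
  have id3: "P + ?A = ?\<Gamma> * U + ?B"
  proof -
    have "P + ?A = (\<integral>\<^sup>+x. ennreal ((u x)\<^sup>2 * (x \<bullet> x) powr a) * (Phi x + cut1 (x \<bullet> x) t) \<partial>lborel)"
      unfolding P_def by (subst nn_integral_add[symmetric]) (auto simp: distrib_left)
    also have "\<dots> = (\<integral>\<^sup>+x. ?\<Gamma> * ennreal ((u x)\<^sup>2) + ennreal ((u x)\<^sup>2 * (x \<bullet> x) powr a) * cut2 (x \<bullet> x) t \<partial>lborel)"
    proof (rule nn_integral_cong_off_point[where c = 0])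
      fix x :: 'a assume "x \<noteq> 0"
      then have r: "x \<bullet> x > 0" by simp
      have "Phi x + cut1 (x \<bullet> x) t = ennreal (Gamma a * (x \<bullet> x) powr - a) + cut2 (x \<bullet> x) t"
        unfolding Phi_def cut1_def cut2_def by (rule nn_integral_cutoff_decomposition[OF a b r t])
      moreover have "ennreal ((u x)\<^sup>2 * (x \<bullet> x) powr a) * ennreal (Gamma a * (x \<bullet> x) powr - a) = ?\<Gamma> * ennreal ((u x)\<^sup>2)"
        using r a by (simp add: ennreal_mult[symmetric] Gamma_real_pos less_imp_le powr_minus field_simps)
      ultimately show "ennreal ((u x)\<^sup>2 * (x \<bullet> x) powr a) * (Phi x + cut1 (x \<bullet> x) t)
        = ?\<Gamma> * ennreal ((u x)\<^sup>2) + ennreal ((u x)\<^sup>2 * (x \<bullet> x) powr a) * cut2 (x \<bullet> x) t"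
        by (simp add: distrib_left)
    qed
    also have "\<dots> = ?\<Gamma> * U + ?B"
      unfolding U_def by (subst nn_integral_add) (auto simp: nn_integral_cmult)
    finally show ?thesis .
  qed
  \<comment> \<open>Square integrability enters here: equal mass terms stand on both sides, are
    finite, and cancel before anything is integrated over \<open>t\<close>.\<close>
  have fin: "2 * ?c * (?\<Gamma> * U) < \<infinity>"
    using L2 by (simp add: U_def ennreal_mult_less_top)
  have "(?\<Gamma> * ?E + 2 * ?c * ?B) + 2 * ?c * (?\<Gamma> * U) = ?\<Gamma> * ?E + 2 * ?c * (?\<Gamma> * U + ?B)"
    by (simp add: distrib_left add_ac)
  also have "\<dots> = (?\<Gamma> * ?E + 2 * ?c * P) + 2 * ?c * ?A"
    unfolding id3[symmetric] by (simp add: distrib_left add_ac)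
  also have "\<dots> = (?\<Gamma> * ?R + 2 * ?c * ?A) + 2 * ?c * (?\<Gamma> * U)"
    unfolding id2 by (simp add: add_ac)
  finally show ?thesis by (rule ennreal_add_left_cancel_finite[OF fin])
qed

text \<open>The Gaussian mass \<open>(pi / t) powr (N / 2)\<close> removes the dimension from the
  subordination weight \<open>t powr (N / 2 + s - 1)\<close> and leaves
  \<open>t powr (s - 1)\<close>, the weight of the Beta integrals.\<close>

private lemma integrate_cut:
  fixes cut :: "real \<Rightarrow> real \<Rightarrow> ennreal"
  assumes [measurable]: "case_prod cut \<in> borel_measurable (borel \<Otimes>\<^sub>M borel)" and K: "K \<ge> 0"
    and cut: "\<And>r. r > 0 \<Longrightarrow> (\<integral>\<^sup>+t\<in>{0<..}. ennreal (t powr (s - 1)) * cut r t \<partial>lborel) = ennreal (Gamma (a + s) * r powr (- (a + s)) * K)"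
  shows "(\<integral>\<^sup>+t\<in>{0<..}. ennreal (t powr (real DIM('a) / 2 + s - 1)) *
      (2 * ennreal ((pi / t) powr (real DIM('a) / 2)) * (\<integral>\<^sup>+x. ennreal ((u x)\<^sup>2 * (x \<bullet> x) powr a) * cut (x \<bullet> x) t \<partial>lborel)) \<partial>lborel)
    = ennreal (2 * pi powr (real DIM('a) / 2) * Gamma b * K) * hardy_integral s 0 u"
proof -
  let ?n = "real DIM('a)"
  have "(\<integral>\<^sup>+t\<in>{0<..}. ennreal (t powr (?n / 2 + s - 1)) *
      (2 * ennreal ((pi / t) powr (?n / 2)) * (\<integral>\<^sup>+x. ennreal ((u x)\<^sup>2 * (x \<bullet> x) powr a) * cut (x \<bullet> x) t \<partial>lborel)) \<partial>lborel)
    = (\<integral>\<^sup>+t. ennreal (2 * pi powr (?n / 2)) * (\<integral>\<^sup>+x. ennreal ((u x)\<^sup>2 * (x \<bullet> x) powr a) * (ennreal (t powr (s - 1)) * cut (x \<bullet> x) t * indicator {0<..} t) \<partial>lborel) \<partial>lborel)"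
  proof (intro nn_integral_cong)
    fix t :: real
    show "ennreal (t powr (?n / 2 + s - 1)) *
      (2 * ennreal ((pi / t) powr (?n / 2)) * (\<integral>\<^sup>+x. ennreal ((u x)\<^sup>2 * (x \<bullet> x) powr a) * cut (x \<bullet> x) t \<partial>lborel)) * indicator {0<..} t =
      ennreal (2 * pi powr (?n / 2)) * (\<integral>\<^sup>+x. ennreal ((u x)\<^sup>2 * (x \<bullet> x) powr a) * (ennreal (t powr (s - 1)) * cut (x \<bullet> x) t * indicator {0<..} t) \<partial>lborel)"
    proof (cases "t > 0")
      case True
      have p: "t powr (?n / 2 + s - 1) * (2 * (pi / t) powr (?n / 2)) = 2 * pi powr (?n / 2) * t powr (s - 1)"
        using True by (simp add: powr_divide powr_add powr_diff)
      have "ennreal (t powr (?n / 2 + s - 1)) * (2 * ennreal ((pi / t) powr (?n / 2))) = ennreal (2 * pi powr (?n / 2)) * ennreal (t powr (s - 1))"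
      proof -
        have "2 * ennreal ((pi / t) powr (?n / 2)) = ennreal (2 * (pi / t) powr (?n / 2))"
          by (simp add: ennreal_mult)
        then show ?thesis using p by (simp only: ennreal_mult[symmetric] powr_ge_zero mult_nonneg_nonneg zero_le_numeral)
      qed
      then have "ennreal (t powr (?n / 2 + s - 1)) *
        (2 * ennreal ((pi / t) powr (?n / 2)) * (\<integral>\<^sup>+x. ennreal ((u x)\<^sup>2 * (x \<bullet> x) powr a) * cut (x \<bullet> x) t \<partial>lborel))
        = ennreal (2 * pi powr (?n / 2)) * (ennreal (t powr (s - 1)) * (\<integral>\<^sup>+x. ennreal ((u x)\<^sup>2 * (x \<bullet> x) powr a) * cut (x \<bullet> x) t \<partial>lborel))"
        by (simp add: mult.assoc[symmetric])
      also have "ennreal (t powr (s - 1)) * (\<integral>\<^sup>+x. ennreal ((u x)\<^sup>2 * (x \<bullet> x) powr a) * cut (x \<bullet> x) t \<partial>lborel)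
        = (\<integral>\<^sup>+x. ennreal ((u x)\<^sup>2 * (x \<bullet> x) powr a) * (ennreal (t powr (s - 1)) * cut (x \<bullet> x) t) \<partial>lborel)"
        by (subst nn_integral_cmult[symmetric]) (auto simp: mult_ac)
      finally show ?thesis using True by simp
    qed simp
  qed
  also have "\<dots> = ennreal (2 * pi powr (?n / 2)) * (\<integral>\<^sup>+t. (\<integral>\<^sup>+x. ennreal ((u x)\<^sup>2 * (x \<bullet> x) powr a) * (ennreal (t powr (s - 1)) * cut (x \<bullet> x) t * indicator {0<..} t) \<partial>lborel) \<partial>lborel)"
    by (rule nn_integral_cmult) measurable
  also have "(\<integral>\<^sup>+t. (\<integral>\<^sup>+x. ennreal ((u x)\<^sup>2 * (x \<bullet> x) powr a) * (ennreal (t powr (s - 1)) * cut (x \<bullet> x) t * indicator {0<..} t) \<partial>lborel) \<partial>lborel)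
    = (\<integral>\<^sup>+x. (\<integral>\<^sup>+t. ennreal ((u x)\<^sup>2 * (x \<bullet> x) powr a) * (ennreal (t powr (s - 1)) * cut (x \<bullet> x) t * indicator {0<..} t) \<partial>lborel) \<partial>lborel)"
    by (rule lborel_pair.Fubini') measurable
  also have "\<dots> = (\<integral>\<^sup>+x. ennreal (Gamma b * K) * ennreal ((u x)\<^sup>2 / norm (x - 0) powr (2 * s)) \<partial>lborel)"
  proof (rule nn_integral_cong_off_point[where c = 0])
    fix x :: 'a assume "x \<noteq> 0"
    then have r: "x \<bullet> x > 0" by simp
    have "(\<integral>\<^sup>+t. ennreal ((u x)\<^sup>2 * (x \<bullet> x) powr a) * (ennreal (t powr (s - 1)) * cut (x \<bullet> x) t * indicator {0<..} t) \<partial>lborel)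
      = ennreal ((u x)\<^sup>2 * (x \<bullet> x) powr a) * ennreal (Gamma (a + s) * (x \<bullet> x) powr (- (a + s)) * K)"
      using cut[OF r] by (subst nn_integral_cmult) auto
    also have "\<dots> = ennreal ((u x)\<^sup>2 * (x \<bullet> x) powr a * (Gamma (a + s) * (x \<bullet> x) powr (- (a + s)) * K))"
      using K b ba by (intro ennreal_mult[symmetric]) (auto simp: Gamma_real_pos less_imp_le)
    also have "(u x)\<^sup>2 * (x \<bullet> x) powr a * (Gamma (a + s) * (x \<bullet> x) powr (- (a + s)) * K) = (Gamma b * K) * ((u x)\<^sup>2 / norm (x - 0) powr (2 * s))"
    proof -
      have "(x \<bullet> x) powr a * (x \<bullet> x) powr (- (a + s)) = inverse (norm (x - 0) powr (2 * s))"
        using r by (simp add: norm_powr_eq_inner_powr powr_add[symmetric] powr_minus)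
      then show ?thesis by (simp add: ba divide_inverse mult_ac)
    qed
    also have "ennreal \<dots> = ennreal (Gamma b * K) * ennreal ((u x)\<^sup>2 / norm (x - 0) powr (2 * s))"
      using K b by (intro ennreal_mult) (auto simp: Gamma_real_pos less_imp_le)
    finally show "(\<integral>\<^sup>+t. ennreal ((u x)\<^sup>2 * (x \<bullet> x) powr a) * (ennreal (t powr (s - 1)) * cut (x \<bullet> x) t * indicator {0<..} t) \<partial>lborel)
      = ennreal (Gamma b * K) * ennreal ((u x)\<^sup>2 / norm (x - 0) powr (2 * s))" .
  qed
  also have "\<dots> = ennreal (Gamma b * K) * hardy_integral s 0 u"
    unfolding hardy_integral_def by (rule nn_integral_cmult) measurable
  finally show ?thesis
    using b K by (simp add: mult.assoc[symmetric] ennreal_mult[symmetric] Gamma_real_pos less_imp_le)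
qed

text \<open>The identity \<open>fixed_time\<close>, integrated against the subordination weight.
  Both corrections become multiples of one Hardy integral; they stay on opposite sides because its
  finiteness is not assumed at this point.\<close>

lemma ground_state_representation_aux:
  "ennreal (Gamma a * Gamma (real DIM('a) / 2 + s)) * frac_energy s u
      + ennreal (2 * pi powr (real DIM('a) / 2) * Gamma b * Beta (1 - s) b) * hardy_integral s 0 u
    = ennreal (Gamma a * Gamma (real DIM('a) / 2 + s)) *
      (\<integral>\<^sup>+x. \<integral>\<^sup>+y. ennreal ((x \<bullet> x) powr (- a) * (y \<bullet> y) powr (- a) * (u x * (x \<bullet> x) powr a - u y * (y \<bullet> y) powr a)\<^sup>2
        / norm (x - y) powr (real DIM('a) + 2 * s)) \<partial>lborel \<partial>lborel)
      + ennreal (2 * pi powr (real DIM('a) / 2) * Gamma b * (b / s * Beta (1 - s) b)) * hardy_integral s 0 u"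
proof -
  let ?n = "real DIM('a)"
  have n: "?n + 2 * s > 0" using s by simp
  have half: "(?n + 2 * s) / 2 = ?n / 2 + s" by simp
  have Beta: "Beta (1 - s) b \<ge> 0" using s b by (intro Beta_real_nonneg) auto
  have G1: "Gamma a > 0" "Gamma (?n / 2 + s) > 0" using a s by (auto intro!: Gamma_real_pos add_nonneg_pos)
  define tp where "tp t = ennreal (t powr (?n / 2 + s - 1))" for t :: real
  have [measurable]: "tp \<in> borel_measurable borel" unfolding tp_def by measurable
  define cc where "cc t = 2 * ennreal ((pi / t) powr (?n / 2))" for t :: real
  have [measurable]: "cc \<in> borel_measurable borel" unfolding cc_def by measurable
  define E where "E t = (\<integral>\<^sup>+x. \<integral>\<^sup>+y. ennreal ((u x - u y)\<^sup>2 * gk t x y) \<partial>lborel \<partial>lborel)" for t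
  define R where "R t = (\<integral>\<^sup>+x. \<integral>\<^sup>+y. ennreal (wt x * wt y * (vt x - vt y)\<^sup>2 * gk t x y) \<partial>lborel \<partial>lborel)" for t
  define A where "A t = (\<integral>\<^sup>+x. ennreal ((u x)\<^sup>2 * (x \<bullet> x) powr a) * cut1 (x \<bullet> x) t \<partial>lborel)" for t
  define B where "B t = (\<integral>\<^sup>+x. ennreal ((u x)\<^sup>2 * (x \<bullet> x) powr a) * cut2 (x \<bullet> x) t \<partial>lborel)" for t
  have [measurable]: "E \<in> borel_measurable borel" "R \<in> borel_measurable borel" "A \<in> borel_measurable borel" "B \<in> borel_measurable borel"
    unfolding E_def R_def A_def B_def gk_def by measurable
  have iE: "ennreal (Gamma (?n / 2 + s)) * frac_energy s u = (\<integral>\<^sup>+t\<in>{0<..}. tp t * E t \<partial>lborel)"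
    unfolding frac_energy_def tp_def E_def gk_def
    using nn_integral_kernel_subordination[OF _ _ _ n, of "\<lambda>x y. (u x - u y)\<^sup>2"] unfolding half by simp
  have iR: "ennreal (Gamma (?n / 2 + s)) * (\<integral>\<^sup>+x. \<integral>\<^sup>+y. ennreal (wt x * wt y * (vt x - vt y)\<^sup>2 / norm (x - y) powr (?n + 2 * s)) \<partial>lborel \<partial>lborel)
    = (\<integral>\<^sup>+t\<in>{0<..}. tp t * R t \<partial>lborel)"
    unfolding tp_def R_def gk_def
    using nn_integral_kernel_subordination[OF _ _ _ n, of "\<lambda>x y. wt x * wt y * (vt x - vt y)\<^sup>2"] unfolding half
    by (simp add: wt_def)
  have iA: "(\<integral>\<^sup>+t\<in>{0<..}. tp t * (cc t * A t) \<partial>lborel) = ennreal (2 * pi powr (?n / 2) * Gamma b * (b / s * Beta (1 - s) b)) * hardy_integral s 0 u"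
    unfolding tp_def A_def cc_def
  proof (rule integrate_cut)
    fix r :: real assume r: "r > 0"
    show "(\<integral>\<^sup>+t\<in>{0<..}. ennreal (t powr (s - 1)) * cut1 r t \<partial>lborel) = ennreal (Gamma (a + s) * r powr (- (a + s)) * (b / s * Beta (1 - s) b))"
      unfolding cut1_def
    proof (rule nn_integral_cutoff_product)
      show "0 \<le> 1 - max 0 (1 - q / t) powr b" if "q > 0" "t > 0" for q t
        using that b by (simp add: powr_le1)
    qed (use s a b r Beta in \<open>auto simp: nn_integral_powr_one_minus_cutoff\<close>)
  qed (use s b Beta in auto)
  have iB: "(\<integral>\<^sup>+t\<in>{0<..}. tp t * (cc t * B t) \<partial>lborel) = ennreal (2 * pi powr (?n / 2) * Gamma b * Beta (1 - s) b) * hardy_integral s 0 u"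
    unfolding tp_def B_def cc_def
  proof (rule integrate_cut)
    fix r :: real assume r: "r > 0"
    show "(\<integral>\<^sup>+t\<in>{0<..}. ennreal (t powr (s - 1)) * cut2 r t \<partial>lborel) = ennreal (Gamma (a + s) * r powr (- (a + s)) * Beta (1 - s) b)"
      unfolding cut2_def
    proof (rule nn_integral_cutoff_product)
      show "(\<integral>\<^sup>+t\<in>{0<..}. ennreal (t powr (s - 1) * (q / t * max 0 (1 - q / t) powr (b - 1))) \<partial>lborel) = ennreal (q powr s * Beta (1 - s) b)"
        if "q > 0" for q
        using that s b by (intro nn_integral_powr_Beta_cutoff) auto
    qed (use s a b r Beta in auto)
  qed (use s b Beta in auto)
  have "ennreal (Gamma a * Gamma (?n / 2 + s)) * frac_energy s u
      + ennreal (2 * pi powr (?n / 2) * Gamma b * Beta (1 - s) b) * hardy_integral s 0 u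
    = ennreal (Gamma a) * (\<integral>\<^sup>+t\<in>{0<..}. tp t * E t \<partial>lborel) + (\<integral>\<^sup>+t\<in>{0<..}. tp t * (cc t * B t) \<partial>lborel)"
    unfolding iE[symmetric] iB using G1 by (simp add: ennreal_mult mult.assoc)
  also have "\<dots> = (\<integral>\<^sup>+t. tp t * (ennreal (Gamma a) * E t + cc t * B t) * indicator {0<..} t \<partial>lborel)"
    by (subst nn_integral_cmult[symmetric], measurable, subst nn_integral_add[symmetric])
      (auto intro!: nn_integral_cong simp: distrib_left distrib_right mult_ac)
  also have "\<dots> = (\<integral>\<^sup>+t. tp t * (ennreal (Gamma a) * R t + cc t * A t) * indicator {0<..} t \<partial>lborel)"
    by (intro nn_integral_cong)
      (auto split: split_indicator simp: E_def R_def A_def B_def cc_def fixed_time)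
  also have "\<dots> = ennreal (Gamma a) * (\<integral>\<^sup>+t\<in>{0<..}. tp t * R t \<partial>lborel) + (\<integral>\<^sup>+t\<in>{0<..}. tp t * (cc t * A t) \<partial>lborel)"
    by (subst nn_integral_cmult[symmetric], measurable, subst nn_integral_add[symmetric])
      (auto intro!: nn_integral_cong simp: distrib_left distrib_right mult_ac)
  also have "\<dots> = ennreal (Gamma a * Gamma (?n / 2 + s)) *
      (\<integral>\<^sup>+x. \<integral>\<^sup>+y. ennreal (wt x * wt y * (vt x - vt y)\<^sup>2 / norm (x - y) powr (?n + 2 * s)) \<partial>lborel \<partial>lborel)
      + ennreal (2 * pi powr (?n / 2) * Gamma b * (b / s * Beta (1 - s) b)) * hardy_integral s 0 u"
    unfolding iR[symmetric] iA using G1 by (simp add: ennreal_mult mult.assoc)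
  finally show ?thesis unfolding wt_def vt_def .
qed

end


section \<open>The ground state representation with its constants\<close>

definition ground_energy :: "real \<Rightarrow> ('a::euclidean_space \<Rightarrow> real) \<Rightarrow> ennreal" where
  "ground_energy s v = (\<integral>\<^sup>+x. \<integral>\<^sup>+y. ennreal (norm x powr (- (real DIM('a) / 2 - s)) * norm y powr (- (real DIM('a) / 2 - s))
    * (v x - v y)\<^sup>2 / norm (x - y) powr (real DIM('a) + 2 * s)) \<partial>lborel \<partial>lborel)"

lemma C_Ns_pos: "0 < s \<Longrightarrow> s < 1 \<Longrightarrow> C_Ns N s > 0"
  unfolding C_Ns_def by (intro mult_pos_pos divide_pos_pos Gamma_real_pos) auto

lemma gamma_H_pos: "0 < s \<Longrightarrow> real N > 2 * s \<Longrightarrow> gamma_H N s > 0"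
  unfolding gamma_H_def by (intro divide_pos_pos mult_pos_pos zero_less_power Gamma_real_pos) auto

text \<open>With a finite Hardy integral the smaller of the two Hardy terms can be cancelled. Since
  \<open>b = a + s\<close>, the coefficients differ by the factor \<open>b / s - 1 = a / s\<close>;
  what remains is normalisation.\<close>

theorem ground_state_representation:
  fixes u :: "'a::euclidean_space \<Rightarrow> real"
  assumes s: "0 < s" "s < 1" and N: "real DIM('a) > 2 * s"
    and um: "u \<in> borel_measurable borel"
    and L2: "(\<integral>\<^sup>+x. ennreal ((u x)\<^sup>2) \<partial>lborel) < \<infinity>" and H: "hardy_integral s 0 u < \<infinity>"
  shows "ennreal (C_Ns DIM('a) s / 2) * frac_energy s u =
    ennreal (C_Ns DIM('a) s / 2) * ground_energy s (\<lambda>x. u x * norm x powr (real DIM('a) / 2 - s))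
    + ennreal (gamma_H DIM('a) s) * hardy_integral s 0 u"
proof -
  let ?n = "real DIM('a)"
  define a b where "a = (?n - 2 * s) / 4" and "b = (?n + 2 * s) / 4"
  have a: "a > 0" and ba: "b = a + s" and ab: "a + b = ?n / 2" and b: "b > 0"
    using N s by (auto simp: a_def b_def field_simps)
  define R where "R = ground_energy s (\<lambda>x. u x * norm x powr (?n / 2 - s))"
  define X where "X = Gamma a * Gamma (?n / 2 + s)"
  define Y where "Y = 2 * pi powr (?n / 2) * Gamma b * Beta (1 - s) b"
  have X: "X > 0" unfolding X_def using a s by (intro mult_pos_pos Gamma_real_pos add_nonneg_pos) auto
  have Y: "Y \<ge> 0" unfolding Y_def using b s by (intro mult_nonneg_nonneg Beta_real_nonneg Gamma_real_nonneg) auto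
  have ha: "?n / 2 - s = 2 * a" by (simp add: a_def)
  have R: "R = (\<integral>\<^sup>+x. \<integral>\<^sup>+y. ennreal ((x \<bullet> x) powr (- a) * (y \<bullet> y) powr (- a) * (u x * (x \<bullet> x) powr a - u y * (y \<bullet> y) powr a)\<^sup>2
        / norm (x - y) powr (?n + 2 * s)) \<partial>lborel \<partial>lborel)"
    unfolding R_def ground_energy_def ha
    by (simp only: norm_powr_eq_inner_powr minus_mult_right)
  have yb: "2 * pi powr (?n / 2) * Gamma b * (b / s * Beta (1 - s) b) = Y * (a / s) + Y"
    using s by (simp add: Y_def ba field_simps)
  have "ennreal X * frac_energy s u + ennreal Y * hardy_integral s 0 u =
    ennreal X * R + ennreal (Y * (a / s) + Y) * hardy_integral s 0 u"
    using ground_state_representation_aux[OF s a ba ab um L2] unfolding R[symmetric] yb X_def[symmetric] Y_def[symmetric] .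
  then have "ennreal X * frac_energy s u + ennreal Y * hardy_integral s 0 u =
    (ennreal X * R + ennreal (Y * (a / s)) * hardy_integral s 0 u) + ennreal Y * hardy_integral s 0 u"
    using Y a s by (simp add: distrib_right add_ac)
  then have E: "ennreal X * frac_energy s u = ennreal X * R + ennreal (Y * (a / s)) * hardy_integral s 0 u"
    by (rule ennreal_add_left_cancel_finite[rotated]) (use H in \<open>auto simp: ennreal_mult_less_top\<close>)
  define G where "G = C_Ns DIM('a) s / 2"
  have G: "G > 0" using C_Ns_pos[OF s] by (simp add: G_def)
  have "a \<notin> \<int>\<^sub>\<le>\<^sub>0" "1 - s \<notin> \<int>\<^sub>\<le>\<^sub>0"
    using a s by (auto elim!: nonpos_Ints_cases)
  then have G1: "Gamma (1 + a) = a * Gamma a" "Gamma (2 - s) = (1 - s) * Gamma (1 - s)"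
    using Gamma_plus1[of a] Gamma_plus1[of "1 - s"] by (auto simp: add.commute)
  have pos: "Gamma a > 0" "Gamma b > 0" "Gamma (1 - s) > 0" "Gamma (?n / 2 + s) > 0"
    using a b s by (auto intro!: Gamma_real_pos add_nonneg_pos)
  then have nz: "Gamma a \<noteq> 0" "Gamma b \<noteq> 0" "Gamma (1 - s) \<noteq> 0" "Gamma (?n / 2 + s) \<noteq> 0"
    by auto
  have half: "(?n + 2 * s) / 2 = ?n / 2 + s" by simp
  \<comment> \<open>Because \<open>1 - s + b = 1 + a\<close>, the Beta function contributes
    \<open>Gamma (1 - s) / (a * Gamma a)\<close>. Its numerator cancels against
    \<open>Gamma (2 - s)\<close> in \<open>C_Ns\<close>, and the quotient of squared Gamma values is
    left.\<close>
  have GY: "G / X * (Y * (a / s)) = gamma_H DIM('a) s"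
  proof -
    have "Beta (1 - s) b = Gamma (1 - s) * Gamma b / (a * Gamma a)"
      using G1 by (simp add: Beta_def ba)
    then have "G / X * (Y * (a / s)) = (pi powr (- ?n / 2) * pi powr (?n / 2)) * (2 powr (2 * s) * (Gamma b)\<^sup>2 / (Gamma a)\<^sup>2)"
      unfolding G_def X_def Y_def C_Ns_def half G1 using nz a s
      by (simp add: power2_eq_square)
    then show ?thesis
      by (simp add: gamma_H_def a_def b_def powr_add[symmetric])
  qed
  have "ennreal G * frac_energy s u = ennreal (G / X) * (ennreal X * frac_energy s u)"
    using G X by (simp add: mult.assoc[symmetric] ennreal_mult[symmetric])
  also have "\<dots> = ennreal G * R + ennreal (G / X * (Y * (a / s))) * hardy_integral s 0 u"
    unfolding E distrib_left using G X Y a s by (simp add: mult.assoc[symmetric] ennreal_mult[symmetric])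
  finally show ?thesis unfolding GY unfolding G_def R_def .
qed

section \<open>Kernel estimates\<close>

lemma nn_integral_norm_powr_ball:
  assumes c: "c < real DIM('a::euclidean_space)"
  shows "(\<integral>\<^sup>+z\<in>cball 0 r. ennreal (norm z powr (- c)) \<partial>(lborel :: 'a measure)) < \<infinity>"
proof -
  let ?n = "real DIM('a)"
  define K where "K = pi powr (?n / 2) / Gamma (?n / 2)"
  have K: "K \<ge> 0" by (simp add: K_def Gamma_real_pos less_imp_le)
  have "(\<integral>\<^sup>+z\<in>cball 0 r. ennreal (norm z powr (- c)) \<partial>(lborel :: 'a measure)) \<le>
    (\<integral>\<^sup>+z. ennreal ((z \<bullet> z) powr (- c / 2)) * indicator {..r\<^sup>2} (z \<bullet> z) \<partial>(lborel :: 'a measure))"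
    by (intro nn_integral_mono)
      (auto split: split_indicator simp: norm_powr_eq_inner_powr' power2_norm_eq_inner[symmetric] power_mono)
  also have "\<dots> = (\<integral>\<^sup>+q\<in>{0<..}. ennreal (K * q powr (?n / 2 - 1)) * (ennreal (q powr (- c / 2)) * indicator {..r\<^sup>2} q) \<partial>lborel)"
    unfolding K_def by (rule nn_integral_radial) measurable
  also have "\<dots> \<le> (\<integral>\<^sup>+q\<in>{0..r\<^sup>2}. ennreal (K * q powr (?n / 2 - 1 - c / 2)) \<partial>lborel)"
    using K by (intro nn_integral_mono)
      (auto split: split_indicator simp: ennreal_mult[symmetric] powr_add[symmetric] mult.assoc)
  also have "\<dots> = ennreal (K * ((r\<^sup>2) powr (?n / 2 - 1 - c / 2 + 1) / (?n / 2 - 1 - c / 2 + 1)))"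
    using K c by (intro nn_integral_has_integral_lebesgue' has_integral_mult_right has_integral_powr_from_0) auto
  finally show ?thesis by (simp add: less_top order.strict_trans1)
qed

text \<open>The numerator is a modulus that will dominate squared increments, of the logarithm and
  of Lipschitz functions alike. The square makes the singularity at 0 integrable because
  \<open>s < 1\<close>; the slower growth \<open>norm z powr s\<close> leaves decay of order
  \<open>- N - s\<close> at infinity.\<close>

lemma nn_integral_levy_kernel_finite:
  assumes s: "0 < s" "s < 1"
  shows "(\<integral>\<^sup>+z. ennreal (min (norm z powr 2) (norm z powr s) / norm z powr (real DIM('a) + 2 * s)) \<partial>(lborel :: 'a::euclidean_space measure)) < \<infinity>"
proof -
  let ?n = "real DIM('a)"
  define K where "K = pi powr (?n / 2) / Gamma (?n / 2)"
  have K: "K \<ge> 0" by (simp add: K_def Gamma_real_pos less_imp_le)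
  have "(\<integral>\<^sup>+z. ennreal (min (norm z powr 2) (norm z powr s) / norm z powr (?n + 2 * s)) \<partial>(lborel :: 'a measure)) =
    (\<integral>\<^sup>+z. ennreal (min ((z \<bullet> z) powr 1) ((z \<bullet> z) powr (s / 2)) / (z \<bullet> z) powr (?n / 2 + s)) \<partial>(lborel :: 'a measure))"
    by (intro nn_integral_cong) (simp only: norm_powr_eq_inner_powr' add_divide_distrib, simp)
  also have "\<dots> = (\<integral>\<^sup>+q\<in>{0<..}. ennreal (K * q powr (?n / 2 - 1)) * ennreal (min (q powr 1) (q powr (s / 2)) / q powr (?n / 2 + s)) \<partial>lborel)"
    unfolding K_def by (rule nn_integral_radial) measurable
  also have "\<dots> \<le> (\<integral>\<^sup>+q. ennreal (K * q powr (- s)) * indicator {0..1} q + ennreal (K * q powr (- 1 - s / 2)) * indicator {1..} q \<partial>lborel)"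
  proof (intro nn_integral_mono)
    fix q :: real
    show "ennreal (K * q powr (?n / 2 - 1)) * ennreal (min (q powr 1) (q powr (s / 2)) / q powr (?n / 2 + s)) * indicator {0<..} q
      \<le> ennreal (K * q powr (- s)) * indicator {0..1} q + ennreal (K * q powr (- 1 - s / 2)) * indicator {1..} q"
    proof (cases "q > 0")
      case True
      have e0: "q powr (?n / 2 - 1) * (min (q powr 1) (q powr (s / 2)) / q powr (?n / 2 + s)) = min (q powr (- s)) (q powr (- 1 - s / 2))"
      proof -
        have p: "q powr (?n / 2 - 1) * (q powr 1 / q powr (?n / 2 + s)) = q powr (- s)"
          "q powr (?n / 2 - 1) * (q powr (s / 2) / q powr (?n / 2 + s)) = q powr (- 1 - s / 2)"
          by (simp_all only: powr_diff[symmetric] powr_add[symmetric]) (simp_all add: algebra_simps)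
        have "q powr (?n / 2 + s) \<ge> 0" by simp
        then have "min (q powr 1) (q powr (s / 2)) / q powr (?n / 2 + s) = min (q powr 1 / q powr (?n / 2 + s)) (q powr (s / 2) / q powr (?n / 2 + s))"
          by (simp only: min_divide_distrib_right if_True)
        then show ?thesis
          by (simp only: min_mult_distrib_left powr_ge_zero if_True p)
      qed
      have eq: "ennreal (K * q powr (?n / 2 - 1)) * ennreal (min (q powr 1) (q powr (s / 2)) / q powr (?n / 2 + s))
        = ennreal (K * min (q powr (- s)) (q powr (- 1 - s / 2)))"
        unfolding e0[symmetric] mult.assoc[symmetric] using K by (intro ennreal_mult[symmetric]) auto
      show ?thesis
      proof (cases "q \<le> 1")
        case True
        with \<open>q > 0\<close> K have "ennreal (K * min (q powr (- s)) (q powr (- 1 - s / 2))) \<le> ennreal (K * q powr (- s)) * indicator {0..1} q"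
          by (auto intro!: ennreal_leI mult_left_mono)
        then show ?thesis using True \<open>q > 0\<close> unfolding eq by (simp add: add_increasing2)
      next
        case False
        with K have "ennreal (K * min (q powr (- s)) (q powr (- 1 - s / 2))) \<le> ennreal (K * q powr (- 1 - s / 2)) * indicator {1..} q"
          by (auto intro!: ennreal_leI mult_left_mono)
        then show ?thesis using False \<open>q > 0\<close> unfolding eq by simp
      qed
    qed simp
  qed
  also have "\<dots> = (\<integral>\<^sup>+q\<in>{0..1}. ennreal (K * q powr (- s)) \<partial>lborel) + (\<integral>\<^sup>+q\<in>{1..}. ennreal (K * q powr (- 1 - s / 2)) \<partial>lborel)"
    by (rule nn_integral_add) measurable
  also have "(\<integral>\<^sup>+q\<in>{0..1}. ennreal (K * q powr (- s)) \<partial>lborel) = ennreal (K * (1 powr (- s + 1) / (- s + 1)))"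
    using K s by (intro nn_integral_has_integral_lebesgue' has_integral_mult_right has_integral_powr_from_0) auto
  also have "(\<integral>\<^sup>+q\<in>{1..}. ennreal (K * q powr (- 1 - s / 2)) \<partial>lborel) = ennreal (K * (- (1 powr (- 1 - s / 2 + 1)) / (- 1 - s / 2 + 1)))"
    using K s by (intro nn_integral_has_integral_lebesgue' has_integral_mult_right has_integral_powr_to_inf) auto
  finally show ?thesis by (simp add: less_top order.strict_trans1)
qed

lemma powr_ge_min_one_half: "c \<ge> 0 \<Longrightarrow> (1 / 2 :: real) \<le> y \<Longrightarrow> y powr (- c) \<le> 2 powr c"
proof -
  assume "c \<ge> 0" "(1 / 2 :: real) \<le> y"
  then have "y powr (- c) \<le> (1 / 2) powr (- c)" by (intro powr_mono2') auto
  then show ?thesis by (simp add: powr_divide powr_minus)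
qed

text \<open>On \<open>r \<ge> 1 / 2\<close> the logarithm is Lipschitz, which settles small
  \<open>d\<close>. For large \<open>d\<close> it is dominated by the power \<open>s / 2\<close>,
  whose square matches \<open>d powr s\<close>; the constant absorbs
  \<open>(2 / s)^2 * 2 powr s\<close>.\<close>

lemma ln_sq_le_levy:
  fixes r d s :: real
  assumes s: "0 < s" "s < 1" and r: "r \<ge> 1 / 2" and d: "\<bar>r - 1\<bar> \<le> d"
  shows "(ln r)\<^sup>2 \<le> 8 / s\<^sup>2 * min (d powr 2) (d powr s)"
proof -
  have d0: "d \<ge> 0" using d by simp
  have s2: "s\<^sup>2 \<le> 1" using s by (simp add: power_le_one)
  have c8: "8 \<le> 8 / s\<^sup>2" using s s2 by (simp add: le_divide_eq)
  have l2: "\<bar>ln r\<bar> \<le> 2 * d"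
  proof (cases "r \<ge> 1")
    case True
    then have "ln r \<le> r - 1" by (intro ln_le_minus_one) auto
    with True d show ?thesis by (simp add: abs_if)
  next
    case False
    have "ln (1 / r) \<le> 1 / r - 1" using r by (intro ln_le_minus_one) auto
    also have "\<dots> = (1 - r) / r" using r by (simp add: field_simps)
    also have "\<dots> \<le> (1 - r) / (1 / 2)" using r False by (intro divide_left_mono) auto
    finally show ?thesis using False d r by (simp add: ln_div abs_if)
  qed
  show ?thesis
  proof (cases "d \<le> 1")
    case True
    have "(ln r)\<^sup>2 \<le> (2 * d)\<^sup>2" using l2 by (rule abs_le_square_iff[THEN iffD1, OF order_trans]) (use d0 in simp)
    also have "\<dots> \<le> 8 * d\<^sup>2" by (simp add: power_mult_distrib)
    also have "d\<^sup>2 = min (d powr 2) (d powr s)"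
    proof (cases "d = 0")
      case False
      then have "d powr 2 \<le> d powr s" using True d0 s by (intro powr_mono') auto
      then show ?thesis using d0 by (simp add: min_def)
    qed simp
    also have "8 * min (d powr 2) (d powr s) \<le> 8 / s\<^sup>2 * min (d powr 2) (d powr s)"
      using c8 by (intro mult_right_mono) auto
    finally show ?thesis by simp
  next
    case False
    then have m: "min (d powr 2) (d powr s) = d powr s" using s by (intro min.absorb2 powr_mono) auto
    have d1: "1 \<le> d powr (s / 2)" using False s by (intro ge_one_powr_ge_zero) auto
    have "\<bar>ln r\<bar> \<le> 2 / s * (2 powr (s / 2) * d powr (s / 2))"
    proof (cases "r \<ge> 1")
      case True
      have "ln r \<le> r powr (s / 2) / (s / 2)" using ln_powr_bound[of r "s / 2"] True s by simp
      also have "r powr (s / 2) \<le> (2 * d) powr (s / 2)" using True False d s by (intro powr_mono2) auto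
      also have "(2 * d) powr (s / 2) = 2 powr (s / 2) * d powr (s / 2)" using d0 by (simp add: powr_mult)
      finally show ?thesis using True s by (simp add: divide_right_mono mult.commute)
    next
      case F: False
      have "ln (1 / r) \<le> 1 / r - 1" using r by (intro ln_le_minus_one) auto
      also have "\<dots> \<le> 1" using r by (simp add: field_simps)
      also have "1 \<le> 2 / s * (2 powr (s / 2) * d powr (s / 2))"
      proof -
        have "1 \<le> 2 powr (s / 2)" using s by (intro ge_one_powr_ge_zero) auto
        with d1 have "1 * 1 \<le> 2 powr (s / 2) * d powr (s / 2)" by (intro mult_mono) auto
        moreover have "1 \<le> 2 / s" using s by simp
        ultimately have "1 * 1 \<le> 2 / s * (2 powr (s / 2) * d powr (s / 2))"
          by (intro mult_mono[of 1 "2 / s" 1]) (use s in auto)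
        then show ?thesis by simp
      qed
      finally show ?thesis using F r by (simp add: ln_div abs_if)
    qed
    then have "(ln r)\<^sup>2 \<le> (2 / s * (2 powr (s / 2) * d powr (s / 2)))\<^sup>2"
      by (subst abs_le_square_iff[symmetric]) (use s in auto)
    also have "\<dots> = 4 / s\<^sup>2 * 2 powr s * d powr s"
    proof -
      have "(2 powr (s / 2))\<^sup>2 = 2 powr s" "(d powr (s / 2))\<^sup>2 = d powr s"
        by (simp_all add: power2_eq_square powr_add[symmetric])
      then show ?thesis by (simp add: power_mult_distrib power_divide)
    qed
    also have "\<dots> \<le> 4 / s\<^sup>2 * 2 * d powr s"
    proof -
      have "2 powr s \<le> 2 powr (1::real)" using s by (intro powr_mono) auto
      then show ?thesis by (intro mult_right_mono mult_left_mono) auto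
    qed
    finally show ?thesis by (simp add: m)
  qed
qed

text \<open>The sphere of radius 1/2 separates the singularities. Inside, \<open>y\<close> stays
  away from \<open>e\<close>, and a small power of \<open>norm y\<close> absorbs the logarithm.
  Outside, \<open>norm y powr (- c)\<close> is bounded, and the logarithm vanishes on the unit
  sphere to first order, which tames the kernel at \<open>e\<close>. The bounding integrands depend
  on \<open>y\<close> or on \<open>y - e\<close> alone, so \<open>D\<close> is the same for all
  \<open>e\<close>.\<close>

lemma log_kernel_unit_bound:
  assumes s: "0 < s" "s < 1" and c: "0 \<le> c" "c < real DIM('a::euclidean_space)"
  obtains D where "D \<ge> 0" "\<And>e::'a. norm e = 1 \<Longrightarrow>
    (\<integral>\<^sup>+y. ennreal ((ln (norm y))\<^sup>2 * norm y powr (- c) / norm (e - y) powr (real DIM('a) + 2 * s)) \<partial>lborel) \<le> ennreal D"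
proof -
  let ?n = "real DIM('a)"
  \<comment> \<open>The squared logarithm then costs the power \<open>2 * dl\<close>, half of the
    distance from \<open>c\<close> to the dimension, and the exponent \<open>(?n + c) / 2\<close> is
    still integrable.\<close>
  define dl where "dl = (?n - c) / 4"
  have dl: "dl > 0" using c by (simp add: dl_def)
  define I1 where "I1 = (\<integral>\<^sup>+z\<in>cball 0 1. ennreal (norm z powr (- ((?n + c) / 2))) \<partial>(lborel :: 'a measure))"
  define I2 where "I2 = (\<integral>\<^sup>+z. ennreal (min (norm z powr 2) (norm z powr s) / norm z powr (?n + 2 * s)) \<partial>(lborel :: 'a measure))"
  have I1: "I1 < \<infinity>" unfolding I1_def using c by (intro nn_integral_norm_powr_ball) auto
  have I2: "I2 < \<infinity>" unfolding I2_def using s by (rule nn_integral_levy_kernel_finite)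
  define k1 k2 where "k1 = 2 powr (?n + 2 * s) / dl\<^sup>2" and "k2 = 2 powr c * (8 / s\<^sup>2)"
  have k: "k1 \<ge> 0" "k2 \<ge> 0" by (auto simp: k1_def k2_def)
  define DD where "DD = ennreal k1 * I1 + ennreal k2 * I2"
  have "DD < \<infinity>" using I1 I2 by (simp add: DD_def ennreal_mult_less_top)
  moreover have "(\<integral>\<^sup>+y. ennreal ((ln (norm y))\<^sup>2 * norm y powr (- c) / norm (e - y) powr (?n + 2 * s)) \<partial>lborel) \<le> DD"
    if e: "norm e = 1" for e :: 'a
  proof -
    have "(\<integral>\<^sup>+y. ennreal ((ln (norm y))\<^sup>2 * norm y powr (- c) / norm (e - y) powr (?n + 2 * s)) \<partial>lborel) \<le>
      (\<integral>\<^sup>+y. ennreal k1 * (ennreal (norm y powr (- ((?n + c) / 2))) * indicator (cball 0 1) y)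
        + ennreal k2 * ennreal (min (norm (y - e) powr 2) (norm (y - e) powr s) / norm (y - e) powr (?n + 2 * s)) \<partial>lborel)"
    proof (intro nn_integral_mono)
      fix y :: 'a
      have rev: "\<bar>norm y - 1\<bar> \<le> norm (y - e)" using norm_triangle_ineq3[of y e] e by simp
      consider "y = 0" | "y \<noteq> 0" "norm y < 1 / 2" | "norm y \<ge> 1 / 2" by linarith
      then show "ennreal ((ln (norm y))\<^sup>2 * norm y powr (- c) / norm (e - y) powr (?n + 2 * s))
        \<le> ennreal k1 * (ennreal (norm y powr (- ((?n + c) / 2))) * indicator (cball 0 1) y)
        + ennreal k2 * ennreal (min (norm (y - e) powr 2) (norm (y - e) powr s) / norm (y - e) powr (?n + 2 * s))"
      proof cases
        case 2
        then have y: "norm y > 0" "norm y < 1 / 2" by auto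
        have "1 / 2 \<le> norm (e - y)" using rev y by (simp add: norm_minus_commute)
        then have "norm (e - y) powr (- (?n + 2 * s)) \<le> 2 powr (?n + 2 * s)"
          using s by (intro powr_ge_min_one_half) auto
        moreover have "(ln (norm y))\<^sup>2 \<le> norm y powr (- (2 * dl)) / dl\<^sup>2"
        proof -
          have "ln (1 / norm y) \<le> (1 / norm y) powr dl / dl" using ln_powr_bound[of "1 / norm y" dl] y dl by simp
          also have "ln (1 / norm y) = \<bar>ln (norm y)\<bar>" using y by (simp add: ln_div)
          also have "(1 / norm y) powr dl / dl = \<bar>norm y powr (- dl) / dl\<bar>" using y dl by (simp add: powr_divide powr_minus_divide)
          finally have "\<bar>ln (norm y)\<bar> \<le> \<bar>norm y powr (- dl) / dl\<bar>" .
          then have "(ln (norm y))\<^sup>2 \<le> (norm y powr (- dl) / dl)\<^sup>2" by (simp only: abs_le_square_iff)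
          then show ?thesis by (simp add: power_divide power2_eq_square powr_add[symmetric])
        qed
        ultimately have "(ln (norm y))\<^sup>2 * norm y powr (- c) * norm (e - y) powr (- (?n + 2 * s))
          \<le> norm y powr (- (2 * dl)) / dl\<^sup>2 * norm y powr (- c) * 2 powr (?n + 2 * s)"
          by (intro mult_mono) auto
        also have "\<dots> = k1 * norm y powr (- ((?n + c) / 2))"
        proof -
          have "- (2 * dl) + - c = - ((?n + c) / 2)" by (simp add: dl_def field_simps)
          then have "norm y powr (- (2 * dl)) * norm y powr (- c) = norm y powr (- ((?n + c) / 2))"
            by (simp only: powr_add[symmetric])
          then show ?thesis by (simp add: k1_def field_simps)
        qed
        finally have "(ln (norm y))\<^sup>2 * norm y powr (- c) / norm (e - y) powr (?n + 2 * s) \<le> k1 * norm y powr (- ((?n + c) / 2))"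
          by (simp only: powr_minus divide_inverse)
        then have "ennreal ((ln (norm y))\<^sup>2 * norm y powr (- c) / norm (e - y) powr (?n + 2 * s)) \<le> ennreal k1 * (ennreal (norm y powr (- ((?n + c) / 2))) * indicator (cball 0 1) y)"
          using y k by (simp add: ennreal_mult[symmetric] ennreal_leI)
        then show ?thesis by (rule add_increasing2[rotated]) simp
      next
        case 3
        have "(ln (norm y))\<^sup>2 \<le> 8 / s\<^sup>2 * min (norm (y - e) powr 2) (norm (y - e) powr s)"
          using 3 rev s by (intro ln_sq_le_levy) auto
        moreover have "norm y powr (- c) \<le> 2 powr c" using 3 c by (intro powr_ge_min_one_half) auto
        ultimately have "(ln (norm y))\<^sup>2 * norm y powr (- c) \<le> (8 / s\<^sup>2 * min (norm (y - e) powr 2) (norm (y - e) powr s)) * 2 powr c"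
          by (intro mult_mono) auto
        then have "(ln (norm y))\<^sup>2 * norm y powr (- c) / norm (e - y) powr (?n + 2 * s)
          \<le> (8 / s\<^sup>2 * min (norm (y - e) powr 2) (norm (y - e) powr s)) * 2 powr c / norm (e - y) powr (?n + 2 * s)"
          by (intro divide_right_mono) auto
        also have "\<dots> = k2 * (min (norm (y - e) powr 2) (norm (y - e) powr s) / norm (y - e) powr (?n + 2 * s))"
          by (simp add: k2_def norm_minus_commute)
        finally have "ennreal ((ln (norm y))\<^sup>2 * norm y powr (- c) / norm (e - y) powr (?n + 2 * s)) \<le>
          ennreal k2 * ennreal (min (norm (y - e) powr 2) (norm (y - e) powr s) / norm (y - e) powr (?n + 2 * s))"
          using k by (simp add: ennreal_mult[symmetric] ennreal_leI)
        then show ?thesis by (rule add_increasing[rotated]) simp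
      qed simp
    qed
    also have "\<dots> = DD"
    proof -
      have "(\<integral>\<^sup>+y. ennreal (min (norm (y - e) powr 2) (norm (y - e) powr s) / norm (y - e) powr (?n + 2 * s)) \<partial>lborel) = I2"
        unfolding I2_def by (rule nn_integral_lborel_translate[where f = "\<lambda>z. ennreal (min (norm z powr 2) (norm z powr s) / norm z powr (?n + 2 * s))"]) measurable
      note t = this
      have [measurable]: "cball (0 :: 'a) 1 \<in> sets borel" by simp
      show ?thesis unfolding DD_def I1_def t[symmetric]
        by (simp add: nn_integral_add nn_integral_cmult)
    qed
    finally show ?thesis .
  qed
  moreover have "ennreal (enn2real DD) = DD"
    using \<open>DD < \<infinity>\<close> by (intro ennreal_enn2real) simp
  ultimately show thesis
    by (intro that[of "enn2real DD"]) (simp_all only: enn2real_nonneg)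
qed

text \<open>Homogeneity of degree \<open>- (2 * s)\<close> reduces this to the unit sphere. The
  value \<open>c = 0\<close> will bound the cost of cut-offs, and \<open>c = N / 2 - s\<close> the
  ground state remainder of the test functions.\<close>

lemma log_kernel_bound:
  assumes s: "0 < s" "s < 1" and c: "0 \<le> c" "c < real DIM('a::euclidean_space)"
  obtains D where "D \<ge> 0" "\<And>x::'a. x \<noteq> 0 \<Longrightarrow>
    (\<integral>\<^sup>+y. ennreal ((ln (norm x) - ln (norm y))\<^sup>2 * (norm y / norm x) powr (- c) / norm (x - y) powr (real DIM('a) + 2 * s)) \<partial>lborel)
      \<le> ennreal (D * norm x powr (- (2 * s)))"
proof -
  let ?n = "real DIM('a)"
  obtain D where D0: "D \<ge> 0" and D: "\<And>e::'a. norm e = 1 \<Longrightarrow>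
    (\<integral>\<^sup>+y. ennreal ((ln (norm y))\<^sup>2 * norm y powr (- c) / norm (e - y) powr (?n + 2 * s)) \<partial>lborel) \<le> ennreal D"
    using log_kernel_unit_bound[OF s c] by blast
  have "(\<integral>\<^sup>+y. ennreal ((ln (norm x) - ln (norm y))\<^sup>2 * (norm y / norm x) powr (- c) / norm (x - y) powr (?n + 2 * s)) \<partial>lborel)
      \<le> ennreal (D * norm x powr (- (2 * s)))" if x: "x \<noteq> 0" for x :: 'a
  proof -
    define r e where "r = norm x" and "e = x /\<^sub>R norm x"
    have r: "r > 0" and e: "norm e = 1" "x = r *\<^sub>R e" using x by (auto simp: r_def e_def)
    have eq: "(\<integral>\<^sup>+y. ennreal ((ln (norm x) - ln (norm y))\<^sup>2 * (norm y / norm x) powr (- c) / norm (x - y) powr (?n + 2 * s)) \<partial>lborel)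
      = ennreal (r ^ DIM('a)) * (\<integral>\<^sup>+y. ennreal ((ln (norm x) - ln (norm (r *\<^sub>R y)))\<^sup>2 * (norm (r *\<^sub>R y) / norm x) powr (- c) / norm (x - r *\<^sub>R y) powr (?n + 2 * s)) \<partial>lborel)"
      using r by (subst nn_integral_lborel_affine[where c = r and t = 0]) auto
    have "(\<integral>\<^sup>+y. ennreal ((ln (norm x) - ln (norm (r *\<^sub>R y)))\<^sup>2 * (norm (r *\<^sub>R y) / norm x) powr (- c) / norm (x - r *\<^sub>R y) powr (?n + 2 * s)) \<partial>lborel)
      = (\<integral>\<^sup>+y. ennreal (r powr (- (?n + 2 * s))) * ennreal ((ln (norm y))\<^sup>2 * norm y powr (- c) / norm (e - y) powr (?n + 2 * s)) \<partial>lborel)"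
    proof (intro nn_integral_cong)
      fix y :: 'a
      show "ennreal ((ln (norm x) - ln (norm (r *\<^sub>R y)))\<^sup>2 * (norm (r *\<^sub>R y) / norm x) powr (- c) / norm (x - r *\<^sub>R y) powr (?n + 2 * s))
        = ennreal (r powr (- (?n + 2 * s))) * ennreal ((ln (norm y))\<^sup>2 * norm y powr (- c) / norm (e - y) powr (?n + 2 * s))"
      proof (cases "y = 0")
        case False
        have n: "norm (x - r *\<^sub>R y) = r * norm (e - y)"
          unfolding e(2) scaleR_diff_right[symmetric] using r by simp
        have eq: "(ln (norm x) - ln (norm (r *\<^sub>R y)))\<^sup>2 * (norm (r *\<^sub>R y) / norm x) powr (- c) / norm (x - r *\<^sub>R y) powr (?n + 2 * s)
          = r powr (- (?n + 2 * s)) * ((ln (norm y))\<^sup>2 * norm y powr (- c) / norm (e - y) powr (?n + 2 * s))"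
          unfolding n using r False by (simp add: r_def[symmetric] ln_mult powr_mult powr_minus_divide del: minus_add_distrib)
        show ?thesis unfolding eq by (intro ennreal_mult) auto
      qed simp
    qed
    also have "\<dots> = ennreal (r powr (- (?n + 2 * s))) * (\<integral>\<^sup>+y. ennreal ((ln (norm y))\<^sup>2 * norm y powr (- c) / norm (e - y) powr (?n + 2 * s)) \<partial>lborel)"
      by (rule nn_integral_cmult) measurable
    also have "\<dots> \<le> ennreal (r powr (- (?n + 2 * s))) * ennreal D"
      by (intro mult_left_mono D e) auto
    finally have "(\<integral>\<^sup>+y. ennreal ((ln (norm x) - ln (norm y))\<^sup>2 * (norm y / norm x) powr (- c) / norm (x - y) powr (?n + 2 * s)) \<partial>lborel)
      \<le> ennreal (r ^ DIM('a)) * (ennreal (r powr (- (?n + 2 * s))) * ennreal D)"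
      unfolding eq by (rule mult_left_mono) simp
    also have "ennreal (r ^ DIM('a)) * (ennreal (r powr (- (?n + 2 * s))) * ennreal D) = ennreal (D * norm x powr (- (2 * s)))"
    proof -
      have "r ^ DIM('a) * (r powr (- (?n + 2 * s)) * D) = D * r powr (- (2 * s))"
        using r by (simp add: powr_realpow[symmetric] powr_add[symmetric] mult_ac)
      then show ?thesis using r D0 by (simp add: ennreal_mult[symmetric] r_def[symmetric])
    qed
    finally show ?thesis .
  qed
  with D0 that show thesis by blast
qed


section \<open>The Hardy inequality and localisation of the energy\<close>

text \<open>Enough to make the mass and, for \<open>N > 2 * s\<close>, all Hardy integrals finite;
  cut-offs with corners stay inside the class.\<close>

definition bounded_support :: "('a::euclidean_space \<Rightarrow> real) \<Rightarrow> bool" where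
  "bounded_support u \<longleftrightarrow> u \<in> borel_measurable borel \<and> (\<exists>M. \<forall>x. \<bar>u x\<bar> \<le> M) \<and> (\<exists>R. \<forall>x. R < norm x \<longrightarrow> u x = 0)"

lemma bounded_supportD [measurable_dest]: "bounded_support u \<Longrightarrow> u \<in> borel_measurable borel"
  by (simp add: bounded_support_def)

lemma bounded_support_translate:
  assumes "bounded_support u"
  shows "bounded_support (\<lambda>x. u (x + p))"
proof -
  obtain M R where MR: "\<And>x. \<bar>u x\<bar> \<le> M" "\<And>x. R < norm x \<Longrightarrow> u x = 0"
    using assms by (auto simp: bounded_support_def)
  note [measurable] = bounded_supportD[OF assms]
  have "u (x + p) = 0" if "R + norm p < norm x" for x
    using that norm_triangle_ineq2[of x "- p"] by (intro MR(2)) simp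
  with MR(1) show ?thesis unfolding bounded_support_def by auto
qed

lemma bounded_support_mult:
  assumes "bounded_support u" and [measurable]: "c \<in> borel_measurable borel" and c: "\<And>x. \<bar>c x\<bar> \<le> 1"
  shows "bounded_support (\<lambda>x. c x * u x)"
proof -
  obtain M R where MR: "\<And>x. \<bar>u x\<bar> \<le> M" "\<And>x. R < norm x \<Longrightarrow> u x = 0"
    using assms by (auto simp: bounded_support_def)
  note [measurable] = bounded_supportD[OF assms(1)]
  have "\<bar>c x * u x\<bar> \<le> M" for x
    using mult_mono[OF c[of x] MR(1)[of x]] by (simp add: abs_mult)
  with MR(2) show ?thesis unfolding bounded_support_def by auto
qed

lemma hardy_integral_finite:
  fixes u :: "'a::euclidean_space \<Rightarrow> real"
  assumes u: "bounded_support u" and N: "real DIM('a) > 2 * s"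
  shows "hardy_integral s p u < \<infinity>"
proof -
  obtain M R where MR: "\<And>x. \<bar>u x\<bar> \<le> M" "\<And>x. R < norm x \<Longrightarrow> u x = 0"
    using u by (auto simp: bounded_support_def)
  have [measurable]: "cball (0 :: 'a) (R + norm p) \<in> sets borel" by simp
  have "hardy_integral s p u \<le> (\<integral>\<^sup>+x. ennreal (M\<^sup>2) * (ennreal (norm (x - p) powr (- (2 * s))) * indicator (cball 0 (R + norm p)) (x - p)) \<partial>lborel)"
    unfolding hardy_integral_def
  proof (intro nn_integral_mono)
    fix x
    show "ennreal ((u x)\<^sup>2 / norm (x - p) powr (2 * s)) \<le> ennreal (M\<^sup>2) * (ennreal (norm (x - p) powr (- (2 * s))) * indicator (cball 0 (R + norm p)) (x - p))"
    proof (cases "norm x \<le> R")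
      case True
      have "(u x)\<^sup>2 \<le> M\<^sup>2" using MR(1)[of x] by (simp add: abs_le_square_iff[symmetric])
      then have "(u x)\<^sup>2 / norm (x - p) powr (2 * s) \<le> M\<^sup>2 * norm (x - p) powr (- (2 * s))"
        by (simp add: powr_minus divide_inverse mult_right_mono)
      moreover have "x - p \<in> cball 0 (R + norm p)" using True norm_triangle_ineq4[of x p] by auto
      ultimately show ?thesis by (simp add: ennreal_mult[symmetric] ennreal_leI)
    qed (simp add: MR(2))
  qed
  also have "\<dots> = ennreal (M\<^sup>2) * (\<integral>\<^sup>+z\<in>cball 0 (R + norm p). ennreal (norm z powr (- (2 * s))) \<partial>(lborel :: 'a measure))"
    by (subst nn_integral_lborel_translate[where a = p and f = "\<lambda>z. ennreal (M\<^sup>2) * (ennreal (norm z powr (- (2 * s))) * indicator (cball 0 (R + norm p)) z)"])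
      (auto simp: nn_integral_cmult)
  also have "\<dots> < \<infinity>"
    using nn_integral_norm_powr_ball[where 'a = 'a, OF N] by (simp add: ennreal_mult_less_top)
  finally show ?thesis .
qed

lemma nn_integral_square_finite:
  fixes u :: "'a::euclidean_space \<Rightarrow> real"
  assumes u: "bounded_support u"
  shows "(\<integral>\<^sup>+x. ennreal ((u x)\<^sup>2) \<partial>lborel) < \<infinity>"
proof -
  obtain M R where MR: "\<And>x. \<bar>u x\<bar> \<le> M" "\<And>x. R < norm x \<Longrightarrow> u x = 0"
    using u by (auto simp: bounded_support_def)
  have "(\<integral>\<^sup>+x. ennreal ((u x)\<^sup>2) \<partial>lborel) \<le> (\<integral>\<^sup>+x. ennreal (M\<^sup>2) * indicator (cball 0 R) x \<partial>(lborel :: 'a measure))"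
  proof (intro nn_integral_mono)
    fix x
    show "ennreal ((u x)\<^sup>2) \<le> ennreal (M\<^sup>2) * indicator (cball 0 R) x"
      using MR(1)[of x] MR(2)[of x] by (cases "norm x \<le> R") (auto intro!: ennreal_leI simp: abs_le_square_iff[symmetric])
  qed
  also have "\<dots> = ennreal (M\<^sup>2) * emeasure lborel (cball (0 :: 'a) R)"
    by (rule nn_integral_cmult_indicator) simp
  also have "\<dots> < \<infinity>" using emeasure_bounded_finite[of "cball (0 :: 'a) R"] by (simp add: ennreal_mult_less_top)
  finally show ?thesis .
qed

lemma hardy_integral_translate:
  fixes u :: "'a::euclidean_space \<Rightarrow> real"
  assumes [measurable]: "u \<in> borel_measurable borel"
  shows "hardy_integral s p (\<lambda>x. u (x - q)) = hardy_integral s (p - q) u"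
  unfolding hardy_integral_def
  using nn_integral_lborel_translate[where a = q and f = "\<lambda>x. ennreal ((u x)\<^sup>2 / norm (x - (p - q)) powr (2 * s))"]
  by (simp add: algebra_simps)

lemma frac_energy_translate:
  fixes u :: "'a::euclidean_space \<Rightarrow> real"
  assumes [measurable]: "u \<in> borel_measurable borel"
  shows "frac_energy s (\<lambda>x. u (x - q)) = frac_energy s u"
proof -
  have "frac_energy s (\<lambda>x. u (x - q)) = (\<integral>\<^sup>+x. \<integral>\<^sup>+y. ennreal ((u (x - q) - u y)\<^sup>2 / norm ((x - q) - y) powr (real DIM('a) + 2 * s)) \<partial>lborel \<partial>lborel)"
    unfolding frac_energy_def
  proof (rule nn_integral_cong)
    fix x
    show "(\<integral>\<^sup>+y. ennreal ((u (x - q) - u (y - q))\<^sup>2 / norm (x - y) powr (real DIM('a) + 2 * s)) \<partial>lborel) =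
      (\<integral>\<^sup>+y. ennreal ((u (x - q) - u y)\<^sup>2 / norm ((x - q) - y) powr (real DIM('a) + 2 * s)) \<partial>lborel)"
      using nn_integral_lborel_translate[where a = q and f = "\<lambda>y. ennreal ((u (x - q) - u y)\<^sup>2 / norm ((x - q) - y) powr (real DIM('a) + 2 * s))"]
      by (simp add: algebra_simps)
  qed
  also have "\<dots> = frac_energy s u"
    unfolding frac_energy_def
    by (rule nn_integral_lborel_translate[where a = q and f = "\<lambda>x. \<integral>\<^sup>+y. ennreal ((u x - u y)\<^sup>2 / norm (x - y) powr (real DIM('a) + 2 * s)) \<partial>lborel"]) measurable
  finally show ?thesis .
qed

text \<open>The ground state remainder is nonnegative, and a translation moves the pole to the
  origin. The energy may be infinite here.\<close>

lemma hardy_inequality: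
  fixes u :: "'a::euclidean_space \<Rightarrow> real"
  assumes s: "0 < s" "s < 1" and N: "real DIM('a) > 2 * s" and u: "bounded_support u"
  shows "ennreal (gamma_H DIM('a) s) * hardy_integral s p u \<le> ennreal (C_Ns DIM('a) s / 2) * frac_energy s u"
proof -
  note [measurable] = bounded_supportD[OF u]
  define v where "v x = u (x + p)" for x
  have v: "bounded_support v" unfolding v_def by (rule bounded_support_translate[OF u])
  note [measurable] = bounded_supportD[OF v]
  have uv: "u = (\<lambda>x. v (x - p))" by (simp add: v_def)
  have H: "hardy_integral s p u = hardy_integral s 0 v" and E: "frac_energy s u = frac_energy s v"
    unfolding uv by (simp_all add: hardy_integral_translate frac_energy_translate)
  show ?thesis unfolding H E
    using ground_state_representation[OF s N bounded_supportD[OF v] nn_integral_square_finite[OF v] hardy_integral_finite[OF v N]]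
    by simp
qed

text \<open>A nonlocal form of the IMS localisation formula. The squares of the cut-offs sum to 1,
  so only the mixed term changes, by the factor \<open>cos (\<theta> x - \<theta> y)\<close>. The
  error is quadratic in the increment of \<open>\<theta>\<close>; integrating squared logarithmic
  increments against the kernel produces the Hardy weight.\<close>

lemma energy_partition:
  assumes s: "0 < s" "s < 1"
  obtains D where "D \<ge> 0" "\<And>(u :: 'a::euclidean_space \<Rightarrow> real) \<theta> d. u \<in> borel_measurable borel \<Longrightarrow> \<theta> \<in> borel_measurable borel \<Longrightarrow>
    (\<And>x y. x \<noteq> 0 \<Longrightarrow> y \<noteq> 0 \<Longrightarrow> \<bar>\<theta> x - \<theta> y\<bar> \<le> d * \<bar>ln (norm x) - ln (norm y)\<bar>) \<Longrightarrow>
    frac_energy s (\<lambda>x. cos (\<theta> x) * u x) + frac_energy s (\<lambda>x. sin (\<theta> x) * u x)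
      \<le> frac_energy s u + ennreal (d\<^sup>2 * D) * hardy_integral s 0 u"
proof -
  let ?n = "real DIM('a)"
  obtain D where D0: "D \<ge> 0" and D: "\<And>x::'a. x \<noteq> 0 \<Longrightarrow>
    (\<integral>\<^sup>+y. ennreal ((ln (norm x) - ln (norm y))\<^sup>2 * (norm y / norm x) powr (- 0) / norm (x - y) powr (?n + 2 * s)) \<partial>lborel)
      \<le> ennreal (D * norm x powr (- (2 * s)))"
    using log_kernel_bound[OF s, of 0, where 'a = 'a] by auto
  show thesis
  proof (rule that[OF D0])
    fix u \<theta> :: "'a \<Rightarrow> real" and d :: real
    assume [measurable]: "u \<in> borel_measurable borel" "\<theta> \<in> borel_measurable borel"
    assume Lip: "\<And>x y. x \<noteq> 0 \<Longrightarrow> y \<noteq> 0 \<Longrightarrow> \<bar>\<theta> x - \<theta> y\<bar> \<le> d * \<bar>ln (norm x) - ln (norm y)\<bar>"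
    define k where "k x y = norm (x - y) powr (?n + 2 * s)" for x y :: 'a
    \<comment> \<open>The share of the error charged to \<open>x\<close>, after the product
      \<open>2 * u x * u y\<close> has been bounded by the sum of the squares; the other share is
      \<open>g y x\<close>.\<close>
    define g where "g x y = d\<^sup>2 / 2 * (u x)\<^sup>2 * ((ln (norm x) - ln (norm y))\<^sup>2 / k x y)" for x y
    have k0: "k x y \<ge> 0" for x y by (simp add: k_def)
    have ks: "k x y = k y x" for x y by (simp add: k_def norm_minus_commute)
    have [measurable]: "case_prod k \<in> borel_measurable (borel \<Otimes>\<^sub>M borel)" "case_prod g \<in> borel_measurable (borel \<Otimes>\<^sub>M borel)"
      unfolding g_def k_def by measurable
    have pw: "ennreal ((cos (\<theta> x) * u x - cos (\<theta> y) * u y)\<^sup>2 / k x y) + ennreal ((sin (\<theta> x) * u x - sin (\<theta> y) * u y)\<^sup>2 / k x y)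
      \<le> ennreal ((u x - u y)\<^sup>2 / k x y) + (ennreal (g x y) + ennreal (g y x))" if xy: "x \<noteq> 0" "y \<noteq> 0" for x y
    proof -
      define f where "f = \<theta> x - \<theta> y"
      define l where "l = ln (norm x) - ln (norm y)"
      have "\<bar>f\<bar> \<le> \<bar>d * l\<bar>" using Lip[OF xy] abs_ge_self[of d] mult_right_mono[of d "\<bar>d\<bar>" "\<bar>l\<bar>"]
        by (simp add: f_def l_def abs_mult)
      then have fl: "f\<^sup>2 \<le> d\<^sup>2 * l\<^sup>2" by (simp add: abs_le_square_iff power_mult_distrib)
      have "(cos (\<theta> x) * u x - cos (\<theta> y) * u y)\<^sup>2 + (sin (\<theta> x) * u x - sin (\<theta> y) * u y)\<^sup>2
        = (u x)\<^sup>2 * ((cos (\<theta> x))\<^sup>2 + (sin (\<theta> x))\<^sup>2) + (u y)\<^sup>2 * ((cos (\<theta> y))\<^sup>2 + (sin (\<theta> y))\<^sup>2)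
          - 2 * u x * u y * (cos (\<theta> x) * cos (\<theta> y) + sin (\<theta> x) * sin (\<theta> y))"
        by algebra
      also have "\<dots> = (u x - u y)\<^sup>2 + 2 * (u x * u y) * (1 - cos f)"
        unfolding f_def cos_diff sin_cos_squared_add2 by (simp add: power2_eq_square algebra_simps)
      also have "2 * (u x * u y) * (1 - cos f) \<le> ((u x)\<^sup>2 + (u y)\<^sup>2) * (f\<^sup>2 / 2)"
      proof -
        have c: "0 \<le> 1 - cos f" by simp
        have "1 - cos f \<le> f\<^sup>2 / 2"
        proof -
          have "cos f = 1 - 2 * (sin (f / 2))\<^sup>2" using cos_double_sin[of "f / 2"] by simp
          moreover have "(sin (f / 2))\<^sup>2 \<le> (f / 2)\<^sup>2"
            using abs_sin_x_le_abs_x[of "f / 2"] by (simp only: abs_le_square_iff)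
          ultimately show ?thesis by (simp add: power_divide)
        qed
        moreover have "2 * (u x * u y) \<le> (u x)\<^sup>2 + (u y)\<^sup>2" using sum_squares_bound[of "u x" "u y"] by simp
        ultimately show ?thesis using c by (intro mult_mono) auto
      qed
      also have "((u x)\<^sup>2 + (u y)\<^sup>2) * (f\<^sup>2 / 2) \<le> ((u x)\<^sup>2 + (u y)\<^sup>2) * (d\<^sup>2 * l\<^sup>2 / 2)"
        using fl by (intro mult_left_mono) auto
      finally have "((cos (\<theta> x) * u x - cos (\<theta> y) * u y)\<^sup>2 + (sin (\<theta> x) * u x - sin (\<theta> y) * u y)\<^sup>2) / k x y
        \<le> ((u x - u y)\<^sup>2 + ((u x)\<^sup>2 + (u y)\<^sup>2) * (d\<^sup>2 * l\<^sup>2 / 2)) / k x y"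
        using k0 by (intro divide_right_mono) auto
      also have "\<dots> = (u x - u y)\<^sup>2 / k x y + (g x y + g y x)"
        by (simp add: g_def l_def ks[of y x] add_divide_distrib power2_commute[of "ln (norm y)"] algebra_simps)
      finally show ?thesis
        using k0 by (simp add: ennreal_plus[symmetric] add_divide_distrib g_def del: ennreal_plus)
    qed
    have gi: "(\<integral>\<^sup>+x. \<integral>\<^sup>+y. ennreal (g x y) \<partial>lborel \<partial>lborel) \<le> ennreal (d\<^sup>2 * D / 2) * hardy_integral s 0 u"
    proof -
      have "(\<integral>\<^sup>+x. \<integral>\<^sup>+y. ennreal (g x y) \<partial>lborel \<partial>lborel) \<le> (\<integral>\<^sup>+x. ennreal (d\<^sup>2 * D / 2) * ennreal ((u x)\<^sup>2 / norm (x - 0) powr (2 * s)) \<partial>lborel)"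
      proof (rule nn_integral_mono_off_point[where c = 0])
        fix x :: 'a assume x: "x \<noteq> 0"
        have "(\<integral>\<^sup>+y. ennreal (g x y) \<partial>lborel) = (\<integral>\<^sup>+y. ennreal (d\<^sup>2 / 2 * (u x)\<^sup>2) * ennreal ((ln (norm x) - ln (norm y))\<^sup>2 * (norm y / norm x) powr (- 0) / norm (x - y) powr (?n + 2 * s)) \<partial>lborel)"
        proof (rule nn_integral_cong_off_point[where c = 0])
          fix y :: 'a assume "y \<noteq> 0"
          then have "(norm y / norm x) powr (- 0) = 1" using x by simp
          then show "ennreal (g x y) = ennreal (d\<^sup>2 / 2 * (u x)\<^sup>2) * ennreal ((ln (norm x) - ln (norm y))\<^sup>2 * (norm y / norm x) powr (- 0) / norm (x - y) powr (?n + 2 * s))"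
            unfolding g_def k_def by (subst ennreal_mult[symmetric]) auto
        qed
        also have "\<dots> = ennreal (d\<^sup>2 / 2 * (u x)\<^sup>2) * (\<integral>\<^sup>+y. ennreal ((ln (norm x) - ln (norm y))\<^sup>2 * (norm y / norm x) powr (- 0) / norm (x - y) powr (?n + 2 * s)) \<partial>lborel)"
          by (rule nn_integral_cmult) measurable
        also have "\<dots> \<le> ennreal (d\<^sup>2 / 2 * (u x)\<^sup>2) * ennreal (D * norm x powr (- (2 * s)))"
          by (intro mult_left_mono D[OF x]) auto
        also have "\<dots> = ennreal (d\<^sup>2 * D / 2) * ennreal ((u x)\<^sup>2 / norm (x - 0) powr (2 * s))"
          using D0 by (simp add: ennreal_mult[symmetric] powr_minus_divide mult_ac)
        finally show "(\<integral>\<^sup>+y. ennreal (g x y) \<partial>lborel) \<le> ennreal (d\<^sup>2 * D / 2) * ennreal ((u x)\<^sup>2 / norm (x - 0) powr (2 * s))" .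
      qed
      also have "\<dots> = ennreal (d\<^sup>2 * D / 2) * hardy_integral s 0 u"
        unfolding hardy_integral_def by (rule nn_integral_cmult) measurable
      finally show ?thesis .
    qed
    have gi': "(\<integral>\<^sup>+x. \<integral>\<^sup>+y. ennreal (g y x) \<partial>lborel \<partial>lborel) = (\<integral>\<^sup>+x. \<integral>\<^sup>+y. ennreal (g x y) \<partial>lborel \<partial>lborel)"
      by (rule lborel_pair.Fubini') measurable
    have "frac_energy s (\<lambda>x. cos (\<theta> x) * u x) + frac_energy s (\<lambda>x. sin (\<theta> x) * u x)
      = (\<integral>\<^sup>+x. \<integral>\<^sup>+y. ennreal ((cos (\<theta> x) * u x - cos (\<theta> y) * u y)\<^sup>2 / k x y) + ennreal ((sin (\<theta> x) * u x - sin (\<theta> y) * u y)\<^sup>2 / k x y) \<partial>lborel \<partial>lborel)"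
      unfolding frac_energy_def k_def[symmetric] by (simp add: nn_integral_add)
    also have "\<dots> \<le> (\<integral>\<^sup>+x. \<integral>\<^sup>+y. ennreal ((u x - u y)\<^sup>2 / k x y) + (ennreal (g x y) + ennreal (g y x)) \<partial>lborel \<partial>lborel)"
    proof (rule nn_integral_mono_off_point[where c = 0])
      fix x :: 'a assume x: "x \<noteq> 0"
      show "(\<integral>\<^sup>+y. ennreal ((cos (\<theta> x) * u x - cos (\<theta> y) * u y)\<^sup>2 / k x y) + ennreal ((sin (\<theta> x) * u x - sin (\<theta> y) * u y)\<^sup>2 / k x y) \<partial>lborel)
        \<le> (\<integral>\<^sup>+y. ennreal ((u x - u y)\<^sup>2 / k x y) + (ennreal (g x y) + ennreal (g y x)) \<partial>lborel)"
        by (rule nn_integral_mono_off_point[where c = 0], rule pw[OF x])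
    qed
    also have "\<dots> = frac_energy s u + ((\<integral>\<^sup>+x. \<integral>\<^sup>+y. ennreal (g x y) \<partial>lborel \<partial>lborel) + (\<integral>\<^sup>+x. \<integral>\<^sup>+y. ennreal (g y x) \<partial>lborel \<partial>lborel))"
      unfolding frac_energy_def k_def[symmetric] by (simp add: nn_integral_add)
    also have "\<dots> \<le> frac_energy s u + (ennreal (d\<^sup>2 * D / 2) * hardy_integral s 0 u + ennreal (d\<^sup>2 * D / 2) * hardy_integral s 0 u)"
      unfolding gi' by (intro add_mono gi order_refl)
    also have "ennreal (d\<^sup>2 * D / 2) * hardy_integral s 0 u + ennreal (d\<^sup>2 * D / 2) * hardy_integral s 0 u = ennreal (d\<^sup>2 * D) * hardy_integral s 0 u"
    proof -
      have nn: "0 \<le> d\<^sup>2 * D / 2" using D0 by simp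
      have "d\<^sup>2 * D / 2 + d\<^sup>2 * D / 2 = d\<^sup>2 * D" by simp
      then show ?thesis by (simp only: distrib_right[symmetric] ennreal_plus[OF nn nn, symmetric])
    qed
    finally show "frac_energy s (\<lambda>x. cos (\<theta> x) * u x) + frac_energy s (\<lambda>x. sin (\<theta> x) * u x)
      \<le> frac_energy s u + ennreal (d\<^sup>2 * D) * hardy_integral s 0 u" .
  qed
qed


section \<open>Real-valued energies and the comparison of poles\<close>

definition hardy_real :: "real \<Rightarrow> 'a::euclidean_space \<Rightarrow> ('a \<Rightarrow> real) \<Rightarrow> real" where
  "hardy_real s p u = enn2real (hardy_integral s p u)"

definition energy_real :: "real \<Rightarrow> ('a::euclidean_space \<Rightarrow> real) \<Rightarrow> real" where
  "energy_real s u = C_Ns DIM('a) s / 2 * enn2real (frac_energy s u)"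

text \<open>\<open>enn2real\<close> sends infinity to 0, so \<open>energy_real\<close> carries
  information only when the energy is finite, which this predicate records.\<close>

definition finite_energy :: "real \<Rightarrow> ('a::euclidean_space \<Rightarrow> real) \<Rightarrow> bool" where
  "finite_energy s u \<longleftrightarrow> bounded_support u \<and> frac_energy s u < \<infinity>"

lemma hardy_real_nonneg: "hardy_real s p u \<ge> 0"
  by (simp add: hardy_real_def)

lemma energy_real_nonneg: "0 < s \<Longrightarrow> s < 1 \<Longrightarrow> energy_real s u \<ge> 0"
  using C_Ns_pos[of s] by (simp add: energy_real_def less_imp_le)

lemma ennreal_hardy_real:
  fixes u :: "'a::euclidean_space \<Rightarrow> real"
  assumes "bounded_support u" "real DIM('a) > 2 * s"
  shows "ennreal (hardy_real s p u) = hardy_integral s p u"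
  unfolding hardy_real_def using hardy_integral_finite[OF assms] by (intro ennreal_enn2real) simp

lemma hardy_inequality_real:
  fixes u :: "'a::euclidean_space \<Rightarrow> real"
  assumes s: "0 < s" "s < 1" and N: "real DIM('a) > 2 * s" and u: "finite_energy s u"
  shows "gamma_H DIM('a) s * hardy_real s p u \<le> energy_real s u"
proof -
  have b: "bounded_support u" and E: "frac_energy s u < \<infinity>" using u by (auto simp: finite_energy_def)
  have "ennreal (gamma_H DIM('a) s * hardy_real s p u) = ennreal (gamma_H DIM('a) s) * hardy_integral s p u"
    unfolding ennreal_hardy_real[OF b N, symmetric] using gamma_H_pos[OF s(1) N]
    by (intro ennreal_mult) (auto simp: hardy_real_nonneg)
  also have "\<dots> \<le> ennreal (C_Ns DIM('a) s / 2) * frac_energy s u"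
    by (rule hardy_inequality[OF s N b])
  also have "frac_energy s u = ennreal (enn2real (frac_energy s u))"
    using E by (intro ennreal_enn2real[symmetric]) simp
  also have "ennreal (C_Ns DIM('a) s / 2) * \<dots> = ennreal (energy_real s u)"
    unfolding energy_real_def using C_Ns_pos[OF s] by (intro ennreal_mult[symmetric]) (auto simp: less_imp_le)
  finally show ?thesis by (simp add: energy_real_nonneg[OF s])
qed

lemma hardy_real_mono:
  fixes w :: "'a::euclidean_space \<Rightarrow> real"
  assumes w: "bounded_support w" and N: "real DIM('a) > 2 * s" and c: "c \<ge> 0"
    and le: "\<And>x. w x \<noteq> 0 \<Longrightarrow> x \<noteq> q \<Longrightarrow> 1 / norm (x - p) powr (2 * s) \<le> c / norm (x - q) powr (2 * s)"
  shows "hardy_real s p w \<le> c * hardy_real s q w"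
proof -
  note [measurable] = bounded_supportD[OF w]
  have "hardy_integral s p w \<le> (\<integral>\<^sup>+x. ennreal c * ennreal ((w x)\<^sup>2 / norm (x - q) powr (2 * s)) \<partial>lborel)"
    unfolding hardy_integral_def
  proof (rule nn_integral_mono_off_point[where c = q])
    fix x assume x: "x \<noteq> q"
    show "ennreal ((w x)\<^sup>2 / norm (x - p) powr (2 * s)) \<le> ennreal c * ennreal ((w x)\<^sup>2 / norm (x - q) powr (2 * s))"
    proof (cases "w x = 0")
      case False
      have "(w x)\<^sup>2 * (1 / norm (x - p) powr (2 * s)) \<le> (w x)\<^sup>2 * (c / norm (x - q) powr (2 * s))"
        by (intro mult_left_mono le False x) auto
      then show ?thesis using c by (simp add: ennreal_mult[symmetric] ennreal_leI mult.commute)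
    qed simp
  qed
  also have "\<dots> = ennreal c * hardy_integral s q w"
    unfolding hardy_integral_def by (rule nn_integral_cmult) measurable
  finally have "ennreal (hardy_real s p w) \<le> ennreal (c * hardy_real s q w)"
    unfolding ennreal_hardy_real[OF w N, symmetric] using c by (simp add: ennreal_mult hardy_real_nonneg)
  then show ?thesis using c by (simp add: hardy_real_nonneg)
qed

text \<open>On the support of \<open>w\<close> the distance to \<open>p\<close> is at least
  \<open>e powr (- (1 / (2 * s)))\<close> times the distance to \<open>q\<close>. Raised to the
  power \<open>2 * s\<close>, this is the factor \<open>1 / e\<close> between the weights.\<close>

lemma hardy_real_near_other_pole:
  fixes w :: "'a::euclidean_space \<Rightarrow> real"
  assumes w: "bounded_support w" and s: "0 < s" and N: "real DIM('a) > 2 * s" and e: "e > 0"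
    and r: "\<And>x. r < norm (x - q) \<Longrightarrow> w x = 0" and p: "r * (1 + e powr (- (1 / (2 * s)))) \<le> norm (p - q)" and r0: "r > 0"
  shows "hardy_real s p w \<le> e * hardy_real s q w"
proof (rule hardy_real_mono[OF w N])
  fix x assume "w x \<noteq> 0" and x: "x \<noteq> q"
  then have xr: "norm (x - q) \<le> r" using r[of x] by force
  have "norm (p - q) \<le> norm (x - p) + norm (x - q)"
    using norm_triangle_ineq4[of "x - q" "x - p"] by (simp add: add.commute)
  then have "r * e powr (- (1 / (2 * s))) \<le> norm (x - p)"
    using p xr by (simp add: algebra_simps)
  moreover have "norm (x - q) * e powr (- (1 / (2 * s))) \<le> r * e powr (- (1 / (2 * s)))"
    using xr by (intro mult_right_mono) auto
  ultimately have "norm (x - q) * e powr (- (1 / (2 * s))) \<le> norm (x - p)" by simp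
  then have "(norm (x - q) * e powr (- (1 / (2 * s)))) powr (2 * s) \<le> norm (x - p) powr (2 * s)"
    using s by (intro powr_mono2) auto
  also have "(norm (x - q) * e powr (- (1 / (2 * s)))) powr (2 * s) = norm (x - q) powr (2 * s) / e"
  proof -
    have "- (1 / (2 * s)) * (2 * s) = - 1" using s by simp
    then have "(e powr (- (1 / (2 * s)))) powr (2 * s) = inverse e"
      unfolding powr_powr using e by (simp only: powr_minus powr_one)
    then show ?thesis using e by (simp only: powr_mult norm_ge_zero powr_ge_zero divide_inverse)
  qed
  finally have le: "norm (x - q) powr (2 * s) / e \<le> norm (x - p) powr (2 * s)" .
  have "1 / norm (x - p) powr (2 * s) \<le> 1 / (norm (x - q) powr (2 * s) / e)"
  proof (rule divide_left_mono[OF le])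
    have pos: "0 < norm (x - q) powr (2 * s) / e" using x e by simp
    then have "0 < norm (x - p) powr (2 * s)" using le by linarith
    then show "0 < norm (x - p) powr (2 * s) * (norm (x - q) powr (2 * s) / e)" using pos by (rule mult_pos_pos)
  qed simp
  then show "1 / norm (x - p) powr (2 * s) \<le> e / norm (x - q) powr (2 * s)" by simp
qed (use e in simp)

text \<open>Far out the quotient of \<open>norm (x - p)\<close> and \<open>norm x\<close> is
  uniformly close to 1, hence so is the quotient of the weights.\<close>

lemma hardy_real_far_from_poles:
  fixes p :: "'a::euclidean_space"
  assumes s: "0 < s" and N: "real DIM('a) > 2 * s" and e: "e > 0"
  obtains R where "R > 0" "\<And>w :: 'a \<Rightarrow> real. bounded_support w \<Longrightarrow> (\<And>x. norm x < R \<Longrightarrow> w x = 0) \<Longrightarrow>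
    \<bar>hardy_real s p w - hardy_real s 0 w\<bar> \<le> e * hardy_real s 0 w"
proof -
  \<comment> \<open>The cap keeps \<open>1 - e'\<close> positive; the lower comparison divides by
    it.\<close>
  define e' where "e' = min e (1 / 2)"
  have e': "0 < e'" "e' \<le> 1 / 2" "e' \<le> e" using e by (auto simp: e'_def)
  have "((\<lambda>t::real. t powr (- (2 * s))) \<longlongrightarrow> 1 powr (- (2 * s))) (at 1)"
    by (intro tendsto_intros) auto
  then have "\<forall>\<^sub>F t in at (1::real). dist (t powr (- (2 * s))) (1 powr (- (2 * s))) < e'"
    using e'(1) by (rule tendstoD)
  then obtain dl where dl: "dl > 0" "\<And>t::real. t \<noteq> 1 \<Longrightarrow> dist t 1 < dl \<Longrightarrow> \<bar>t powr (- (2 * s)) - 1\<bar> < e'"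
    unfolding eventually_at by (auto simp: dist_real_def)
  have dl2: "\<bar>t powr (- (2 * s)) - 1\<bar> \<le> e'" if "\<bar>t - 1\<bar> < dl" for t :: real
    using dl(2)[of t] that e' by (cases "t = 1") (auto simp: dist_real_def)
  define R where "R = norm p / dl + 1"
  have R: "R > 0" using dl by (simp add: R_def add_nonneg_pos)
  have key: "\<bar>norm x powr (2 * s) / norm (x - p) powr (2 * s) - 1\<bar> \<le> e'" if x: "norm x \<ge> R" for x
  proof -
    have x0: "norm x > 0" using R x by linarith
    define t where "t = norm (x - p) / norm x"
    have "\<bar>norm (x - p) - norm x\<bar> \<le> norm p" using norm_triangle_ineq3[of "x - p" x] by simp
    moreover have "norm p < dl * norm x"
      using x dl by (simp add: R_def field_simps)
    ultimately have "\<bar>norm (x - p) - norm x\<bar> < dl * norm x" by simp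
    moreover have "t - 1 = (norm (x - p) - norm x) / norm x" using x0 by (simp add: t_def diff_divide_distrib)
    ultimately have "\<bar>t - 1\<bar> < dl" using x0 by (simp add: pos_divide_less_eq abs_divide)
    then have "\<bar>t powr (- (2 * s)) - 1\<bar> \<le> e'" by (rule dl2)
    then show ?thesis by (simp add: t_def powr_divide powr_minus_divide)
  qed
  show thesis
  proof (rule that[OF R])
    fix w :: "'a \<Rightarrow> real" assume w: "bounded_support w" and far: "\<And>x. norm x < R \<Longrightarrow> w x = 0"
    have up: "hardy_real s p w \<le> (1 + e') * hardy_real s 0 w"
    proof (rule hardy_real_mono[OF w N])
      fix x :: 'a assume "w x \<noteq> 0" "x \<noteq> 0"
      then have "norm x \<ge> R" using far[of x] by force
      then have "norm x powr (2 * s) / norm (x - p) powr (2 * s) \<le> 1 + e'" using key[of x] by linarith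
      then show "1 / norm (x - p) powr (2 * s) \<le> (1 + e') / norm (x - 0) powr (2 * s)"
        using \<open>x \<noteq> 0\<close> by (simp add: pos_le_divide_eq mult.commute)
    qed (use e' in simp)
    have lo: "hardy_real s 0 w \<le> 1 / (1 - e') * hardy_real s p w"
    proof (rule hardy_real_mono[OF w N])
      fix x :: 'a assume "w x \<noteq> 0" "x \<noteq> p"
      then have "norm x \<ge> R" using far[of x] by force
      then have "1 - e' \<le> norm x powr (2 * s) / norm (x - p) powr (2 * s)" "norm x > 0" using key[of x] R by linarith+
      then show "1 / norm (x - 0) powr (2 * s) \<le> 1 / (1 - e') / norm (x - p) powr (2 * s)"
        using e' \<open>x \<noteq> p\<close> by (simp add: divide_simps mult_ac)
    qed (use e' in simp)
    have "(1 - e') * hardy_real s 0 w \<le> hardy_real s p w"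
      using lo e' by (simp add: pos_le_divide_eq mult.commute)
    then have "\<bar>hardy_real s p w - hardy_real s 0 w\<bar> \<le> e' * hardy_real s 0 w"
      using up by (simp add: algebra_simps abs_le_iff)
    also have "\<dots> \<le> e * hardy_real s 0 w"
      using e' by (intro mult_right_mono) (auto simp: hardy_real_nonneg)
    finally show "\<bar>hardy_real s p w - hardy_real s 0 w\<bar> \<le> e * hardy_real s 0 w" .
  qed
qed

lemma hardy_real_partition:
  fixes u :: "'a::euclidean_space \<Rightarrow> real"
  assumes u: "bounded_support u" and [measurable]: "\<theta> \<in> borel_measurable borel" and N: "real DIM('a) > 2 * s"
  shows "hardy_real s p u = hardy_real s p (\<lambda>x. cos (\<theta> x) * u x) + hardy_real s p (\<lambda>x. sin (\<theta> x) * u x)"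
proof -
  note [measurable] = bounded_supportD[OF u]
  have c: "bounded_support (\<lambda>x. cos (\<theta> x) * u x)" and sn: "bounded_support (\<lambda>x. sin (\<theta> x) * u x)"
    by (rule bounded_support_mult[OF u]; simp)+
  have "hardy_integral s p (\<lambda>x. cos (\<theta> x) * u x) + hardy_integral s p (\<lambda>x. sin (\<theta> x) * u x) = hardy_integral s p u"
    unfolding hardy_integral_def
  proof (subst nn_integral_add[symmetric])
    show "(\<integral>\<^sup>+x. ennreal ((cos (\<theta> x) * u x)\<^sup>2 / norm (x - p) powr (2 * s)) + ennreal ((sin (\<theta> x) * u x)\<^sup>2 / norm (x - p) powr (2 * s)) \<partial>lborel)
      = (\<integral>\<^sup>+x. ennreal ((u x)\<^sup>2 / norm (x - p) powr (2 * s)) \<partial>lborel)"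
      by (intro nn_integral_cong)
        (simp add: ennreal_plus[symmetric] add_divide_distrib[symmetric] power_mult_distrib distrib_right[symmetric] del: ennreal_plus)
  qed measurable
  then have "ennreal (hardy_real s p (\<lambda>x. cos (\<theta> x) * u x) + hardy_real s p (\<lambda>x. sin (\<theta> x) * u x)) = ennreal (hardy_real s p u)"
    by (simp add: ennreal_hardy_real[OF c N] ennreal_hardy_real[OF sn N] ennreal_hardy_real[OF u N] hardy_real_nonneg)
  then show ?thesis by (simp add: hardy_real_nonneg add_nonneg_nonneg del: ennreal_plus)
qed

text \<open>The Hardy inequality absorbs the additive error of \<open>energy_partition\<close>, so
  localisation costs only a factor close to 1.\<close>

lemma energy_real_partition:
  assumes s: "0 < s" "s < 1" and N: "real DIM('a::euclidean_space) > 2 * s"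
  obtains D where "D \<ge> 0" "\<And>(u :: 'a \<Rightarrow> real) \<theta> d. finite_energy s u \<Longrightarrow> \<theta> \<in> borel_measurable borel \<Longrightarrow>
    (\<And>x y. x \<noteq> 0 \<Longrightarrow> y \<noteq> 0 \<Longrightarrow> \<bar>\<theta> x - \<theta> y\<bar> \<le> d * \<bar>ln (norm x) - ln (norm y)\<bar>) \<Longrightarrow>
    finite_energy s (\<lambda>x. cos (\<theta> x) * u x) \<and> finite_energy s (\<lambda>x. sin (\<theta> x) * u x) \<and>
    energy_real s (\<lambda>x. cos (\<theta> x) * u x) + energy_real s (\<lambda>x. sin (\<theta> x) * u x)
      \<le> (1 + d\<^sup>2 * D) * energy_real s u"
proof -
  obtain D where D0: "D \<ge> 0" and D: "\<And>(u :: 'a \<Rightarrow> real) \<theta> d. u \<in> borel_measurable borel \<Longrightarrow> \<theta> \<in> borel_measurable borel \<Longrightarrow>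
    (\<And>x y. x \<noteq> 0 \<Longrightarrow> y \<noteq> 0 \<Longrightarrow> \<bar>\<theta> x - \<theta> y\<bar> \<le> d * \<bar>ln (norm x) - ln (norm y)\<bar>) \<Longrightarrow>
    frac_energy s (\<lambda>x. cos (\<theta> x) * u x) + frac_energy s (\<lambda>x. sin (\<theta> x) * u x)
      \<le> frac_energy s u + ennreal (d\<^sup>2 * D) * hardy_integral s 0 u"
    using energy_partition[OF s, where 'a = 'a] by blast
  define G where "G = C_Ns DIM('a) s / 2"
  define \<gamma> where "\<gamma> = gamma_H DIM('a) s"
  have G: "G > 0" and \<gamma>: "\<gamma> > 0" using C_Ns_pos[OF s] gamma_H_pos[OF s(1) N] by (auto simp: G_def \<gamma>_def)
  show thesis
  proof (rule that[of "G * D / \<gamma>"])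
    show "G * D / \<gamma> \<ge> 0" using D0 G \<gamma> by simp
    fix u \<theta> :: "'a \<Rightarrow> real" and d
    assume u: "finite_energy s u" and [measurable]: "\<theta> \<in> borel_measurable borel"
      and Lip: "\<And>x y. x \<noteq> 0 \<Longrightarrow> y \<noteq> 0 \<Longrightarrow> \<bar>\<theta> x - \<theta> y\<bar> \<le> d * \<bar>ln (norm x) - ln (norm y)\<bar>"
    have b: "bounded_support u" and E: "frac_energy s u < \<infinity>" using u by (auto simp: finite_energy_def)
    note [measurable] = bounded_supportD[OF b]
    define Ec Es where "Ec = frac_energy s (\<lambda>x. cos (\<theta> x) * u x)" and "Es = frac_energy s (\<lambda>x. sin (\<theta> x) * u x)"
    have le: "Ec + Es \<le> frac_energy s u + ennreal (d\<^sup>2 * D) * hardy_integral s 0 u"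
      unfolding Ec_def Es_def by (rule D) (use Lip in auto)
    also have "\<dots> < \<infinity>" using E hardy_integral_finite[OF b N] by (simp add: ennreal_mult_less_top)
    finally have fin: "Ec < \<infinity>" "Es < \<infinity>" by (simp_all add: ennreal_add_less_top)
    have "ennreal (enn2real Ec + enn2real Es) = Ec + Es" using fin by simp
    also note le
    also have "frac_energy s u + ennreal (d\<^sup>2 * D) * hardy_integral s 0 u = ennreal (enn2real (frac_energy s u) + d\<^sup>2 * D * hardy_real s 0 u)"
      using E D0 by (simp add: ennreal_hardy_real[OF b N, symmetric] ennreal_mult hardy_real_nonneg)
    finally have "enn2real Ec + enn2real Es \<le> enn2real (frac_energy s u) + d\<^sup>2 * D * hardy_real s 0 u"
      using D0 by (subst (asm) ennreal_le_iff) (auto intro!: add_nonneg_nonneg mult_nonneg_nonneg hardy_real_nonneg)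
    then have "G * (enn2real Ec + enn2real Es) \<le> G * (enn2real (frac_energy s u) + d\<^sup>2 * D * hardy_real s 0 u)"
      using G by (intro mult_left_mono) auto
    also have "\<dots> = energy_real s u + d\<^sup>2 * (G * D / \<gamma>) * (\<gamma> * hardy_real s 0 u)"
      using \<gamma> by (simp add: energy_real_def G_def algebra_simps)
    also have "\<dots> \<le> energy_real s u + d\<^sup>2 * (G * D / \<gamma>) * energy_real s u"
      using hardy_inequality_real[OF s N u, of 0] D0 G \<gamma> by (intro add_left_mono mult_left_mono) (auto simp: \<gamma>_def)
    finally have "energy_real s (\<lambda>x. cos (\<theta> x) * u x) + energy_real s (\<lambda>x. sin (\<theta> x) * u x) \<le> (1 + d\<^sup>2 * (G * D / \<gamma>)) * energy_real s u"
      by (simp add: energy_real_def Ec_def Es_def G_def algebra_simps)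
    moreover have "bounded_support (\<lambda>x. cos (\<theta> x) * u x)" "bounded_support (\<lambda>x. sin (\<theta> x) * u x)"
      by (rule bounded_support_mult[OF b]; simp)+
    ultimately show "finite_energy s (\<lambda>x. cos (\<theta> x) * u x) \<and> finite_energy s (\<lambda>x. sin (\<theta> x) * u x) \<and>
      energy_real s (\<lambda>x. cos (\<theta> x) * u x) + energy_real s (\<lambda>x. sin (\<theta> x) * u x) \<le> (1 + d\<^sup>2 * (G * D / \<gamma>)) * energy_real s u"
      using fin by (auto simp: finite_energy_def Ec_def Es_def)
  qed
qed


section \<open>Adding poles\<close>

text \<open>Positive definiteness with gap \<open>1 - q\<close>, tested on functions of finite
  energy, where cut-offs may be applied. One \<open>q\<close> below 1 serves all functions, which
  leaves room for the localisation error.\<close>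

definition strictly_subcritical :: "real \<Rightarrow> nat set \<Rightarrow> (nat \<Rightarrow> real) \<Rightarrow> (nat \<Rightarrow> 'a::euclidean_space) \<Rightarrow> bool" where
  "strictly_subcritical s I lam a \<longleftrightarrow> (\<exists>q. 0 \<le> q \<and> q < 1 \<and>
     (\<forall>u. finite_energy s u \<longrightarrow> (\<Sum>i\<in>I. lam i * hardy_real s (a i) u) \<le> q * energy_real s u))"

lemma hardy_sum_far_from_poles:
  fixes a :: "nat \<Rightarrow> 'a::euclidean_space"
  assumes "finite I" and s: "0 < s" and N: "real DIM('a) > 2 * s" and e: "e > 0"
  obtains R where "R > 0" "\<And>w :: 'a \<Rightarrow> real. bounded_support w \<Longrightarrow> (\<And>x. norm x < R \<Longrightarrow> w x = 0) \<Longrightarrow>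
    \<bar>(\<Sum>i\<in>I. lam i * hardy_real s (a i) w) - (\<Sum>i\<in>I. lam i) * hardy_real s 0 w\<bar> \<le> e * hardy_real s 0 w"
proof -
  define S where "S = (\<Sum>i\<in>I. \<bar>lam i\<bar>)"
  have S: "S \<ge> 0" by (simp add: S_def sum_nonneg)
  define e' where "e' = e / (S + 1)"
  have e': "e' > 0" using e S by (simp add: e'_def)
  have "S * e' \<le> e" using e S by (simp add: e'_def field_simps)
  have "\<forall>i\<in>I. \<exists>R>0. \<forall>w. bounded_support w \<longrightarrow> (\<forall>x. norm x < R \<longrightarrow> w x = 0) \<longrightarrow>
    \<bar>hardy_real s (a i) w - hardy_real s 0 w\<bar> \<le> e' * hardy_real s 0 w"
    using hardy_real_far_from_poles[OF s N e'] by metis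
  then obtain R where R: "\<And>i. i \<in> I \<Longrightarrow> R i > 0" "\<And>i w. i \<in> I \<Longrightarrow> bounded_support w \<Longrightarrow> (\<forall>x. norm x < R i \<longrightarrow> w x = 0) \<Longrightarrow>
    \<bar>hardy_real s (a i) w - hardy_real s 0 w\<bar> \<le> e' * hardy_real s 0 w"
    by metis
  define R' where "R' = Max (insert 1 (R ` I))"
  have R': "R' > 0" "\<And>i. i \<in> I \<Longrightarrow> R i \<le> R'"
    using assms(1) by (auto simp: R'_def Max_ge_iff less_le_trans[OF zero_less_one] intro!: Max_ge)
  show thesis
  proof (rule that[OF R'(1)])
    fix w :: "'a \<Rightarrow> real" assume w: "bounded_support w" "\<And>x. norm x < R' \<Longrightarrow> w x = 0"
    have "\<bar>(\<Sum>i\<in>I. lam i * hardy_real s (a i) w) - (\<Sum>i\<in>I. lam i) * hardy_real s 0 w\<bar>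
      = \<bar>\<Sum>i\<in>I. lam i * (hardy_real s (a i) w - hardy_real s 0 w)\<bar>"
      by (simp add: sum_distrib_right right_diff_distrib sum_subtractf)
    also have "\<dots> \<le> (\<Sum>i\<in>I. \<bar>lam i\<bar> * (e' * hardy_real s 0 w))"
    proof (rule order_trans[OF sum_abs], rule sum_mono)
      fix i assume i: "i \<in> I"
      then have "\<forall>x. norm x < R i \<longrightarrow> w x = 0" using w(2) R'(2)[OF i] by force
      then have "\<bar>hardy_real s (a i) w - hardy_real s 0 w\<bar> \<le> e' * hardy_real s 0 w" using R(2)[OF i w(1)] by blast
      then show "\<bar>lam i * (hardy_real s (a i) w - hardy_real s 0 w)\<bar> \<le> \<bar>lam i\<bar> * (e' * hardy_real s 0 w)"
        by (simp add: abs_mult mult_left_mono)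
    qed
    also have "\<dots> = S * e' * hardy_real s 0 w" by (simp add: S_def sum_distrib_right mult.assoc)
    also have "\<dots> \<le> e * hardy_real s 0 w"
      using \<open>S * e' \<le> e\<close> by (intro mult_right_mono) (auto simp: hardy_real_nonneg)
    finally show "\<bar>(\<Sum>i\<in>I. lam i * hardy_real s (a i) w) - (\<Sum>i\<in>I. lam i) * hardy_real s 0 w\<bar> \<le> e * hardy_real s 0 w" .
  qed
qed

text \<open>
  The new pole is placed so far away that a cut-off which varies slowly on the logarithmic scale separates
  it from the old ones; the cut-off costs only a small multiple of the energy, by \<open>energy_real_partition\<close>.
\<close>

lemma strictly_subcritical_insert_pole:
  fixes a :: "nat \<Rightarrow> 'a::euclidean_space"
  assumes s: "0 < s" "s < 1" and N: "real DIM('a) > 2 * s"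
    and I: "finite I" "i0 \<notin> I" and sub: "strictly_subcritical s I lam a"
    and l0: "0 \<le> lam i0" "lam i0 < gamma_H DIM('a) s" and lS: "(\<Sum>i\<in>insert i0 I. lam i) < gamma_H DIM('a) s"
  shows "\<exists>b. b \<notin> a ` I \<and> strictly_subcritical s (insert i0 I) lam (a(i0 := b))"
proof -
  define \<gamma> where "\<gamma> = gamma_H DIM('a) s"
  have \<gamma>: "\<gamma> > 0" using gamma_H_pos[OF s(1) N] by (simp add: \<gamma>_def)
  define l where "l = lam i0"
  define S where "S = (\<Sum>i\<in>I. lam i)"
  have l: "0 \<le> l" "l < \<gamma>" and lS': "S + l < \<gamma>"
    using l0 lS I by (auto simp: l_def S_def \<gamma>_def add.commute)
  obtain q1 where q1: "0 \<le> q1" "q1 < 1"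
    and sub1: "\<And>u. finite_energy s u \<Longrightarrow> (\<Sum>i\<in>I. lam i * hardy_real s (a i) u) \<le> q1 * energy_real s u"
    using sub by (auto simp: strictly_subcritical_def)
  obtain D where D0: "D \<ge> 0" and D: "\<And>(u :: 'a \<Rightarrow> real) \<theta> d. finite_energy s u \<Longrightarrow> \<theta> \<in> borel_measurable borel \<Longrightarrow>
    (\<And>x y. x \<noteq> 0 \<Longrightarrow> y \<noteq> 0 \<Longrightarrow> \<bar>\<theta> x - \<theta> y\<bar> \<le> d * \<bar>ln (norm x) - ln (norm y)\<bar>) \<Longrightarrow>
    finite_energy s (\<lambda>x. cos (\<theta> x) * u x) \<and> finite_energy s (\<lambda>x. sin (\<theta> x) * u x) \<and>
    energy_real s (\<lambda>x. cos (\<theta> x) * u x) + energy_real s (\<lambda>x. sin (\<theta> x) * u x)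
      \<le> (1 + d\<^sup>2 * D) * energy_real s u"
    using energy_real_partition[OF s N] by blast
  \<comment> \<open>Half of the gap below the Hardy constant is granted to the error of merging the
    old poles at the origin.\<close>
  define e where "e = (\<gamma> - S - l) / 2"
  have e: "e > 0" using lS' by (simp add: e_def)
  obtain R where R: "R > 0" and far: "\<And>w :: 'a \<Rightarrow> real. bounded_support w \<Longrightarrow> (\<And>x. norm x < R \<Longrightarrow> w x = 0) \<Longrightarrow>
    \<bar>(\<Sum>i\<in>I. lam i * hardy_real s (a i) w) - S * hardy_real s 0 w\<bar> \<le> e * hardy_real s 0 w"
    unfolding S_def using hardy_sum_far_from_poles[OF I(1) s(1) N e] by blast
  \<comment> \<open>The relative bound for the outer piece. A negative \<open>S + e\<close> is
    replaced by 0, as its term may be dropped; the numerator stays below \<open>\<gamma>\<close> in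
    that case because \<open>l < \<gamma>\<close>.\<close>
  define q2 where "q2 = (max 0 (S + e) + l) / \<gamma>"
  have q2: "0 \<le> q2" "q2 < 1" using l lS' \<gamma> e by (auto simp: q2_def e_def max_def field_simps)
  \<comment> \<open>Chosen so that the new pole uses at most half of the gap \<open>1 - q1\<close>
    on the inner piece.\<close>
  define et where "et = (1 - q1) / 2 * \<gamma> / (l + 1)"
  have et: "et > 0" using q1 \<gamma> l by (simp add: et_def)
  define q3 where "q3 = q1 + l * et / \<gamma>"
  have "l * et / \<gamma> = (1 - q1) / 2 * (l / (l + 1))" using \<gamma> by (simp add: et_def)
  also have "\<dots> \<le> (1 - q1) / 2 * 1" using q1 l by (intro mult_left_mono) auto
  finally have "l * et / \<gamma> \<le> (1 - q1) / 2 * 1" .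
  then have "q3 < 1" unfolding q3_def using q1 by argo
  moreover have "0 \<le> q3" using q1 l et \<gamma> by (simp add: q3_def)
  ultimately have q3: "0 \<le> q3" "q3 < 1" by simp_all
  define q where "q = max q2 q3"
  have q: "0 \<le> q" "q < 1" "q2 \<le> q" "q3 \<le> q" using q2 q3 by (auto simp: q_def)
  \<comment> \<open>Makes the localisation error at most half of the remaining gap, which suffices
    since \<open>q * (1 + (1 - q) / 2) < 1\<close>.\<close>
  define d where "d = sqrt ((1 - q) / 2 / (D + 1))"
  have d: "d > 0" using q D0 by (simp add: d_def)
  have d2: "d\<^sup>2 * D \<le> (1 - q) / 2"
  proof -
    have "d\<^sup>2 * D = (1 - q) / 2 * (D / (D + 1))" using q D0 by (simp add: d_def)
    also have "\<dots> \<le> (1 - q) / 2 * 1" using q D0 by (intro mult_left_mono) auto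
    finally show ?thesis by simp
  qed
  define Q where "Q = q * (1 + d\<^sup>2 * D)"
  have "Q \<le> q * (1 + (1 - q) / 2)" unfolding Q_def using d2 q by (intro mult_left_mono) auto
  also have "\<dots> < 1"
  proof -
    have "0 < (1 - q) * (2 - q)" using q by simp
    then show ?thesis by (simp add: field_simps)
  qed
  finally have Q: "0 \<le> Q" "Q < 1" using q D0 by (auto simp: Q_def)
  \<comment> \<open>The angle rises from 0 at radius \<open>R\<close> to \<open>pi / 2\<close> at
    radius \<open>R2\<close>, with slope \<open>d\<close> in \<open>ln (norm x)\<close>. The cosine
    piece lives inside \<open>R2\<close>, the sine piece outside \<open>R\<close>.\<close>
  define \<theta> where "\<theta> x = max 0 (min (pi / 2) (d * ln (norm x / R)))" for x :: 'a
  have [measurable]: "\<theta> \<in> borel_measurable borel" unfolding \<theta>_def by measurable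
  have Lip: "\<bar>\<theta> x - \<theta> y\<bar> \<le> d * \<bar>ln (norm x) - ln (norm y)\<bar>" if "x \<noteq> 0" "y \<noteq> 0" for x y
  proof -
    have "\<bar>\<theta> x - \<theta> y\<bar> \<le> \<bar>d * ln (norm x / R) - d * ln (norm y / R)\<bar>" by (auto simp: \<theta>_def max_def min_def abs_if)
    also have "\<dots> = d * \<bar>ln (norm x) - ln (norm y)\<bar>"
      using that R d by (simp add: ln_div right_diff_distrib[symmetric] abs_mult)
    finally show ?thesis .
  qed
  have inner: "sin (\<theta> x) = 0" if "norm x < R" for x
  proof -
    \<comment> \<open>At the origin this rests on the default value of \<open>ln 0\<close>.\<close>
    have "ln (norm x / R) \<le> 0" using that R by (cases "x = 0") (auto simp: ln_le_zero_iff)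
    then have "d * ln (norm x / R) \<le> 0" using d by (simp add: mult_le_0_iff)
    then have "\<theta> x = 0" unfolding \<theta>_def by (intro max.absorb1 min.coboundedI2)
    then show ?thesis by simp
  qed
  define R2 where "R2 = R * exp (pi / (2 * d))"
  have R2: "R2 > 0" using R by (simp add: R2_def)
  have outer: "cos (\<theta> x) = 0" if "R2 < norm x" for x
  proof -
    have "exp (pi / (2 * d)) \<le> norm x / R" using that R by (simp add: R2_def pos_le_divide_eq mult.commute)
    moreover from this have "0 < norm x / R" by (rule less_le_trans[OF exp_gt_zero])
    ultimately have "pi / (2 * d) \<le> ln (norm x / R)" by (simp add: ln_ge_iff)
    then have "d * (pi / (2 * d)) \<le> d * ln (norm x / R)" using d by (intro mult_left_mono) auto
    then have "pi / 2 \<le> d * ln (norm x / R)" using d by simp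
    then have "\<theta> x = pi / 2" by (simp add: \<theta>_def)
    then show ?thesis by (simp only: cos_pi_half)
  qed
  \<comment> \<open>Far enough for \<open>hardy_real_near_other_pole\<close> with tolerance
    \<open>et\<close>, and farther out than all old poles, hence different from them.\<close>
  have "\<exists>b. b \<notin> a ` I \<and> R2 * (1 + et powr (- (1 / (2 * s)))) \<le> norm b"
  proof -
    have "bounded (a ` I)" using I by (intro finite_imp_bounded) auto
    then obtain B where B: "\<And>x. x \<in> a ` I \<Longrightarrow> norm x \<le> B" by (auto simp: bounded_iff)
    obtain b :: 'a where b: "norm b = max 0 (max (B + 1) (R2 * (1 + et powr (- (1 / (2 * s))))))"
      using vector_choose_size[of "max 0 (max (B + 1) (R2 * (1 + et powr (- (1 / (2 * s))))))"] by auto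
    then have "norm b > B" "R2 * (1 + et powr (- (1 / (2 * s)))) \<le> norm b" by auto
    with B show ?thesis by force
  qed
  then obtain b where b: "b \<notin> a ` I" and bR: "R2 * (1 + et powr (- (1 / (2 * s)))) \<le> norm b" by blast
  have "(\<Sum>i\<in>insert i0 I. lam i * hardy_real s ((a(i0 := b)) i) u) \<le> Q * energy_real s u" if u: "finite_energy s u" for u
  proof -
    define uc us where "uc = (\<lambda>x. cos (\<theta> x) * u x)" and "us = (\<lambda>x. sin (\<theta> x) * u x)"
    have fc: "finite_energy s uc" and fs: "finite_energy s us"
      and part: "energy_real s uc + energy_real s us \<le> (1 + d\<^sup>2 * D) * energy_real s u"
      using D[OF u, of \<theta> d] Lip by (auto simp: uc_def us_def)
    have bu: "bounded_support u" and bc: "bounded_support uc" and bs: "bounded_support us"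
      using u fc fs by (auto simp: finite_energy_def)
    have h: "hardy_real s p u = hardy_real s p uc + hardy_real s p us" for p
      unfolding uc_def us_def by (rule hardy_real_partition[OF bu _ N]) simp
    have hin: "\<gamma> * hardy_real s p uc \<le> energy_real s uc" "\<gamma> * hardy_real s p us \<le> energy_real s us" for p
      unfolding \<gamma>_def using hardy_inequality_real[OF s N] fc fs by auto
    have c: "hardy_real s b uc \<le> et * hardy_real s 0 uc"
      by (rule hardy_real_near_other_pole[OF bc s(1) N et _ _ R2]) (use outer bR in \<open>auto simp: uc_def\<close>)
    have "(\<Sum>i\<in>I. lam i * hardy_real s (a i) us) \<le> (S + e) * hardy_real s 0 us"
      using far[OF bs] inner by (simp add: us_def abs_le_iff algebra_simps)
    also have "\<dots> \<le> max 0 (S + e) * hardy_real s 0 us" by (intro mult_right_mono) (auto simp: hardy_real_nonneg)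
    finally have t3: "(\<Sum>i\<in>I. lam i * hardy_real s (a i) us) \<le> max 0 (S + e) * hardy_real s 0 us" .
    have "(\<Sum>i\<in>insert i0 I. lam i * hardy_real s ((a(i0 := b)) i) u) = l * hardy_real s b u + (\<Sum>i\<in>I. lam i * hardy_real s (a i) u)"
      using I by (auto simp: l_def intro!: sum.cong)
    also have "\<dots> = ((\<Sum>i\<in>I. lam i * hardy_real s (a i) uc) + l * hardy_real s b uc) + ((\<Sum>i\<in>I. lam i * hardy_real s (a i) us) + l * hardy_real s b us)"
      by (simp add: h distrib_left sum.distrib)
    \<comment> \<open>On the inner piece the old poles are controlled by hypothesis and the new one
      interacts weakly; on the outer piece the old poles count as one pole at the origin.\<close>
    also have "\<dots> \<le> (q1 * energy_real s uc + l * (et * hardy_real s 0 uc)) + (max 0 (S + e) * hardy_real s 0 us + l * hardy_real s b us)"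
      using sub1[OF fc] c t3 l by (intro add_mono mult_left_mono) auto
    also have "\<dots> \<le> q3 * energy_real s uc + q2 * energy_real s us"
    proof (rule add_mono)
      have "l * et / \<gamma> * (\<gamma> * hardy_real s 0 uc) \<le> l * et / \<gamma> * energy_real s uc"
        using l et \<gamma> by (intro mult_left_mono hin) auto
      then show "q1 * energy_real s uc + l * (et * hardy_real s 0 uc) \<le> q3 * energy_real s uc"
        using \<gamma> by (simp add: q3_def algebra_simps)
      \<comment> \<open>The outer piece sees poles at two different points. Each Hardy inequality is
        used with its own share of the energy, and the shares add up to \<open>q2\<close>.\<close>
      have "max 0 (S + e) / \<gamma> * (\<gamma> * hardy_real s 0 us) + l / \<gamma> * (\<gamma> * hardy_real s b us) \<le> max 0 (S + e) / \<gamma> * energy_real s us + l / \<gamma> * energy_real s us"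
        using l \<gamma> by (intro add_mono mult_left_mono hin) auto
      then show "max 0 (S + e) * hardy_real s 0 us + l * hardy_real s b us \<le> q2 * energy_real s us"
        using \<gamma> by (simp add: q2_def add_divide_distrib distrib_right)
    qed
    also have "\<dots> \<le> q * energy_real s uc + q * energy_real s us"
      using q by (intro add_mono mult_right_mono energy_real_nonneg s) auto
    also have "\<dots> = q * (energy_real s uc + energy_real s us)" by (simp add: distrib_left)
    also have "\<dots> \<le> q * ((1 + d\<^sup>2 * D) * energy_real s u)" using part q by (intro mult_left_mono) auto
    finally show ?thesis by (simp add: Q_def mult.assoc)
  qed
  then have "strictly_subcritical s (insert i0 I) lam (a(i0 := b))"
    unfolding strictly_subcritical_def using Q by blast
  with b show ?thesis by blast
qed

text \<open>Removing a nonnegative coefficient cannot increase the sum, so the condition passes to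
  the smaller index set, and the removed pole is put back by
  \<open>strictly_subcritical_insert_pole\<close>. Once only negative coefficients are left,
  \<open>q = 0\<close> works for any distinct positions.\<close>

lemma exists_strictly_subcritical_configuration:
  assumes s: "0 < s" "s < 1" and N: "real DIM('a::euclidean_space) > 2 * s"
    and I: "finite I" and l: "\<And>i. i \<in> I \<Longrightarrow> lam i < gamma_H DIM('a) s" and lS: "(\<Sum>i\<in>I. lam i) < gamma_H DIM('a) s"
  shows "\<exists>a :: nat \<Rightarrow> 'a. inj_on a I \<and> strictly_subcritical s I lam a"
  using I l lS
proof (induction I rule: finite_psubset_induct)
  case (psubset I)
  show ?case
  proof (cases "\<exists>i\<in>I. lam i \<ge> 0")
    case True
    then obtain i0 where i0: "i0 \<in> I" "lam i0 \<ge> 0" by blast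
    define J where "J = I - {i0}"
    have J: "I = insert i0 J" "i0 \<notin> J" "finite J" "J \<subset> I" using i0 psubset.hyps by (auto simp: J_def)
    have "(\<Sum>i\<in>J. lam i) \<le> (\<Sum>i\<in>I. lam i)" using i0 J by simp
    then have "\<exists>a :: nat \<Rightarrow> 'a. inj_on a J \<and> strictly_subcritical s J lam a"
      using psubset J by (intro psubset.IH) auto
    then obtain a :: "nat \<Rightarrow> 'a" where a: "inj_on a J" "strictly_subcritical s J lam a" by blast
    obtain b where b: "b \<notin> a ` J" "strictly_subcritical s (insert i0 J) lam (a(i0 := b))"
      using strictly_subcritical_insert_pole[OF s N J(3,2) a(2)] i0 psubset.prems J by blast
    moreover have "inj_on (a(i0 := b)) (insert i0 J)"
      using a(1) b(1) J(2) by (auto simp: inj_on_def)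
    ultimately show ?thesis unfolding J(1) by blast
  next
    case False
    obtain e :: 'a where e: "norm e = 1" using vector_choose_size[of 1] by auto
    then have "e \<noteq> 0" by auto
    then have "inj_on (\<lambda>i. real i *\<^sub>R e) I" by (auto simp: inj_on_def)
    moreover have "strictly_subcritical s I lam (\<lambda>i. real i *\<^sub>R e)"
      unfolding strictly_subcritical_def
    proof (intro exI[of _ 0] conjI allI impI)
      fix u :: "'a \<Rightarrow> real"
      show "(\<Sum>i\<in>I. lam i * hardy_real s (real i *\<^sub>R e) u) \<le> 0 * energy_real s u"
        using False by (auto intro!: sum_nonpos mult_nonpos_nonneg hardy_real_nonneg simp: not_le less_imp_le)
    qed auto
    ultimately show ?thesis by blast
  qed
qed


section \<open>Passage to the completion\<close>

text \<open>Squared increments are dominated by the modulus of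
  \<open>nn_integral_levy_kernel_finite\<close>: through the Lipschitz bound up to distance 1,
  through boundedness beyond. One of the two points must lie in a ball carrying the support, and
  this ball has finite volume.\<close>

lemma frac_energy_finite_Lipschitz:
  fixes u :: "'a::euclidean_space \<Rightarrow> real"
  assumes s: "0 < s" "s < 1" and u: "bounded_support u" and L: "\<And>x y. \<bar>u x - u y\<bar> \<le> L * norm (x - y)"
  shows "frac_energy s u < \<infinity>"
proof -
  let ?n = "real DIM('a)"
  obtain M R where MR: "\<And>x. \<bar>u x\<bar> \<le> M" "\<And>x. R < norm x \<Longrightarrow> u x = 0"
    using u by (auto simp: bounded_support_def)
  have L0: "L \<ge> 0" using L[of "SOME b. b \<in> Basis" 0] norm_some_Basis by (metis abs_ge_zero diff_zero mult.right_neutral order_trans)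
  have M0: "M \<ge> 0" using MR(1)[of 0] by simp
  define C where "C = max (L\<^sup>2) (4 * M\<^sup>2)"
  have C: "C \<ge> 0" by (simp add: C_def le_max_iff_disj)
  define K where "K z = min (norm z powr 2) (norm z powr s) / norm z powr (?n + 2 * s)" for z :: 'a
  have [measurable]: "K \<in> borel_measurable borel" unfolding K_def by measurable
  define I2 where "I2 = (\<integral>\<^sup>+z. ennreal (K z) \<partial>(lborel :: 'a measure))"
  have I2: "I2 < \<infinity>" unfolding I2_def K_def using s by (rule nn_integral_levy_kernel_finite)
  have [measurable]: "cball (0 :: 'a) R \<in> sets borel" by simp
  define B where "B = emeasure lborel (cball (0 :: 'a) R)"
  have B: "B < \<infinity>" unfolding B_def by (rule emeasure_bounded_finite) simp
  have sq: "(u x - u y)\<^sup>2 \<le> C * min (norm (x - y) powr 2) (norm (x - y) powr s)" for x y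
  proof (cases "norm (x - y) \<le> 1")
    case True
    have "(u x - u y)\<^sup>2 \<le> (L * norm (x - y))\<^sup>2" using L[of x y] L0 by (simp add: abs_le_square_iff[symmetric] abs_mult)
    also have "\<dots> \<le> C * (norm (x - y))\<^sup>2" unfolding power_mult_distrib by (intro mult_right_mono) (auto simp: C_def)
    also have "(norm (x - y))\<^sup>2 = min (norm (x - y) powr 2) (norm (x - y) powr s)"
    proof (cases "x = y")
      case False
      then have "norm (x - y) powr 2 \<le> norm (x - y) powr s" using True s by (intro powr_mono') auto
      then show ?thesis by (simp add: min_def powr_numeral)
    qed simp
    finally show ?thesis .
  next
    case False
    have "\<bar>u x - u y\<bar> \<le> \<bar>2 * M\<bar>" using MR(1)[of x] MR(1)[of y] by linarith
    then have "(u x - u y)\<^sup>2 \<le> (2 * M)\<^sup>2" by (simp only: abs_le_square_iff)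
    also have "\<dots> \<le> C * 1" by (simp add: C_def power_mult_distrib)
    also have "\<dots> \<le> C * min (norm (x - y) powr 2) (norm (x - y) powr s)"
      using False s C by (intro mult_left_mono) (auto simp: ge_one_powr_ge_zero)
    finally show ?thesis .
  qed
  have pw: "ennreal ((u x - u y)\<^sup>2 / norm (x - y) powr (?n + 2 * s)) \<le>
    ennreal C * (indicator (cball 0 R) x * ennreal (K (y - x)) + indicator (cball 0 R) y * ennreal (K (x - y)))" for x y
  proof (cases "R < norm x \<and> R < norm y")
    case False
    have "(u x - u y)\<^sup>2 / norm (x - y) powr (?n + 2 * s) \<le> C * K (x - y)"
      using sq[of x y] by (simp add: K_def divide_right_mono)
    then have "ennreal ((u x - u y)\<^sup>2 / norm (x - y) powr (?n + 2 * s)) \<le> ennreal C * ennreal (K (x - y))"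
      using C by (subst ennreal_mult[symmetric]) (auto simp: K_def intro!: ennreal_leI)
    also have "K (y - x) = K (x - y)" by (simp add: K_def norm_minus_commute)
    then have "ennreal C * ennreal (K (x - y)) \<le> ennreal C * (indicator (cball 0 R) x * ennreal (K (y - x)) + indicator (cball 0 R) y * ennreal (K (x - y)))"
      using False by (intro mult_left_mono) (auto split: split_indicator simp: add_increasing)
    finally show ?thesis .
  qed (simp add: MR(2))
  have i1: "(\<integral>\<^sup>+x. \<integral>\<^sup>+y. indicator (cball 0 R) x * ennreal (K (y - x)) \<partial>lborel \<partial>lborel) = B * I2"
    by (simp add: nn_integral_cmult nn_integral_lborel_translate[where f = "\<lambda>z. ennreal (K z)"] I2_def[symmetric] nn_integral_multc B_def)
  have i1': "(\<integral>\<^sup>+x. indicator (cball 0 R) x * (\<integral>\<^sup>+y. ennreal (K (y - x)) \<partial>lborel) \<partial>lborel) = B * I2"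
    using i1 by (simp add: nn_integral_cmult)
  have i2: "(\<integral>\<^sup>+x. \<integral>\<^sup>+y. indicator (cball 0 R) y * ennreal (K (x - y)) \<partial>lborel \<partial>lborel) = B * I2"
    by (subst lborel_pair.Fubini') (simp_all add: i1)
  have "frac_energy s u \<le> (\<integral>\<^sup>+x. \<integral>\<^sup>+y. ennreal C * (indicator (cball 0 R) x * ennreal (K (y - x)) + indicator (cball 0 R) y * ennreal (K (x - y))) \<partial>lborel \<partial>lborel)"
    unfolding frac_energy_def by (intro nn_integral_mono pw)
  also have "\<dots> = ennreal C * (B * I2 + B * I2)"
    by (simp add: nn_integral_cmult nn_integral_add i1' i2)
  also have "\<dots> < \<infinity>" using B I2 by (simp add: ennreal_mult_less_top)
  finally show ?thesis .
qed

lemma finite_energy_diff: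
  fixes u v :: "'a::euclidean_space \<Rightarrow> real"
  assumes u: "finite_energy s u" and v: "finite_energy s v"
  shows "finite_energy s (\<lambda>x. u x - v x)"
proof -
  have bu: "bounded_support u" and bv: "bounded_support v" using u v by (auto simp: finite_energy_def)
  note [measurable] = bounded_supportD[OF bu] bounded_supportD[OF bv]
  obtain M R where MR: "\<And>x. \<bar>u x\<bar> \<le> M" "\<And>x. R < norm x \<Longrightarrow> u x = 0"
    using bu by (auto simp: bounded_support_def)
  obtain M' R' where MR': "\<And>x. \<bar>v x\<bar> \<le> M'" "\<And>x. R' < norm x \<Longrightarrow> v x = 0"
    using bv by (auto simp: bounded_support_def)
  have "\<bar>u x - v x\<bar> \<le> M + M'" for x using MR(1)[of x] MR'(1)[of x] by linarith
  moreover have "u x - v x = 0" if "max R R' < norm x" for x using MR(2) MR'(2) that by simp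
  ultimately have b: "bounded_support (\<lambda>x. u x - v x)" 
    unfolding bounded_support_def by (intro conjI exI[of _ "M + M'"] exI[of _ "max R R'"]) auto
  have e2: "ennreal (2 * p + 2 * q) = 2 * ennreal p + 2 * ennreal q" if "p \<ge> 0" "q \<ge> 0" for p q
    using that by (simp add: ennreal_mult)
  have "frac_energy s (\<lambda>x. u x - v x) \<le> (\<integral>\<^sup>+x. \<integral>\<^sup>+y. 2 * ennreal ((u x - u y)\<^sup>2 / norm (x - y) powr (real DIM('a) + 2 * s))
      + 2 * ennreal ((v x - v y)\<^sup>2 / norm (x - y) powr (real DIM('a) + 2 * s)) \<partial>lborel \<partial>lborel)"
    unfolding frac_energy_def
  proof (intro nn_integral_mono)
    fix x y :: 'a
    let ?k = "norm (x - y) powr (real DIM('a) + 2 * s)"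
    have "0 \<le> ((u x - u y) + (v x - v y))\<^sup>2" by simp
    then have "((u x - v x) - (u y - v y))\<^sup>2 \<le> 2 * (u x - u y)\<^sup>2 + 2 * (v x - v y)\<^sup>2" by (simp add: power2_eq_square algebra_simps)
    then have "((u x - v x) - (u y - v y))\<^sup>2 / ?k \<le> (2 * (u x - u y)\<^sup>2 + 2 * (v x - v y)\<^sup>2) / ?k" by (intro divide_right_mono) auto
    also have "\<dots> = 2 * ((u x - u y)\<^sup>2 / ?k) + 2 * ((v x - v y)\<^sup>2 / ?k)" by (simp add: add_divide_distrib)
    finally have "ennreal (((u x - v x) - (u y - v y))\<^sup>2 / ?k) \<le> ennreal (2 * ((u x - u y)\<^sup>2 / ?k) + 2 * ((v x - v y)\<^sup>2 / ?k))"
      by (rule ennreal_leI)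
    also have "ennreal (2 * ((u x - u y)\<^sup>2 / ?k) + 2 * ((v x - v y)\<^sup>2 / ?k)) = 2 * ennreal ((u x - u y)\<^sup>2 / ?k) + 2 * ennreal ((v x - v y)\<^sup>2 / ?k)"
      by (rule e2) auto
    finally show "ennreal (((u x - v x) - (u y - v y))\<^sup>2 / ?k) \<le> 2 * ennreal ((u x - u y)\<^sup>2 / ?k) + 2 * ennreal ((v x - v y)\<^sup>2 / ?k)" .
  qed
  also have "\<dots> = 2 * frac_energy s u + 2 * frac_energy s v"
    unfolding frac_energy_def by (simp add: nn_integral_add nn_integral_cmult)
  also have "\<dots> < \<infinity>" using u v by (simp add: finite_energy_def ennreal_mult_less_top)
  finally show ?thesis using b by (simp add: finite_energy_def)
qed

text \<open>A continuous derivative that vanishes off a compact set is bounded, so \<open>f\<close>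
  is Lipschitz.\<close>

lemma test_function_finite_energy:
  fixes f :: "'a::euclidean_space \<Rightarrow> real"
  assumes s: "0 < s" "s < 1" and f: "f \<in> C_c_infinity"
  shows "finite_energy s f"
proof -
  define K where "K = closure {x. f x \<noteq> 0}"
  have K: "compact K" using f by (simp add: C_c_infinity_def K_def)
  have zero: "f x = 0" if "x \<notin> K" for x using that closure_subset[of "{x. f x \<noteq> 0}"] by (auto simp: K_def)
  have C1: "C_k 1 f" "C_k 0 f" using f by (auto simp: C_c_infinity_def)
  have dif: "f differentiable (at x)" for x
    using C1(1) by (auto simp: differentiable_on_def)
  have cont: "continuous_on UNIV f" using C1(2) by simp
  have contd: "continuous_on UNIV (\<lambda>x. frechet_derivative f (at x) v)" for v using C1(1) by simp
  have der: "(f has_derivative frechet_derivative f (at x)) (at x)" for x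
    using dif frechet_derivative_works by blast
  have bnd: "\<exists>M. \<forall>x. \<bar>g x\<bar> \<le> M" if g: "continuous_on UNIV g" and gz: "\<And>x. x \<notin> K \<Longrightarrow> g x = 0" for g :: "'a \<Rightarrow> real"
  proof -
    have "bounded (g ` K)"
      by (intro compact_imp_bounded compact_continuous_image K continuous_on_subset[OF g]) auto
    then obtain B where B: "\<And>x. x \<in> K \<Longrightarrow> \<bar>g x\<bar> \<le> B" by (auto simp: bounded_iff)
    have "\<bar>g x\<bar> \<le> max B 0" for x using B[of x] gz[of x] by (cases "x \<in> K") auto
    then show ?thesis by blast
  qed
  obtain M where M: "\<And>x. \<bar>f x\<bar> \<le> M" using bnd[OF cont zero] by blast
  obtain R where R: "\<And>x. x \<in> K \<Longrightarrow> norm x \<le> R" using compact_imp_bounded[OF K] by (auto simp: bounded_iff)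
  have dzero: "frechet_derivative f (at x) v = 0" if x: "x \<notin> K" for x v
  proof -
    have "open (- K)" using K by (simp add: compact_imp_closed open_Compl)
    then have "((\<lambda>_. 0 :: real) has_derivative frechet_derivative f (at x)) (at x)"
      by (rule has_derivative_transform_within_open[OF der]) (use x zero in auto)
    then have "frechet_derivative f (at x) = (\<lambda>_. 0)" by (rule has_derivative_unique) (rule has_derivative_const)
    then show ?thesis by simp
  qed
  have "\<forall>b. \<exists>M. \<forall>x. \<bar>frechet_derivative f (at x) b\<bar> \<le> M" using bnd[OF contd dzero] by blast
  then obtain B where B: "\<And>b x. \<bar>frechet_derivative f (at x) b\<bar> \<le> B b" by metis
  \<comment> \<open>Each directional derivative is bounded separately; summing the bounds over the
    basis controls the operator norm.\<close>
  define L where "L = (\<Sum>b\<in>(Basis :: 'a set). B b)"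
  have on: "onorm (frechet_derivative f (at x)) \<le> L" for x
  proof (rule onorm_le)
    fix v :: 'a
    interpret D: bounded_linear "frechet_derivative f (at x)" using der[of x] by (rule has_derivative_bounded_linear)
    have "frechet_derivative f (at x) v = (\<Sum>b\<in>Basis. (v \<bullet> b) * frechet_derivative f (at x) b)"
      by (subst euclidean_representation[of v, symmetric]) (simp only: D.sum D.scaleR real_scaleR_def)
    then have "norm (frechet_derivative f (at x) v) \<le> (\<Sum>b\<in>Basis. \<bar>(v \<bullet> b) * frechet_derivative f (at x) b\<bar>)" by (simp add: sum_abs)
    also have "\<dots> \<le> (\<Sum>b\<in>(Basis :: 'a set). norm v * B b)"
      unfolding abs_mult by (intro sum_mono mult_mono Basis_le_norm B) auto
    finally show "norm (frechet_derivative f (at x) v) \<le> L * norm v" by (simp add: L_def sum_distrib_left mult.commute)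
  qed
  have Lip: "\<bar>f x - f y\<bar> \<le> L * norm (x - y)" for x y
    using differentiable_bound[of UNIV f "\<lambda>x. frechet_derivative f (at x)" L x y] der on by (auto simp: convex_UNIV)
  have bs: "bounded_support f"
    unfolding bounded_support_def using borel_measurable_continuous_onI[OF cont] M zero R by (meson not_le)
  show ?thesis unfolding finite_energy_def using bs frac_energy_finite_Lipschitz[OF s bs Lip] by simp
qed

text \<open>By Fatou's lemma the pointwise limit of a Cauchy sequence is its limit in square mean,
  and then the square integrals converge. It will be applied to quotients: by a power of the
  distance to a pole, and by a power of \<open>norm (x - y)\<close> on the product space.\<close>

lemma square_integral_tendsto:
  fixes f :: "nat \<Rightarrow> 'b \<Rightarrow> real" and F :: "'b \<Rightarrow> real"
  assumes [measurable]: "\<And>n. f n \<in> borel_measurable M" "F \<in> borel_measurable M"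
    and int: "\<And>n. (\<integral>\<^sup>+x. ennreal ((f n x)\<^sup>2) \<partial>M) < \<infinity>"
    and lim: "AE x in M. (\<lambda>n. f n x) \<longlonglongrightarrow> F x"
    and cauchy: "\<And>e. e > 0 \<Longrightarrow> \<exists>N. \<forall>m\<ge>N. \<forall>n\<ge>N. (\<integral>\<^sup>+x. ennreal ((f m x - f n x)\<^sup>2) \<partial>M) \<le> ennreal e"
  shows "(\<integral>\<^sup>+x. ennreal ((F x)\<^sup>2) \<partial>M) < \<infinity>"
    and "(\<lambda>n. enn2real (\<integral>\<^sup>+x. ennreal ((f n x)\<^sup>2) \<partial>M)) \<longlonglongrightarrow> enn2real (\<integral>\<^sup>+x. ennreal ((F x)\<^sup>2) \<partial>M)"
proof -
  have fatou: "\<exists>N. \<forall>n\<ge>N. (\<integral>\<^sup>+x. ennreal ((f n x - F x)\<^sup>2) \<partial>M) \<le> ennreal e" if e: "e > 0" for e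
  proof -
    obtain N where N: "\<And>m n. m \<ge> N \<Longrightarrow> n \<ge> N \<Longrightarrow> (\<integral>\<^sup>+x. ennreal ((f m x - f n x)\<^sup>2) \<partial>M) \<le> ennreal e"
      using cauchy[OF e] by blast
    have "(\<integral>\<^sup>+x. ennreal ((f n x - F x)\<^sup>2) \<partial>M) \<le> ennreal e" if n: "n \<ge> N" for n
    proof -
      have "(\<integral>\<^sup>+x. ennreal ((f n x - F x)\<^sup>2) \<partial>M) = (\<integral>\<^sup>+x. liminf (\<lambda>m. ennreal ((f n x - f m x)\<^sup>2)) \<partial>M)"
      proof (rule nn_integral_cong_AE, rule AE_mp[OF lim], rule AE_I2, rule impI)
        fix x assume "(\<lambda>n. f n x) \<longlonglongrightarrow> F x"
        then have "(\<lambda>m. ennreal ((f n x - f m x)\<^sup>2)) \<longlonglongrightarrow> ennreal ((f n x - F x)\<^sup>2)"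
          by (intro tendsto_ennrealI tendsto_intros)
        then show "ennreal ((f n x - F x)\<^sup>2) = liminf (\<lambda>m. ennreal ((f n x - f m x)\<^sup>2))"
          by (intro lim_imp_Liminf[symmetric]) auto
      qed
      also have "\<dots> \<le> liminf (\<lambda>m. \<integral>\<^sup>+x. ennreal ((f n x - f m x)\<^sup>2) \<partial>M)"
        by (rule nn_integral_liminf) measurable
      also have "\<dots> \<le> liminf (\<lambda>m. ennreal e)"
        using N[OF n] by (intro Liminf_mono) (auto simp: eventually_sequentially)
      finally show ?thesis by (simp add: Liminf_const)
    qed
    then show ?thesis by blast
  qed
  define A where "A n = enn2real (\<integral>\<^sup>+x. ennreal ((f n x)\<^sup>2) \<partial>M)" for n
  define B where "B = enn2real (\<integral>\<^sup>+x. ennreal ((F x)\<^sup>2) \<partial>M)"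
  have A: "(\<integral>\<^sup>+x. ennreal ((f n x)\<^sup>2) \<partial>M) = ennreal (A n)" for n
    unfolding A_def using int[of n] by (intro ennreal_enn2real[symmetric]) simp
  \<comment> \<open>A triangle inequality for squares: the mixed term is split with weight
    \<open>d\<close>, which can be made small while the factor \<open>1 + 1 / d\<close> meets a
    difference that tends to 0.\<close>
  have split: "(\<integral>\<^sup>+x. ennreal ((g x)\<^sup>2) \<partial>M) \<le> ennreal (1 + d) * (\<integral>\<^sup>+x. ennreal ((h x)\<^sup>2) \<partial>M) + ennreal (1 + 1 / d) * (\<integral>\<^sup>+x. ennreal ((g x - h x)\<^sup>2) \<partial>M)"
    if d: "d > 0" and [measurable]: "g \<in> borel_measurable M" "h \<in> borel_measurable M" for d and g h :: "'b \<Rightarrow> real"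
  proof -
    have "(\<integral>\<^sup>+x. ennreal ((g x)\<^sup>2) \<partial>M) \<le> (\<integral>\<^sup>+x. ennreal (1 + d) * ennreal ((h x)\<^sup>2) + ennreal (1 + 1 / d) * ennreal ((g x - h x)\<^sup>2) \<partial>M)"
    proof (intro nn_integral_mono)
      fix x
      have "0 \<le> (sqrt d * h x - (g x - h x) / sqrt d)\<^sup>2" by simp
      also have "\<dots> = d * (h x)\<^sup>2 + (g x - h x)\<^sup>2 / d - 2 * h x * (g x - h x)"
        using d by (simp add: power2_diff power_mult_distrib power_divide)
      finally have "2 * h x * (g x - h x) \<le> d * (h x)\<^sup>2 + (g x - h x)\<^sup>2 / d" by simp
      moreover have "(g x)\<^sup>2 = (h x)\<^sup>2 + 2 * h x * (g x - h x) + (g x - h x)\<^sup>2"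
        by (simp add: power2_eq_square algebra_simps)
      moreover have "(1 + 1 / d) * (g x - h x)\<^sup>2 = (g x - h x)\<^sup>2 + (g x - h x)\<^sup>2 / d" "(1 + d) * (h x)\<^sup>2 = (h x)\<^sup>2 + d * (h x)\<^sup>2"
        by (simp_all add: distrib_right)
      ultimately have "(g x)\<^sup>2 \<le> (1 + d) * (h x)\<^sup>2 + (1 + 1 / d) * (g x - h x)\<^sup>2"
        by linarith
      then have "ennreal ((g x)\<^sup>2) \<le> ennreal ((1 + d) * (h x)\<^sup>2 + (1 + 1 / d) * (g x - h x)\<^sup>2)" by (rule ennreal_leI)
      also have "\<dots> = ennreal (1 + d) * ennreal ((h x)\<^sup>2) + ennreal (1 + 1 / d) * ennreal ((g x - h x)\<^sup>2)"
        using d by (subst ennreal_plus) (auto simp: ennreal_mult simp del: ennreal_plus)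
      finally show "ennreal ((g x)\<^sup>2) \<le> ennreal (1 + d) * ennreal ((h x)\<^sup>2) + ennreal (1 + 1 / d) * ennreal ((g x - h x)\<^sup>2)" .
    qed
    also have "\<dots> = ennreal (1 + d) * (\<integral>\<^sup>+x. ennreal ((h x)\<^sup>2) \<partial>M) + ennreal (1 + 1 / d) * (\<integral>\<^sup>+x. ennreal ((g x - h x)\<^sup>2) \<partial>M)"
      by (simp add: nn_integral_add nn_integral_cmult)
    finally show ?thesis .
  qed
  obtain N1 where N1: "\<And>n. n \<ge> N1 \<Longrightarrow> (\<integral>\<^sup>+x. ennreal ((f n x - F x)\<^sup>2) \<partial>M) \<le> ennreal 1"
    using fatou[of 1] by auto
  have sym: "(\<integral>\<^sup>+x. ennreal ((F x - f n x)\<^sup>2) \<partial>M) = (\<integral>\<^sup>+x. ennreal ((f n x - F x)\<^sup>2) \<partial>M)" for n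
    by (simp add: power2_commute)
  have "(\<integral>\<^sup>+x. ennreal ((F x)\<^sup>2) \<partial>M) \<le> ennreal (1 + 1) * ennreal (A N1) + ennreal (1 + 1 / 1) * ennreal 1"
    by (rule order_trans[OF split[of 1 F "f N1"]]) (auto simp: sym A simp del: ennreal_plus ennreal_1 intro!: add_left_mono mult_left_mono N1)
  also have "\<dots> < \<infinity>" by (simp add: ennreal_mult_less_top)
  finally show fin: "(\<integral>\<^sup>+x. ennreal ((F x)\<^sup>2) \<partial>M) < \<infinity>" .
  then have B: "(\<integral>\<^sup>+x. ennreal ((F x)\<^sup>2) \<partial>M) = ennreal B"
    unfolding B_def by (intro ennreal_enn2real[symmetric]) simp
  have AB0: "A n \<ge> 0" "B \<ge> 0" for n by (simp_all add: A_def B_def)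
  have conv: "\<exists>N. \<forall>n\<ge>N. A n \<le> (1 + d) * B + d \<and> B \<le> (1 + d) * A n + d" if d: "d > 0" for d
  proof -
    \<comment> \<open>Chosen so that the error term \<open>(1 + 1 / d) * e\<close> equals
      \<open>d\<close>.\<close>
    define e where "e = d / (1 + 1 / d)"
    have "1 + 1 / d > 0" using d by (simp add: add_pos_pos)
    then have e: "e > 0" "(1 + 1 / d) * e = d" using d unfolding e_def by auto
    obtain N where N: "\<And>n. n \<ge> N \<Longrightarrow> (\<integral>\<^sup>+x. ennreal ((f n x - F x)\<^sup>2) \<partial>M) \<le> ennreal e"
      using fatou[OF e(1)] by blast
    have "A n \<le> (1 + d) * B + d \<and> B \<le> (1 + d) * A n + d" if n: "n \<ge> N" for n
    proof -
      have le: "ennreal (1 + 1 / d) * (\<integral>\<^sup>+x. ennreal ((f n x - F x)\<^sup>2) \<partial>M) \<le> ennreal d"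
      proof -
        have "ennreal (1 + 1 / d) * (\<integral>\<^sup>+x. ennreal ((f n x - F x)\<^sup>2) \<partial>M) \<le> ennreal (1 + 1 / d) * ennreal e"
          by (intro mult_left_mono N n) simp
        also have "\<dots> = ennreal d" using e d by (simp add: ennreal_mult[symmetric] del: ennreal_plus)
        finally show ?thesis .
      qed
      have "ennreal (A n) \<le> ennreal (1 + d) * ennreal B + ennreal d"
        using split[OF d, of "f n" F] le unfolding A B by (auto intro: order_trans[OF _ add_left_mono])
      then have 1: "A n \<le> (1 + d) * B + d"
        using d AB0 by (simp add: ennreal_mult[symmetric] ennreal_plus[symmetric] del: ennreal_plus)
      have "ennreal B \<le> ennreal (1 + d) * ennreal (A n) + ennreal d"
        using split[OF d, of F "f n"] le unfolding sym A B by (auto intro: order_trans[OF _ add_left_mono])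
      then have 2: "B \<le> (1 + d) * A n + d"
        using d AB0 by (simp add: ennreal_mult[symmetric] ennreal_plus[symmetric] del: ennreal_plus)
      from 1 2 show ?thesis by blast
    qed
    then show ?thesis by blast
  qed
  have "A \<longlonglongrightarrow> B"
  proof (rule LIMSEQ_I)
    fix r :: real assume r: "r > 0"
    \<comment> \<open>The cap at 1 bounds \<open>A n\<close> by \<open>2 * B + 1\<close>; both
      differences are then at most \<open>d * (2 * B + 3)\<close>, which is below
      \<open>r\<close>.\<close>
    define d where "d = min 1 (r / (4 * (B + 2)))"
    have d: "0 < d" "d \<le> 1" using r AB0 by (auto simp: d_def)
    have "d \<le> r / (4 * (B + 2))" by (simp add: d_def)
    then have "d * (4 * (B + 2)) \<le> r" using AB0 by (subst (asm) pos_le_divide_eq) auto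
    moreover have "d * (2 * B + 3) < d * (4 * (B + 2))" using d AB0 by (intro mult_strict_left_mono) auto
    ultimately have dB: "d * (2 * B + 3) < r" by linarith
    obtain N where N: "\<And>n. n \<ge> N \<Longrightarrow> A n \<le> (1 + d) * B + d \<and> B \<le> (1 + d) * A n + d"
      using conv[OF d(1)] by blast
    have "norm (A n - B) < r" if "n \<ge> N" for n
    proof -
      have n: "A n \<le> (1 + d) * B + d" "B \<le> (1 + d) * A n + d" using N[OF that] by auto
      have "A n \<le> 2 * B + 1" using n(1) d AB0 mult_right_mono[OF d(2), of B] by (simp add: algebra_simps)
      then have "d * A n \<le> d * (2 * B + 1)" using d by (intro mult_left_mono) auto
      then have "B - A n \<le> d * (2 * B + 2)" using n(2) by (simp add: algebra_simps)
      moreover have "A n - B \<le> d * (B + 1)" using n(1) by (simp add: algebra_simps)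
      moreover have "d * (2 * B + 2) \<le> d * (2 * B + 3)" "d * (B + 1) \<le> d * (2 * B + 3)"
        using d AB0 by (auto intro!: mult_left_mono)
      ultimately show ?thesis using dB by (simp add: abs_less_iff)
    qed
    then show "\<exists>no. \<forall>n\<ge>no. norm (A n - B) < r" by blast
  qed
  then show "(\<lambda>n. enn2real (\<integral>\<^sup>+x. ennreal ((f n x)\<^sup>2) \<partial>M)) \<longlonglongrightarrow> enn2real (\<integral>\<^sup>+x. ennreal ((F x)\<^sup>2) \<partial>M)"
    unfolding A_def B_def .
qed


section \<open>Norm and quadratic form on the completion\<close>

lemma Ds2_norm_square:
  fixes u :: "real ^ 'n::finite \<Rightarrow> real"
  assumes s: "0 < s" "s < 1" and [measurable]: "u \<in> borel_measurable borel"
  shows "(Ds2_norm s u)\<^sup>2 = energy_real s u"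
proof -
  let ?f = "\<lambda>(x, y). \<bar>u x - u y\<bar>\<^sup>2 / norm (x - y) powr (real CARD('n) + 2 * s)"
  \<comment> \<open>For a divergent integral both sides are 0, by the conventions for the Bochner
    integral and for \<open>enn2real\<close>.\<close>
  have "(LINT z|(lborel \<Otimes>\<^sub>M lborel). ?f z) = enn2real (\<integral>\<^sup>+z. ennreal (?f z) \<partial>(lborel \<Otimes>\<^sub>M lborel))"
    by (rule integral_eq_nn_integral) auto
  also have "(\<integral>\<^sup>+z. ennreal (?f z) \<partial>(lborel \<Otimes>\<^sub>M lborel)) = frac_energy s u"
    unfolding frac_energy_def by (subst lborel.nn_integral_fst[symmetric]) (auto simp: split_beta')
  finally show ?thesis
    unfolding Ds2_norm_def energy_real_def using C_Ns_pos[OF s]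
    by (simp add: real_sqrt_pow2 less_imp_le)
qed

lemma Ds2_norm_nonneg: "0 < s \<Longrightarrow> s < 1 \<Longrightarrow> Ds2_norm s u \<ge> 0"
  unfolding Ds2_norm_def using C_Ns_pos[of s]
  by (auto intro!: mult_nonneg_nonneg integral_nonneg_AE simp: less_imp_le split_beta')

lemma Q_form_eq:
  fixes u :: "real ^ 'n::finite \<Rightarrow> real"
  assumes s: "0 < s" "s < 1" and [measurable]: "u \<in> borel_measurable borel"
  shows "Q_form s k lam a u = energy_real s u - (\<Sum>i=1..k. lam i * hardy_real s (a i) u)"
proof -
  have "(LINT x|lborel. \<bar>u x\<bar>\<^sup>2 / norm (x - p) powr (2 * s)) = hardy_real s p u" for p
    unfolding hardy_real_def hardy_integral_def by (subst integral_eq_nn_integral) auto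
  then show ?thesis unfolding Q_form_def using Ds2_norm_square[OF s assms(3)] by simp
qed

lemma test_function_in_Ds2:
  fixes f :: "real ^ 'n::finite \<Rightarrow> real"
  assumes "0 < s" "s < 1" "f \<in> C_c_infinity"
  shows "f \<in> Ds2 s"
proof -
  have "C_k 0 f" using assms(3) unfolding C_c_infinity_def by blast
  then have "f \<in> borel_measurable borel" by (simp add: borel_measurable_continuous_onI)
  moreover have "Ds2_norm s (\<lambda>x :: real ^ 'n. 0) = 0"
    by (simp add: Ds2_norm_def split_beta')
  ultimately show ?thesis
    unfolding Ds2_def using assms(3) by (auto intro!: exI[of _ "\<lambda>_. f"])
qed

text \<open>Dividing \<open>u\<close> by \<open>norm (x - p) powr s\<close>, and its increments by
  \<open>norm (x - y) powr (N / 2 + s)\<close>, turns the Hardy integral and the energy into plain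
  square integrals. The approximating sequence is Cauchy for the second by definition, and for the
  first by the Hardy inequality applied to differences.\<close>

lemma Ds2_approximation:
  fixes u :: "real ^ 'n::finite \<Rightarrow> real"
  assumes s: "0 < s" "s < 1" and N: "real CARD('n) > 2 * s" and u: "u \<in> Ds2 s"
  obtains \<phi> where "\<And>n. finite_energy s (\<phi> n)" "(\<lambda>n. energy_real s (\<phi> n)) \<longlonglongrightarrow> energy_real s u"
    "\<And>p. (\<lambda>n. hardy_real s p (\<phi> n)) \<longlonglongrightarrow> hardy_real s p u" "\<And>p. hardy_integral s p u < \<infinity>"
proof -
  have N': "real DIM(real ^ 'n) > 2 * s" using N by simp
  have um [measurable]: "u \<in> borel_measurable borel" using u by (simp add: Ds2_def)
  obtain \<phi> where \<phi>: "\<And>n. \<phi> n \<in> C_c_infinity"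
    and cau: "\<And>e. e > 0 \<Longrightarrow> \<exists>M. \<forall>m\<ge>M. \<forall>n\<ge>M. Ds2_norm s (\<lambda>x. \<phi> m x - \<phi> n x) < e"
    and ae: "AE x in lborel. (\<lambda>n. \<phi> n x) \<longlonglongrightarrow> u x"
    using u by (auto simp: Ds2_def)
  have fe: "finite_energy s (\<phi> n)" for n by (rule test_function_finite_energy[OF s \<phi>])
  then have bs: "bounded_support (\<phi> n)" for n by (simp add: finite_energy_def)
  have pm [measurable]: "\<phi> n \<in> borel_measurable borel" for n by (rule bounded_supportD[OF bs])
  have fd: "finite_energy s (\<lambda>x. \<phi> m x - \<phi> n x)" for m n by (rule finite_energy_diff[OF fe fe])
  define G where "G = C_Ns DIM(real ^ 'n) s / 2"
  define \<gamma> where "\<gamma> = gamma_H DIM(real ^ 'n) s"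
  have G: "G > 0" and \<gamma>: "\<gamma> > 0" using C_Ns_pos[OF s] gamma_H_pos[OF s(1) N'] by (auto simp: G_def \<gamma>_def)
  have cauE: "\<exists>M. \<forall>m\<ge>M. \<forall>n\<ge>M. energy_real s (\<lambda>x. \<phi> m x - \<phi> n x) \<le> e" if e: "e > 0" for e
  proof -
    obtain M where M: "\<And>m n. m \<ge> M \<Longrightarrow> n \<ge> M \<Longrightarrow> Ds2_norm s (\<lambda>x. \<phi> m x - \<phi> n x) < sqrt e"
      using cau[of "sqrt e"] e by auto
    have "energy_real s (\<lambda>x. \<phi> m x - \<phi> n x) \<le> e" if "m \<ge> M" "n \<ge> M" for m n
    proof -
      have "(Ds2_norm s (\<lambda>x. \<phi> m x - \<phi> n x))\<^sup>2 \<le> (sqrt e)\<^sup>2"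
        using M[OF that] Ds2_norm_nonneg[OF s] by (intro power_mono) (auto simp: less_imp_le)
      then show ?thesis using e by (simp add: Ds2_norm_square[OF s])
    qed
    then show ?thesis by blast
  qed
  have hardy: "hardy_integral s p u < \<infinity> \<and> (\<lambda>n. hardy_real s p (\<phi> n)) \<longlonglongrightarrow> hardy_real s p u" for p
  proof -
    define h where "h v x = v x / norm (x - p) powr s" for v :: "real ^ 'n \<Rightarrow> real" and x
    have hsq: "(h v x)\<^sup>2 = (v x)\<^sup>2 / norm (x - p) powr (2 * s)" for v x
      by (simp add: h_def power_divide power2_eq_square powr_add[symmetric])
    have [measurable]: "h u \<in> borel_measurable lborel" "\<And>n. h (\<phi> n) \<in> borel_measurable lborel"
      unfolding h_def by measurable
    have hd: "h (\<phi> m) x - h (\<phi> n) x = h (\<lambda>x. \<phi> m x - \<phi> n x) x" for m n x by (simp add: h_def diff_divide_distrib)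
    have 1: "(\<integral>\<^sup>+x. ennreal ((h (\<phi> n) x)\<^sup>2) \<partial>lborel) < \<infinity>" for n
      unfolding hsq hardy_integral_def[symmetric] by (rule hardy_integral_finite[OF bs N'])
    have 2: "AE x in lborel. (\<lambda>n. h (\<phi> n) x) \<longlonglongrightarrow> h u x"
    proof (rule AE_mp[OF ae], rule AE_mp[OF AE_lborel_singleton[of p]], rule AE_I2, intro impI)
      fix x assume "x \<noteq> p" "(\<lambda>n. \<phi> n x) \<longlonglongrightarrow> u x"
      then show "(\<lambda>n. h (\<phi> n) x) \<longlonglongrightarrow> h u x" unfolding h_def by (intro tendsto_intros) auto
    qed
    have 3: "\<exists>N. \<forall>m\<ge>N. \<forall>n\<ge>N. (\<integral>\<^sup>+x. ennreal ((h (\<phi> m) x - h (\<phi> n) x)\<^sup>2) \<partial>lborel) \<le> ennreal e" if e: "e > 0" for e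
    proof -
      obtain M where M: "\<And>m n. m \<ge> M \<Longrightarrow> n \<ge> M \<Longrightarrow> energy_real s (\<lambda>x. \<phi> m x - \<phi> n x) \<le> \<gamma> * e"
        using cauE[of "\<gamma> * e"] e \<gamma> by auto
      have "(\<integral>\<^sup>+x. ennreal ((h (\<phi> m) x - h (\<phi> n) x)\<^sup>2) \<partial>lborel) \<le> ennreal e" if mn: "m \<ge> M" "n \<ge> M" for m n
      proof -
        have b: "bounded_support (\<lambda>x. \<phi> m x - \<phi> n x)" using fd by (simp add: finite_energy_def)
        have "\<gamma> * hardy_real s p (\<lambda>x. \<phi> m x - \<phi> n x) \<le> \<gamma> * e"
          using hardy_inequality_real[OF s N' fd, of p m n] M[OF mn] by (simp add: \<gamma>_def)
        then have "hardy_real s p (\<lambda>x. \<phi> m x - \<phi> n x) \<le> e" using \<gamma> by simp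
        then have "ennreal (hardy_real s p (\<lambda>x. \<phi> m x - \<phi> n x)) \<le> ennreal e" by (rule ennreal_leI)
        then show ?thesis unfolding hd hsq ennreal_hardy_real[OF b N'] hardy_integral_def .
      qed
      then show ?thesis by blast
    qed
    show ?thesis
      using square_integral_tendsto[of "\<lambda>n. h (\<phi> n)" lborel "h u", OF _ _ 1 2 3]
      unfolding hsq hardy_real_def hardy_integral_def by simp
  qed
  have energy: "(\<lambda>n. energy_real s (\<phi> n)) \<longlonglongrightarrow> energy_real s u"
  proof -
    define p where "p = real DIM(real ^ 'n) + 2 * s"
    define h where "h v z = (v (fst z) - v (snd z)) / norm (fst z - snd z) powr (p / 2)" for v :: "real ^ 'n \<Rightarrow> real" and z
    let ?M = "lborel \<Otimes>\<^sub>M lborel :: ((real ^ 'n) \<times> (real ^ 'n)) measure"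
    have hsq: "(h v z)\<^sup>2 = (v (fst z) - v (snd z))\<^sup>2 / norm (fst z - snd z) powr p" for v z
      by (simp add: h_def power_divide power2_eq_square powr_add[symmetric])
    have hm [measurable]: "h v \<in> borel_measurable ?M" if [measurable]: "v \<in> borel_measurable borel" for v
      unfolding h_def by measurable
    have hi: "(\<integral>\<^sup>+z. ennreal ((h v z)\<^sup>2) \<partial>?M) = frac_energy s v" if [measurable]: "v \<in> borel_measurable borel" for v
      unfolding frac_energy_def hsq p_def by (subst lborel.nn_integral_fst[symmetric]) auto
    have hd: "h (\<phi> m) z - h (\<phi> n) z = h (\<lambda>x. \<phi> m x - \<phi> n x) z" for m n z by (simp add: h_def diff_divide_distrib[symmetric])
    have 1: "(\<integral>\<^sup>+z. ennreal ((h (\<phi> n) z)\<^sup>2) \<partial>?M) < \<infinity>" for n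
      using fe[of n] by (simp add: hi finite_energy_def)
    have 2: "AE z in ?M. (\<lambda>n. h (\<phi> n) z) \<longlonglongrightarrow> h u z"
    proof -
      \<comment> \<open>Convergence fails at most on a null set \<open>B\<close>; on the product it
        can fail only where one coordinate lies in \<open>B\<close>, which is again a null
        set.\<close>
      obtain B where B: "B \<in> null_sets lborel" "{x \<in> space lborel. \<not> (\<lambda>n. \<phi> n x) \<longlonglongrightarrow> u x} \<subseteq> B"
        using ae by (auto simp: eventually_ae_filter)
      have [measurable]: "B \<in> sets lborel" using B by auto
      have "B \<times> UNIV \<in> null_sets ?M" "UNIV \<times> B \<in> null_sets ?M"
        using B(1) by (auto simp: null_sets_def lborel.emeasure_pair_measure_Times)
      then have nB: "AE z in ?M. z \<notin> B \<times> UNIV" "AE z in ?M. z \<notin> UNIV \<times> B"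
        by (auto intro: AE_not_in)
      have conv: "(\<lambda>n. \<phi> n x) \<longlonglongrightarrow> u x" if "x \<notin> B" for x using B(2) that by auto
      show ?thesis
      proof (rule AE_mp[OF nB(1)], rule AE_mp[OF nB(2)], rule AE_I2, intro impI)
        fix z assume "z \<notin> UNIV \<times> B" "z \<notin> B \<times> UNIV"
        then have c: "(\<lambda>n. \<phi> n (fst z)) \<longlonglongrightarrow> u (fst z)" "(\<lambda>n. \<phi> n (snd z)) \<longlonglongrightarrow> u (snd z)"
          by (auto intro!: conv simp: mem_Times_iff)
        show "(\<lambda>n. h (\<phi> n) z) \<longlonglongrightarrow> h u z"
        proof (cases "fst z = snd z")
          case False
          then show ?thesis unfolding h_def by (intro tendsto_intros c) auto
        qed (simp add: h_def)
      qed
    qed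
    have 3: "\<exists>N. \<forall>m\<ge>N. \<forall>n\<ge>N. (\<integral>\<^sup>+z. ennreal ((h (\<phi> m) z - h (\<phi> n) z)\<^sup>2) \<partial>?M) \<le> ennreal e" if e: "e > 0" for e
    proof -
      obtain M where M: "\<And>m n. m \<ge> M \<Longrightarrow> n \<ge> M \<Longrightarrow> energy_real s (\<lambda>x. \<phi> m x - \<phi> n x) \<le> G * e"
        using cauE[of "G * e"] e G by auto
      have "(\<integral>\<^sup>+z. ennreal ((h (\<phi> m) z - h (\<phi> n) z)\<^sup>2) \<partial>?M) \<le> ennreal e" if mn: "m \<ge> M" "n \<ge> M" for m n
      proof -
        have fin: "frac_energy s (\<lambda>x. \<phi> m x - \<phi> n x) < \<infinity>" using fd by (simp add: finite_energy_def)
        have "G * enn2real (frac_energy s (\<lambda>x. \<phi> m x - \<phi> n x)) \<le> G * e"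
          using M[OF mn] unfolding energy_real_def G_def .
        then have "enn2real (frac_energy s (\<lambda>x. \<phi> m x - \<phi> n x)) \<le> e" using G by simp
        then have "ennreal (enn2real (frac_energy s (\<lambda>x. \<phi> m x - \<phi> n x))) \<le> ennreal e" by (rule ennreal_leI)
        moreover have "ennreal (enn2real (frac_energy s (\<lambda>x. \<phi> m x - \<phi> n x))) = frac_energy s (\<lambda>x. \<phi> m x - \<phi> n x)"
          using fin by (intro ennreal_enn2real) simp
        ultimately show ?thesis unfolding hd by (subst hi) auto
      qed
      then show ?thesis by blast
    qed
    have "(\<lambda>n. enn2real (frac_energy s (\<phi> n))) \<longlonglongrightarrow> enn2real (frac_energy s u)"
      using square_integral_tendsto(2)[of "\<lambda>n. h (\<phi> n)" ?M "h u", OF _ _ 1 2 3] by (simp add: hi)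
    then show ?thesis unfolding energy_real_def by (intro tendsto_mult_left)
  qed
  show thesis using that[OF fe energy] hardy by blast
qed

text \<open>The inequality with \<open>q\<close> survives the limits of
  \<open>Ds2_approximation\<close>. Dividing by the squared norm requires positive energy, which the
  Hardy inequality provides: a vanishing Hardy integral would make \<open>u\<close> zero almost
  everywhere.\<close>

lemma strictly_subcritical_imp_positive_definite:
  fixes a :: "nat \<Rightarrow> real ^ 'n::finite"
  assumes s: "0 < s" "s < 1" and N: "real CARD('n) > 2 * s" and sub: "strictly_subcritical s {1..k} lam a"
  shows "Q_positive_definite s k lam a"
proof -
  have N': "real DIM(real ^ 'n) > 2 * s" using N by simp
  define \<gamma> where "\<gamma> = gamma_H DIM(real ^ 'n) s"
  have \<gamma>: "\<gamma> > 0" using gamma_H_pos[OF s(1) N'] by (simp add: \<gamma>_def)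
  obtain q where q: "0 \<le> q" "q < 1"
    and sub1: "\<And>u :: real ^ 'n \<Rightarrow> real. finite_energy s u \<Longrightarrow> (\<Sum>i=1..k. lam i * hardy_real s (a i) u) \<le> q * energy_real s u"
    using sub by (auto simp: strictly_subcritical_def)
  have "ereal (1 - q) \<le> ereal (Q_form s k lam a u / (Ds2_norm s u)\<^sup>2)" if u: "u \<in> Ds2 s" "\<not> (AE x in lborel. u x = 0)" for u :: "real ^ 'n \<Rightarrow> real"
  proof -
    have um [measurable]: "u \<in> borel_measurable borel" using u(1) by (simp add: Ds2_def)
    obtain \<phi> where \<phi>: "\<And>n. finite_energy s (\<phi> n)" "(\<lambda>n. energy_real s (\<phi> n)) \<longlonglongrightarrow> energy_real s u"
      "\<And>p. (\<lambda>n. hardy_real s p (\<phi> n)) \<longlonglongrightarrow> hardy_real s p u" "\<And>p. hardy_integral s p u < \<infinity>"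
      using Ds2_approximation[OF s N u(1)] by blast
    have le: "(\<Sum>i=1..k. lam i * hardy_real s (a i) u) \<le> q * energy_real s u"
    proof (rule LIMSEQ_le)
      show "(\<lambda>n. \<Sum>i=1..k. lam i * hardy_real s (a i) (\<phi> n)) \<longlonglongrightarrow> (\<Sum>i=1..k. lam i * hardy_real s (a i) u)"
        by (intro tendsto_intros \<phi>(3))
      show "(\<lambda>n. q * energy_real s (\<phi> n)) \<longlonglongrightarrow> q * energy_real s u" by (intro tendsto_intros \<phi>(2))
    qed (use sub1[OF \<phi>(1)] in auto)
    have "\<gamma> * hardy_real s 0 u \<le> energy_real s u"
    proof (rule LIMSEQ_le)
      show "(\<lambda>n. \<gamma> * hardy_real s 0 (\<phi> n)) \<longlonglongrightarrow> \<gamma> * hardy_real s 0 u" by (intro tendsto_intros \<phi>(3))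
    qed (use \<phi>(2) hardy_inequality_real[OF s N' \<phi>(1)] in \<open>auto simp: \<gamma>_def\<close>)
    moreover have "hardy_real s 0 u > 0"
    proof (rule ccontr)
      assume "\<not> hardy_real s 0 u > 0"
      then have "hardy_real s 0 u = 0" using hardy_real_nonneg[of s 0 u] by linarith
      \<comment> \<open>Finiteness is used: an infinite Hardy integral would also have
        \<open>hardy_real\<close> equal to 0.\<close>
      then have "hardy_integral s 0 u = 0"
        using \<phi>(4)[of 0] by (auto simp: hardy_real_def enn2real_eq_0_iff)
      then have ae: "AE x in lborel. ennreal ((u x)\<^sup>2 / norm (x - 0) powr (2 * s)) = 0"
        unfolding hardy_integral_def by (subst (asm) nn_integral_0_iff_AE) auto
      have "AE x in lborel. u x = 0"
      proof (rule AE_mp[OF ae], rule AE_mp[OF AE_lborel_singleton[of 0]], rule AE_I2, intro impI)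
        fix x :: "real ^ 'n" assume x: "x \<noteq> 0" and "ennreal ((u x)\<^sup>2 / norm (x - 0) powr (2 * s)) = 0"
        then have "(u x)\<^sup>2 / norm x powr (2 * s) \<le> 0" by (simp add: ennreal_eq_0_iff)
        moreover have "norm x powr (2 * s) > 0" using x by simp
        ultimately have "(u x)\<^sup>2 \<le> 0" by (simp only: pos_divide_le_eq mult_zero_left)
        then show "u x = 0" by simp
      qed
      with u(2) show False by blast
    qed
    ultimately have e: "energy_real s u > 0" using \<gamma> by (smt (verit) mult_pos_pos)
    have "(1 - q) * energy_real s u \<le> Q_form s k lam a u"
      unfolding Q_form_eq[OF s um] using le by (simp add: algebra_simps)
    then have "1 - q \<le> Q_form s k lam a u / (Ds2_norm s u)\<^sup>2"
      unfolding Ds2_norm_square[OF s um] using e by (simp add: pos_le_divide_eq)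
    then show ?thesis by simp
  qed
  then have "ereal (1 - q) \<le> (INF u \<in> {u \<in> Ds2 s. \<not> (AE x in lborel. u x = 0)}. ereal (Q_form s k lam a u / (Ds2_norm s u)\<^sup>2))"
    by (intro INF_greatest) auto
  moreover have "ereal (1 - q) > 0" using q by simp
  ultimately show ?thesis unfolding Q_positive_definite_def by (rule less_le_trans[rotated])
qed


section \<open>Almost optimal test functions\<close>

text \<open>The flat function \<open>exp (- inverse r)\<close> together with the factors that its
  derivatives produce: up to linear combinations the family in \<open>j\<close> is closed under
  differentiation.\<close>

definition flat_exp :: "nat \<Rightarrow> real \<Rightarrow> real" where
  "flat_exp j r = (if r > 0 then inverse r ^ j * exp (- inverse r) else 0)"

lemma power_le_fact_exp: "0 \<le> z \<Longrightarrow> z ^ n \<le> fact n * exp (z :: real)"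
proof -
  assume z: "0 \<le> z"
  have "(\<Sum>m\<in>{n}. z ^ m /\<^sub>R fact m) \<le> (\<Sum>m. z ^ m /\<^sub>R fact m)"
    using z exp_converges[of z] by (intro sum_le_suminf) (auto simp: sums_iff)
  then have "z ^ n / fact n \<le> exp z"
    using exp_converges[of z] by (simp add: sums_iff divide_inverse mult.commute)
  then show ?thesis by (simp add: divide_le_eq mult.commute)
qed

lemma flat_exp_bounds: "0 \<le> flat_exp j r" "flat_exp j r \<le> fact j"
proof -
  show "0 \<le> flat_exp j r" by (simp add: flat_exp_def)
  show "flat_exp j r \<le> fact j"
  proof (cases "r > 0")
    case True
    have "inverse r ^ j * exp (- inverse r) \<le> (fact j * exp (inverse r)) * exp (- inverse r)"
      using True by (intro mult_right_mono power_le_fact_exp) auto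
    then show ?thesis using True by (simp add: flat_exp_def mult.assoc exp_add[symmetric])
  qed (simp add: flat_exp_def)
qed

text \<open>The point \<open>r = 0\<close> is the only one that is not a computation. For
  \<open>h > 0\<close>, \<open>flat_exp j h\<close> equals \<open>h^2 * flat_exp (j + 2) h\<close>,
  and the bound \<open>fact (j + 2)\<close> sends the difference quotient to 0.\<close>

lemma flat_exp_has_derivative:
  "(flat_exp j has_real_derivative flat_exp (j + 2) r - real j * flat_exp (j + 1) r) (at r)"
proof -
  consider "r > 0" | "r < 0" | "r = 0" by linarith
  then show ?thesis
  proof cases
    case 1
    have "((\<lambda>r. inverse r ^ j * exp (- inverse r)) has_real_derivative flat_exp (j + 2) r - real j * flat_exp (j + 1) r) (at r)"
    proof (cases j)
      case 0
      then show ?thesis using 1 by (auto intro!: derivative_eq_intros simp: flat_exp_def power2_eq_square)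
    next
      case (Suc i)
      show ?thesis unfolding Suc using 1
        by (auto intro!: derivative_eq_intros simp: flat_exp_def) (cases i; simp add: algebra_simps)
    qed
    then show ?thesis
      by (rule has_field_derivative_transform_within_open[where S = "{0<..}"]) (use 1 in \<open>auto simp: flat_exp_def\<close>)
  next
    case 2
    have "((\<lambda>r. 0) has_real_derivative flat_exp (j + 2) r - real j * flat_exp (j + 1) r) (at r)"
      using 2 by (auto simp: flat_exp_def)
    then show ?thesis
      by (rule has_field_derivative_transform_within_open[where S = "{..<0}"]) (use 2 in \<open>auto simp: flat_exp_def\<close>)
  next
    case 3
    have "((\<lambda>h. (flat_exp j h - flat_exp j 0) / h) \<longlongrightarrow> 0) (at 0)"
    proof (rule Lim_null_comparison)
      show "\<forall>\<^sub>F h in at 0. norm ((flat_exp j h - flat_exp j 0) / h) \<le> fact (j + 2) * \<bar>h\<bar>"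
      proof (rule eventually_at_topological[THEN iffD2], intro exI[of _ UNIV] conjI ballI impI)
        fix h :: real assume "h \<noteq> 0"
        show "norm ((flat_exp j h - flat_exp j 0) / h) \<le> fact (j + 2) * \<bar>h\<bar>"
        proof (cases "h > 0")
          case True
          have "flat_exp j h = flat_exp (j + 2) h * h\<^sup>2"
            using True by (simp add: flat_exp_def power_add field_simps power2_eq_square)
          also have "\<dots> \<le> fact (j + 2) * h\<^sup>2" by (intro mult_right_mono flat_exp_bounds) auto
          finally have "flat_exp j h / h \<le> fact (j + 2) * h"
            using True by (simp add: pos_divide_le_eq power2_eq_square mult.assoc)
          then show ?thesis using True flat_exp_bounds(1)[of j h] by (simp add: flat_exp_def[of _ 0])
        next
          case False
          then have "norm ((flat_exp j h - flat_exp j 0) / h) = 0" by (simp add: flat_exp_def)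
          also have "0 \<le> fact (j + 2) * \<bar>h\<bar>" by (intro mult_nonneg_nonneg) auto
          finally show ?thesis .
        qed
      qed auto
      have "((\<lambda>h. fact (j + 2) * \<bar>h\<bar>) \<longlongrightarrow> fact (j + 2) * \<bar>0::real\<bar>) (at 0)"
        by (intro tendsto_intros)
      then show "((\<lambda>h. fact (j + 2) * \<bar>h\<bar>) \<longlongrightarrow> (0::real)) (at 0)" by simp
    qed
    then show ?thesis using 3 by (simp add: has_field_derivative_iff flat_exp_def[of _ 0])
  qed
qed

text \<open>Generated syntactically, so that closure under directional derivatives off the origin is an induction.\<close>

inductive punctured_smooth :: "('a::euclidean_space \<Rightarrow> real) \<Rightarrow> bool" where
  const: "punctured_smooth (\<lambda>x. c)"
| inner: "punctured_smooth (\<lambda>x. x \<bullet> v)"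
| powr: "punctured_smooth (\<lambda>x. (x \<bullet> x) powr c)"
| flat: "punctured_smooth (\<lambda>x. flat_exp j (p + q * ln (x \<bullet> x)))"
| add: "punctured_smooth f \<Longrightarrow> punctured_smooth g \<Longrightarrow> punctured_smooth (\<lambda>x. f x + g x)"
| mult: "punctured_smooth f \<Longrightarrow> punctured_smooth g \<Longrightarrow> punctured_smooth (\<lambda>x. f x * g x)"

lemma punctured_smooth_derivative:
  "punctured_smooth f \<Longrightarrow> \<exists>f'. (\<forall>v. punctured_smooth (f' v)) \<and> (\<forall>x. x \<noteq> 0 \<longrightarrow> (f has_derivative (\<lambda>v. f' v x)) (at x))"
proof (induction rule: punctured_smooth.induct)
  case (const c)
  show ?case by (intro exI[of _ "\<lambda>v x. 0"]) (auto intro: punctured_smooth.const)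
next
  case (inner w)
  show ?case
    by (intro exI[of _ "\<lambda>v x. v \<bullet> w"]) (auto intro!: punctured_smooth.const derivative_eq_intros)
next
  case (powr c)
  show ?case
  proof (intro exI[of _ "\<lambda>v x. (c * (x \<bullet> x) powr (c - 1)) * (2 * (x \<bullet> v))"] conjI allI impI)
    fix x :: 'a assume "x \<noteq> 0"
    then have pos: "x \<bullet> x > 0" by simp
    have 1: "((\<lambda>x. x \<bullet> x) has_derivative (\<lambda>v. 2 * (x \<bullet> v))) (at x)"
      by (auto intro!: derivative_eq_intros simp: inner_commute)
    have "((\<lambda>t. t powr c) has_real_derivative c * (x \<bullet> x) powr (c - 1)) (at (x \<bullet> x))"
      using pos by (rule has_real_derivative_powr)
    then have "((\<lambda>t. t powr c) has_derivative (\<lambda>h. (c * (x \<bullet> x) powr (c - 1)) * h)) (at (x \<bullet> x))"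
      by (simp add: has_field_derivative_def)
    from has_derivative_compose[OF 1 this]
    show "((\<lambda>x. (x \<bullet> x) powr c) has_derivative (\<lambda>v. (c * (x \<bullet> x) powr (c - 1)) * (2 * (x \<bullet> v)))) (at x)" .
  qed (intro punctured_smooth.intros)
next
  case (flat j p q)
  show ?case
  proof (intro exI[of _ "\<lambda>v x. (flat_exp (j + 2) (p + q * ln (x \<bullet> x)) + (- real j) * flat_exp (j + 1) (p + q * ln (x \<bullet> x)))
      * (q * ((x \<bullet> x) powr (- 1) * (2 * (x \<bullet> v))))"] conjI allI impI)
    fix x :: 'a assume "x \<noteq> 0"
    then have pos: "x \<bullet> x > 0" by simp
    have 1: "((\<lambda>x. x \<bullet> x) has_derivative (\<lambda>v. 2 * (x \<bullet> v))) (at x)"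
      by (auto intro!: derivative_eq_intros simp: inner_commute)
    have "((\<lambda>t. p + q * ln t) has_real_derivative q * (x \<bullet> x) powr (- 1)) (at (x \<bullet> x))"
      using pos by (auto intro!: derivative_eq_intros simp: powr_minus divide_inverse)
    from DERIV_chain2[OF flat_exp_has_derivative this]
    have "((\<lambda>t. flat_exp j (p + q * ln t)) has_derivative (\<lambda>h. ((flat_exp (j + 2) (p + q * ln (x \<bullet> x)) - real j * flat_exp (j + 1) (p + q * ln (x \<bullet> x)))
      * (q * (x \<bullet> x) powr (- 1))) * h)) (at (x \<bullet> x))"
      by (simp only: has_field_derivative_def)
    from has_derivative_compose[OF 1 this]
    show "((\<lambda>x. flat_exp j (p + q * ln (x \<bullet> x))) has_derivative (\<lambda>v. (flat_exp (j + 2) (p + q * ln (x \<bullet> x)) + (- real j) * flat_exp (j + 1) (p + q * ln (x \<bullet> x)))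
      * (q * ((x \<bullet> x) powr (- 1) * (2 * (x \<bullet> v)))))) (at x)"
      by (rule has_derivative_eq_rhs) (simp only: diff_conv_add_uminus mult_minus_left mult.assoc)
  qed (intro punctured_smooth.intros)
next
  case (add f g)
  then obtain f' g' where "\<forall>v. punctured_smooth (f' v)" "\<forall>v. punctured_smooth (g' v)"
    "\<forall>x. x \<noteq> 0 \<longrightarrow> (f has_derivative (\<lambda>v. f' v x)) (at x)" "\<forall>x. x \<noteq> 0 \<longrightarrow> (g has_derivative (\<lambda>v. g' v x)) (at x)" by blast
  then show ?case
    by (intro exI[of _ "\<lambda>v x. f' v x + g' v x"]) (auto intro!: punctured_smooth.intros has_derivative_add)
next
  case (mult f g)
  then obtain f' g' where "\<forall>v. punctured_smooth (f' v)" "\<forall>v. punctured_smooth (g' v)"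
    "\<forall>x. x \<noteq> 0 \<longrightarrow> (f has_derivative (\<lambda>v. f' v x)) (at x)" "\<forall>x. x \<noteq> 0 \<longrightarrow> (g has_derivative (\<lambda>v. g' v x)) (at x)" by blast
  then show ?case
    using mult.hyps by (intro exI[of _ "\<lambda>v x. f x * g' v x + f' v x * g x"]) (auto intro!: punctured_smooth.intros has_derivative_mult)
qed

text \<open>A function in \<open>punctured_smooth\<close> may be singular at the origin, but
  \<open>f\<close> vanishes near it. Agreeing with such a function off the origin and vanishing near
  it is a property that every directional derivative inherits, hence the induction with
  \<open>f\<close> and \<open>g\<close> arbitrary.\<close>

lemma punctured_smooth_C_k:
  fixes f g :: "'a::euclidean_space \<Rightarrow> real"
  assumes r: "r > 0"
  shows "punctured_smooth g \<Longrightarrow> (\<And>x. norm x < r \<Longrightarrow> f x = 0) \<Longrightarrow> (\<And>x. x \<noteq> 0 \<Longrightarrow> f x = g x) \<Longrightarrow> C_k k f"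
proof (induction k arbitrary: f g)
  have aux: "\<exists>g'. (\<forall>v. punctured_smooth (g' v)) \<and> (\<forall>x. f differentiable (at x)) \<and>
     (\<forall>x. x \<noteq> 0 \<longrightarrow> frechet_derivative f (at x) = (\<lambda>v. g' v x)) \<and> (\<forall>x. norm x < r \<longrightarrow> frechet_derivative f (at x) = (\<lambda>v. 0))"
    if g: "punctured_smooth g" and f0: "\<And>x. norm x < r \<Longrightarrow> f x = 0" and fg: "\<And>x. x \<noteq> 0 \<Longrightarrow> f x = g x" for f g :: "'a \<Rightarrow> real"
  proof -
    obtain g' where g': "\<And>v. punctured_smooth (g' v)" "\<And>x. x \<noteq> 0 \<Longrightarrow> (g has_derivative (\<lambda>v. g' v x)) (at x)"
      using punctured_smooth_derivative[OF g] by blast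
    have d1: "(f has_derivative (\<lambda>v. g' v x)) (at x)" if "x \<noteq> 0" for x
      by (rule has_derivative_transform_within_open[OF g'(2)[OF that], where s = "- {0}"]) (use that fg in auto)
    have d0: "(f has_derivative (\<lambda>v. 0)) (at x)" if "norm x < r" for x
      by (rule has_derivative_transform_within_open[where f = "\<lambda>_. 0" and s = "ball 0 r"]) (use that f0 in auto)
    have "f differentiable (at x)" for x
      using d1[of x] d0[of x] r by (cases "x = 0") (auto simp: differentiable_def)
    with g'(1) d1 d0 show ?thesis
      by (intro exI[of _ g']) (auto simp: frechet_derivative_at[symmetric])
  qed
  {
    case 0
    then obtain "\<forall>x. f differentiable (at x)" using aux[OF 0] by blast
    then show ?case by (auto simp: continuous_on_eq_continuous_at intro: differentiable_imp_continuous_within)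
  next
    case (Suc k)
    obtain g' where g': "\<And>v. punctured_smooth (g' v)" "\<And>x. f differentiable (at x)"
      "\<And>x. x \<noteq> 0 \<Longrightarrow> frechet_derivative f (at x) = (\<lambda>v. g' v x)" "\<And>x. norm x < r \<Longrightarrow> frechet_derivative f (at x) = (\<lambda>v. 0)"
      using aux[OF Suc.prems] by blast
    have "C_k k (\<lambda>x. frechet_derivative f (at x) v)" for v
      by (rule Suc.IH[OF g'(1)[of v]]) (simp_all add: g'(3,4))
    with g'(2) show ?case by (simp add: differentiable_on_def differentiable_at_withinI)
  }
qed

lemma C_k_translate: "C_k k f \<Longrightarrow> C_k k (\<lambda>x. f (x - c))"
proof (induction k arbitrary: f)
  case 0
  then show ?case by (auto intro!: continuous_on_compose2[of UNIV f UNIV] continuous_intros)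
next
  case (Suc k)
  have dif: "f differentiable (at x)" for x using Suc.prems by (auto simp: differentiable_on_def)
  have d: "((\<lambda>x. f (x - c)) has_derivative frechet_derivative f (at (x - c))) (at x)" for x
  proof -
    have "((\<lambda>x. x - c) has_derivative (\<lambda>v. v)) (at x)" by (auto intro!: derivative_eq_intros)
    from has_derivative_compose[OF this frechet_derivative_works[THEN iffD1, OF dif]] show ?thesis .
  qed
  have "frechet_derivative (\<lambda>x. f (x - c)) (at x) = frechet_derivative f (at (x - c))" for x
    using frechet_derivative_at[OF d] by simp
  then have "C_k k (\<lambda>x. frechet_derivative (\<lambda>x. f (x - c)) (at x) v)" for v
    using Suc.IH[of "\<lambda>x. frechet_derivative f (at x) v"] Suc.prems by simp
  then show ?case using d by (auto simp: differentiable_on_def differentiable_def)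
qed

lemma C_c_infinityI:
  fixes f :: "'a::euclidean_space \<Rightarrow> real"
  assumes "\<And>k. C_k k f" "\<And>x. R < norm x \<Longrightarrow> f x = 0"
  shows "f \<in> C_c_infinity"
proof -
  have "{x. f x \<noteq> 0} \<subseteq> cball 0 R" using assms(2) by force
  then have "bounded {x. f x \<noteq> 0}" using bounded_cball bounded_subset by blast
  then show ?thesis using assms(1) by (simp add: C_c_infinity_def compact_closure)
qed

lemma C_c_infinity_translate:
  fixes f :: "'a::euclidean_space \<Rightarrow> real"
  assumes f: "f \<in> C_c_infinity"
  shows "(\<lambda>x. f (x - c)) \<in> C_c_infinity"
proof -
  have "bounded {x. f x \<noteq> 0}"
    using f closure_subset by (auto simp: C_c_infinity_def intro: bounded_subset compact_imp_bounded)
  then obtain R where R: "\<And>x. f x \<noteq> 0 \<Longrightarrow> norm x \<le> R" by (auto simp: bounded_iff)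
  show ?thesis
  proof (rule C_c_infinityI)
    show "C_k k (\<lambda>x. f (x - c))" for k using f by (intro C_k_translate) (auto simp: C_c_infinity_def)
    fix x :: 'a assume "R + norm c < norm x"
    then show "f (x - c) = 0" using R[of "x - c"] norm_triangle_ineq2[of x c] by force
  qed
qed


section \<open>The logarithmic profile and the Hardy quotient of the test functions\<close>

lemma nn_integral_log_annulus:
  assumes "0 < a" "a \<le> b"
  shows "(\<integral>\<^sup>+x. ennreal (norm x powr (- real DIM('a))) * indicator {a..b} (x \<bullet> x) \<partial>(lborel :: 'a::euclidean_space measure)) =
    ennreal (pi powr (real DIM('a) / 2) / Gamma (real DIM('a) / 2) * (ln b - ln a))"
proof -
  let ?n = "real DIM('a)"
  define K where "K = pi powr (?n / 2) / Gamma (?n / 2)"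
  have K: "K \<ge> 0" by (simp add: K_def Gamma_real_pos less_imp_le)
  have "(\<integral>\<^sup>+x. ennreal (norm x powr (- ?n)) * indicator {a..b} (x \<bullet> x) \<partial>(lborel :: 'a measure))
    = (\<integral>\<^sup>+x. ennreal ((x \<bullet> x) powr (- ?n / 2)) * indicator {a..b} (x \<bullet> x) \<partial>(lborel :: 'a measure))"
    by (simp only: norm_powr_eq_inner_powr')
  also have "\<dots> = (\<integral>\<^sup>+q\<in>{0<..}. ennreal (K * q powr (?n / 2 - 1)) * (ennreal (q powr (- ?n / 2)) * indicator {a..b} q) \<partial>lborel)"
    unfolding K_def by (rule nn_integral_radial) measurable
  also have "\<dots> = (\<integral>\<^sup>+q\<in>{a..b}. ennreal (K * inverse q) \<partial>lborel)"
  proof (rule nn_integral_cong)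
    fix q :: real
    show "ennreal (K * q powr (?n / 2 - 1)) * (ennreal (q powr (- ?n / 2)) * indicator {a..b} q) * indicator {0<..} q = ennreal (K * inverse q) * indicator {a..b} q"
    proof (cases "q \<in> {a..b}")
      case True
      then have q: "q > 0" using assms by simp
      have "q powr (?n / 2 - 1) * q powr (- ?n / 2) = q powr (- 1)" by (simp add: powr_add[symmetric])
      then have "K * q powr (?n / 2 - 1) * q powr (- ?n / 2) = K * inverse q" using q by (simp add: powr_minus mult.assoc)
      then show ?thesis using True q K by (simp add: ennreal_mult[symmetric])
    qed simp
  qed
  also have "\<dots> = ennreal (K * (ln b - ln a))"
  proof (rule nn_integral_has_integral_lebesgue')
    show "((\<lambda>q. K * inverse q) has_integral K * (ln b - ln a)) {a..b}"
    proof (intro has_integral_mult_right fundamental_theorem_of_calculus assms)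
      fix q assume "q \<in> {a..b}"
      then show "(ln has_vector_derivative inverse q) (at q within {a..b})"
        using assms unfolding has_real_derivative_iff_has_vector_derivative[symmetric]
        by (auto intro!: derivative_eq_intros simp: divide_inverse)
    qed
  qed (use K assms in auto)
  finally show ?thesis by (simp add: K_def)
qed

text \<open>A smooth profile on the unit interval. Its factors come from the \<open>flat_exp\<close>
  family, so that composing with an affine function of \<open>ln (x \<bullet> x)\<close> stays in
  \<open>punctured_smooth\<close>.\<close>

definition log_bump :: "real \<Rightarrow> real" where
  "log_bump r = flat_exp 0 r * flat_exp 0 (1 - r)"

text \<open>The derivative is \<open>flat_exp 2\<close>, bounded by \<open>fact 2\<close>.\<close>

lemma flat_exp_0_Lipschitz: "\<bar>flat_exp 0 x - flat_exp 0 y\<bar> \<le> 2 * \<bar>x - y\<bar>"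
proof -
  have "norm (flat_exp 0 x - flat_exp 0 y) \<le> 2 * norm (x - y)"
  proof (rule field_differentiable_bound[of UNIV])
    show "(flat_exp 0 has_real_derivative flat_exp 2 z) (at z within UNIV)" for z
      using flat_exp_has_derivative[of 0 z] by (simp add: numeral_2_eq_2)
    show "norm (flat_exp 2 z) \<le> 2" for z using flat_exp_bounds[of 2 z] by simp
  qed auto
  then show ?thesis by simp
qed

lemma log_bump_Lipschitz: "\<bar>log_bump x - log_bump y\<bar> \<le> 4 * \<bar>x - y\<bar>"
proof -
  have b: "\<bar>flat_exp 0 z\<bar> \<le> 1" for z using flat_exp_bounds[of 0 z] by simp
  have "log_bump x - log_bump y = (flat_exp 0 x - flat_exp 0 y) * flat_exp 0 (1 - x) + flat_exp 0 y * (flat_exp 0 (1 - x) - flat_exp 0 (1 - y))"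
    by (simp add: log_bump_def algebra_simps)
  also have "\<bar>\<dots>\<bar> \<le> (2 * \<bar>x - y\<bar>) * 1 + 1 * (2 * \<bar>(1 - x) - (1 - y)\<bar>)"
    by (rule order_trans[OF abs_triangle_ineq]) (unfold abs_mult, intro add_mono mult_mono flat_exp_0_Lipschitz b, auto)
  finally show ?thesis by (simp add: abs_minus_commute)
qed

lemma log_bump_eq_0: "r \<le> 0 \<or> 1 \<le> r \<Longrightarrow> log_bump r = 0"
  by (auto simp: log_bump_def flat_exp_def)

lemma log_bump_lower: "1 / 3 \<le> r \<Longrightarrow> r \<le> 2 / 3 \<Longrightarrow> exp (- 6) \<le> log_bump r"
proof -
  assume r: "1 / 3 \<le> r" "r \<le> 2 / 3"
  have "exp (- 3) \<le> flat_exp 0 t" if "1 / 3 \<le> t" for t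
    using that le_imp_inverse_le[of "1 / 3" t] by (simp add: flat_exp_def)
  then have "exp (- 3) * exp (- 3) \<le> log_bump r"
    unfolding log_bump_def using r by (intro mult_mono) (auto simp: flat_exp_bounds)
  then show ?thesis by (simp add: exp_add[symmetric])
qed

text \<open>
  On the ground state \<open>norm x powr - (N/2 - s)\<close>, cut off by a profile of slope \<open>\<epsilon>\<close> in \<open>ln (norm x)\<close>,
  the Hardy integral has size \<open>1/\<epsilon>\<close> and the ground state remainder only \<open>\<epsilon>\<close>. The inner radius \<open>T\<close> is free,
  which later replaces rescaling.
\<close>

lemma almost_optimal_test_function:
  assumes s: "0 < s" "s < 1" and N: "real DIM('a::euclidean_space) > 2 * s"
  obtains C where "C \<ge> 0" "\<And>\<epsilon> T. \<epsilon> > 0 \<Longrightarrow> T > 0 \<Longrightarrow> \<exists>u :: 'a \<Rightarrow> real. u \<in> C_c_infinity \<and>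
    (\<forall>x. norm x < T \<longrightarrow> u x = 0) \<and> (\<forall>x. T * exp (1 / \<epsilon>) < norm x \<longrightarrow> u x = 0) \<and> hardy_real s 0 u > 0 \<and>
    energy_real s u \<le> (gamma_H DIM('a) s + C * \<epsilon>\<^sup>2) * hardy_real s 0 u"
proof -
  let ?n = "real DIM('a)"
  define \<alpha> where "\<alpha> = ?n / 2 - s"
  have \<alpha>: "0 \<le> \<alpha>" "\<alpha> < ?n" using N s by (auto simp: \<alpha>_def)
  obtain D where D0: "D \<ge> 0" and D: "\<And>x::'a. x \<noteq> 0 \<Longrightarrow>
    (\<integral>\<^sup>+y. ennreal ((ln (norm x) - ln (norm y))\<^sup>2 * (norm y / norm x) powr (- \<alpha>) / norm (x - y) powr (?n + 2 * s)) \<partial>lborel)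
      \<le> ennreal (D * norm x powr (- (2 * s)))"
    using log_kernel_bound[OF s \<alpha>] by blast
  define G where "G = C_Ns DIM('a) s / 2"
  define \<gamma> where "\<gamma> = gamma_H DIM('a) s"
  have G: "G > 0" and \<gamma>: "\<gamma> > 0" using C_Ns_pos[OF s] gamma_H_pos[OF s(1) N] by (auto simp: G_def \<gamma>_def)
  define K where "K = pi powr (?n / 2) / Gamma (?n / 2)"
  have K: "K > 0" by (simp add: K_def Gamma_real_pos)
  show thesis
  \<comment> \<open>The factor 96 is 16 from the squared Lipschitz constant of
    \<open>log_bump\<close>, times 2 from charging the error to either point, times 3 from using a
    third of the annulus. The profile is at least \<open>exp (- 6)\<close> there, whence
    \<open>exp 12\<close>.\<close>
  proof (rule that[of "G * (96 * D * exp 12)"])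
    show "G * (96 * D * exp 12) \<ge> 0" using G D0 by simp
    fix \<epsilon> T :: real assume e: "\<epsilon> > 0" and T: "T > 0"
    define ar where "ar x = \<epsilon> * (ln (norm x) - ln T)" for x :: 'a
    \<comment> \<open>The ground state times \<open>log_bump\<close> of \<open>ar x\<close>, spelled
      out in \<open>x \<bullet> x\<close> so that it visibly belongs to
      \<open>punctured_smooth\<close>. The factor 1/2 stems from
      \<open>ln (x \<bullet> x) = 2 * ln (norm x)\<close>.\<close>
    define u where "u x = (x \<bullet> x) powr (- \<alpha> / 2) * (flat_exp 0 (- \<epsilon> * ln T + \<epsilon> / 2 * ln (x \<bullet> x)) * flat_exp 0 (1 + \<epsilon> * ln T + (- \<epsilon> / 2) * ln (x \<bullet> x)))" for x :: 'a
    have u: "u x = norm x powr (- \<alpha>) * log_bump (ar x)" for x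
    proof (cases "x = 0")
      case False
      have "ln (x \<bullet> x) = 2 * ln (norm x)" using False
        by (simp add: power2_norm_eq_inner[symmetric] ln_realpow)
      then have "- \<epsilon> * ln T + \<epsilon> / 2 * ln (x \<bullet> x) = ar x" "1 + \<epsilon> * ln T + (- \<epsilon> / 2) * ln (x \<bullet> x) = 1 - ar x"
        by (simp_all add: ar_def algebra_simps)
      then show ?thesis unfolding u_def log_bump_def by (simp only: norm_powr_eq_inner_powr'[of x "- \<alpha>"])
    qed (simp add: u_def)
    have ar_neg: "ar x \<le> 0" if "x \<noteq> 0" "norm x \<le> T" for x
      using that e T by (simp add: ar_def mult_le_0_iff)
    have ar_big: "1 \<le> ar x" if "T * exp (1 / \<epsilon>) \<le> norm x" for x
    proof -
      have "0 < T * exp (1 / \<epsilon>)" using T by simp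
      then have "ln (T * exp (1 / \<epsilon>)) \<le> ln (norm x)" using that by (intro ln_mono)
      then have "1 / \<epsilon> \<le> ln (norm x) - ln T" using T by (simp add: ln_mult)
      then show ?thesis using e by (simp add: ar_def pos_divide_le_eq mult.commute)
    qed
    have near: "u x = 0" if "norm x < T" for x
      using ar_neg[of x] that by (cases "x = 0") (auto simp: u log_bump_eq_0)
    have far: "u x = 0" if "T * exp (1 / \<epsilon>) < norm x" for x
      using ar_big[of x] that by (simp add: u log_bump_eq_0)
    have "punctured_smooth u" unfolding u_def by (intro punctured_smooth.mult punctured_smooth.powr punctured_smooth.flat)
    then have uC: "u \<in> C_c_infinity"
      by (intro C_c_infinityI[OF _ far] punctured_smooth_C_k[OF T _ near]) auto
    have fe: "finite_energy s u" by (rule test_function_finite_energy[OF s uC])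
    then have bs: "bounded_support u" and Efin: "frac_energy s u < \<infinity>" by (auto simp: finite_energy_def)
    note [measurable] = bounded_supportD[OF bs]
    \<comment> \<open>The integral of \<open>norm x powr (- ?n)\<close> over the annulus between the
      radii \<open>T\<close> and \<open>T * exp (1 / \<epsilon>)\<close>.\<close>
    define j where "j = K * (2 / \<epsilon>)"
    have j: "j > 0" using K e by (simp add: j_def)
    define A where "A x = (indicator {T\<^sup>2..T\<^sup>2 * exp (2 / \<epsilon>)} (x \<bullet> x) :: ennreal)" for x :: 'a
    have [measurable]: "A \<in> borel_measurable borel" unfolding A_def by measurable
    have J: "(\<integral>\<^sup>+x. ennreal (norm x powr (- ?n)) * A x \<partial>lborel) = ennreal j"
      unfolding A_def using T e by (subst nn_integral_log_annulus) (auto simp: j_def K_def ln_mult)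
    have Aout: "log_bump (ar x) = 0" if x: "x \<noteq> 0" "A x = 0" for x
    proof -
      have "x \<bullet> x < T\<^sup>2 \<or> T\<^sup>2 * exp (2 / \<epsilon>) < x \<bullet> x" using x(2) by (auto simp: A_def split: split_indicator_asm)
      moreover have "T\<^sup>2 * exp (2 / \<epsilon>) = (T * exp (1 / \<epsilon>))\<^sup>2"
        by (simp add: power_mult_distrib power2_eq_square exp_add[symmetric])
      ultimately have "(norm x)\<^sup>2 < T\<^sup>2 \<or> (T * exp (1 / \<epsilon>))\<^sup>2 < (norm x)\<^sup>2" by (simp add: power2_norm_eq_inner)
      then have "norm x < T \<or> T * exp (1 / \<epsilon>) < norm x"
        using T power2_less_imp_less[of "norm x" T] power2_less_imp_less[of "T * exp (1 / \<epsilon>)" "norm x"] by auto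
      then show ?thesis using ar_neg[of x] ar_big[of x] x(1) by (auto intro!: log_bump_eq_0)
    qed
    define v where "v x = u x * norm x powr \<alpha>" for x
    have v: "v x = log_bump (ar x)" if "x \<noteq> 0" for x
      using that by (simp add: v_def u powr_minus)
    define k where "k x y = norm (x - y) powr (?n + 2 * s)" for x y :: 'a
    have k0: "k x y \<ge> 0" for x y by (simp add: k_def)
    define g where "g x y = norm x powr (- \<alpha>) * norm y powr (- \<alpha>) * (ln (norm x) - ln (norm y))\<^sup>2 / k x y" for x y :: 'a
    have g0: "g x y \<ge> 0" for x y using k0 by (simp add: g_def)
    have gs: "g y x = g x y" for x y by (simp add: g_def k_def norm_minus_commute power2_commute mult.commute)
    have [measurable]: "case_prod g \<in> borel_measurable (borel \<Otimes>\<^sub>M borel)" unfolding g_def k_def by measurable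
    \<comment> \<open>The increment vanishes unless one point lies in the annulus, and is charged to
      such a point. This matters because the weight \<open>norm x powr (- ?n)\<close> that arises
      has infinite integral over the whole space.\<close>
    have pw: "ennreal (norm x powr (- \<alpha>) * norm y powr (- \<alpha>) * (v x - v y)\<^sup>2 / k x y) \<le> ennreal (16 * \<epsilon>\<^sup>2) * (A x * ennreal (g x y) + A y * ennreal (g y x))"
      if xy: "x \<noteq> 0" "y \<noteq> 0" for x y
    proof (cases "A x = 0 \<and> A y = 0")
      case True
      then show ?thesis using Aout xy by (simp add: v)
    next
      case False
      have "\<bar>v x - v y\<bar> \<le> \<bar>4 * (\<epsilon> * (ln (norm x) - ln (norm y)))\<bar>"
      proof -
        have "4 * (\<epsilon> * (ln (norm x) - ln (norm y))) = 4 * (ar x - ar y)" by (simp add: ar_def algebra_simps)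
        then have "\<bar>4 * (\<epsilon> * (ln (norm x) - ln (norm y)))\<bar> = 4 * \<bar>ar x - ar y\<bar>" by (simp only: abs_mult abs_numeral)
        then show ?thesis using log_bump_Lipschitz[of "ar x" "ar y"] by (simp only: v[OF xy(1)] v[OF xy(2)])
      qed
      then have "(v x - v y)\<^sup>2 \<le> (4 * (\<epsilon> * (ln (norm x) - ln (norm y))))\<^sup>2" by (simp only: abs_le_square_iff)
      then have "(v x - v y)\<^sup>2 \<le> 16 * \<epsilon>\<^sup>2 * (ln (norm x) - ln (norm y))\<^sup>2" by (simp add: power_mult_distrib)
      then have "norm x powr (- \<alpha>) * norm y powr (- \<alpha>) * (v x - v y)\<^sup>2 / k x y \<le>
        norm x powr (- \<alpha>) * norm y powr (- \<alpha>) * (16 * \<epsilon>\<^sup>2 * (ln (norm x) - ln (norm y))\<^sup>2) / k x y"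
        using k0 by (intro divide_right_mono mult_left_mono) auto
      also have "\<dots> = 16 * \<epsilon>\<^sup>2 * g x y" by (simp add: g_def)
      finally have "ennreal (norm x powr (- \<alpha>) * norm y powr (- \<alpha>) * (v x - v y)\<^sup>2 / k x y) \<le> ennreal (16 * \<epsilon>\<^sup>2) * ennreal (g x y)"
        using g0 by (simp add: ennreal_mult[symmetric] ennreal_leI)
      also have "ennreal (g x y) \<le> A x * ennreal (g x y) + A y * ennreal (g y x)"
        using False by (auto simp: A_def gs[of x y] indicator_def split: if_splits)
      finally show ?thesis by (simp add: mult_left_mono)
    qed
    have Ag: "(\<integral>\<^sup>+x. \<integral>\<^sup>+y. A x * ennreal (g x y) \<partial>lborel \<partial>lborel) \<le> ennreal (D * j)"
    proof -
      have "(\<integral>\<^sup>+x. \<integral>\<^sup>+y. A x * ennreal (g x y) \<partial>lborel \<partial>lborel) \<le> (\<integral>\<^sup>+x. ennreal D * (ennreal (norm x powr (- ?n)) * A x) \<partial>lborel)"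
      proof (rule nn_integral_mono_off_point[where c = 0])
        fix x :: 'a assume x: "x \<noteq> 0"
        \<comment> \<open>Factoring out \<open>norm x powr (- (2 * \<alpha>))\<close> leaves the
          kernel of \<open>log_kernel_bound\<close> with \<open>c = \<alpha>\<close>; the powers of
          \<open>norm x\<close> then combine to \<open>- ?n\<close>.\<close>
        have "(\<integral>\<^sup>+y. ennreal (g x y) \<partial>lborel) = (\<integral>\<^sup>+y. ennreal (norm x powr (- (2 * \<alpha>))) * ennreal ((ln (norm x) - ln (norm y))\<^sup>2 * (norm y / norm x) powr (- \<alpha>) / norm (x - y) powr (?n + 2 * s)) \<partial>lborel)"
        proof (rule nn_integral_cong)
          fix y :: 'a
          have "(norm y / norm x) powr (- \<alpha>) = norm y powr (- \<alpha>) * norm x powr \<alpha>" using x by (simp add: powr_divide powr_minus_divide)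
          moreover have "norm x powr (- \<alpha>) = norm x powr (- (2 * \<alpha>)) * norm x powr \<alpha>" by (simp add: powr_add[symmetric])
          ultimately have "g x y = norm x powr (- (2 * \<alpha>)) * ((ln (norm x) - ln (norm y))\<^sup>2 * (norm y / norm x) powr (- \<alpha>) / norm (x - y) powr (?n + 2 * s))"
            unfolding g_def k_def by (simp only: times_divide_eq_right mult_ac)
          then show "ennreal (g x y) = ennreal (norm x powr (- (2 * \<alpha>))) * ennreal ((ln (norm x) - ln (norm y))\<^sup>2 * (norm y / norm x) powr (- \<alpha>) / norm (x - y) powr (?n + 2 * s))"
            by (simp only:) (rule ennreal_mult, auto)
        qed
        also have "\<dots> = ennreal (norm x powr (- (2 * \<alpha>))) * (\<integral>\<^sup>+y. ennreal ((ln (norm x) - ln (norm y))\<^sup>2 * (norm y / norm x) powr (- \<alpha>) / norm (x - y) powr (?n + 2 * s)) \<partial>lborel)"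
          by (rule nn_integral_cmult) measurable
        also have "\<dots> \<le> ennreal (norm x powr (- (2 * \<alpha>))) * ennreal (D * norm x powr (- (2 * s)))"
          by (intro mult_left_mono D x) simp
        also have "\<dots> = ennreal D * ennreal (norm x powr (- ?n))"
        proof -
          have "- (2 * \<alpha>) + - (2 * s) = - ?n" by (simp add: \<alpha>_def)
          then have "norm x powr (- (2 * \<alpha>)) * norm x powr (- (2 * s)) = norm x powr (- ?n)" by (simp only: powr_add[symmetric])
          then have "norm x powr (- (2 * \<alpha>)) * (D * norm x powr (- (2 * s))) = D * norm x powr (- ?n)" by (metis mult.left_commute)
          then show ?thesis using D0 by (simp only: ennreal_mult[symmetric] powr_ge_zero mult_nonneg_nonneg)
        qed
        finally show "(\<integral>\<^sup>+y. A x * ennreal (g x y) \<partial>lborel) \<le> ennreal D * (ennreal (norm x powr (- ?n)) * A x)"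
          by (subst nn_integral_cmult) (auto simp: mult_left_mono mult_ac intro: order_trans[OF mult_left_mono])
      qed
      also have "\<dots> = ennreal D * ennreal j" unfolding J[symmetric] by (rule nn_integral_cmult) measurable
      also have "\<dots> = ennreal (D * j)" using D0 j by (intro ennreal_mult[symmetric]) auto
      finally show ?thesis .
    qed
    have R: "ground_energy s v \<le> ennreal (32 * \<epsilon>\<^sup>2 * D * j)"
    proof -
      have "ground_energy s v \<le> (\<integral>\<^sup>+x. \<integral>\<^sup>+y. ennreal (16 * \<epsilon>\<^sup>2) * (A x * ennreal (g x y) + A y * ennreal (g y x)) \<partial>lborel \<partial>lborel)"
        unfolding ground_energy_def \<alpha>_def[symmetric] k_def[symmetric]
        by (rule nn_integral_mono_off_point[where c = 0],
            rule nn_integral_mono_off_point[where c = 0], rule pw)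
      also have "\<dots> = ennreal (16 * \<epsilon>\<^sup>2) * ((\<integral>\<^sup>+x. \<integral>\<^sup>+y. A x * ennreal (g x y) \<partial>lborel \<partial>lborel) + (\<integral>\<^sup>+x. \<integral>\<^sup>+y. A y * ennreal (g y x) \<partial>lborel \<partial>lborel))"
        by (simp add: nn_integral_cmult[of "\<lambda>y. A _ * _ y + _ y"] nn_integral_cmult[of "\<lambda>x. integral\<^sup>N _ _ + _ x"] nn_integral_add nn_integral_cmult)
      also have "(\<integral>\<^sup>+x. \<integral>\<^sup>+y. A y * ennreal (g y x) \<partial>lborel \<partial>lborel) = (\<integral>\<^sup>+x. \<integral>\<^sup>+y. A x * ennreal (g x y) \<partial>lborel \<partial>lborel)"
        by (rule lborel_pair.Fubini') measurable
      also have "ennreal (16 * \<epsilon>\<^sup>2) * ((\<integral>\<^sup>+x. \<integral>\<^sup>+y. A x * ennreal (g x y) \<partial>lborel \<partial>lborel) + (\<integral>\<^sup>+x. \<integral>\<^sup>+y. A x * ennreal (g x y) \<partial>lborel \<partial>lborel))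
        \<le> ennreal (16 * \<epsilon>\<^sup>2) * (ennreal (D * j) + ennreal (D * j))"
        by (intro mult_left_mono add_mono Ag) auto
      also have "\<dots> = ennreal (32 * \<epsilon>\<^sup>2 * D * j)"
        using D0 j by (simp add: ennreal_plus[symmetric] ennreal_mult[symmetric] del: ennreal_plus)
      finally show ?thesis .
    qed
    have H: "exp (- 12) * (j / 3) \<le> hardy_real s 0 u"
    proof -
      \<comment> \<open>The middle third of the annulus on the logarithmic scale, given by squared
        radii; there \<open>log_bump_lower\<close> applies.\<close>
      define a' b' where "a' = T\<^sup>2 * exp (2 / (3 * \<epsilon>))" and "b' = T\<^sup>2 * exp (4 / (3 * \<epsilon>))"
      have ab: "0 < a'" "a' \<le> b'" using T e by (auto simp: a'_def b'_def divide_right_mono)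
      have "ln b' - ln a' = 2 / (3 * \<epsilon>)" using T e by (simp add: a'_def b'_def ln_mult diff_divide_distrib[symmetric])
      then have "K * (ln b' - ln a') = j / 3" by (simp add: j_def)
      then have J': "(\<integral>\<^sup>+x. ennreal (norm x powr (- ?n)) * indicator {a'..b'} (x \<bullet> x) \<partial>(lborel :: 'a measure)) = ennreal (j / 3)"
        unfolding nn_integral_log_annulus[OF ab] K_def[symmetric] by (rule arg_cong)
      have "(\<integral>\<^sup>+x. ennreal (exp (- 12)) * (ennreal (norm x powr (- ?n)) * indicator {a'..b'} (x \<bullet> x)) \<partial>(lborel :: 'a measure)) \<le> hardy_integral s 0 u"
        unfolding hardy_integral_def
      proof (rule nn_integral_mono)
        fix x :: 'a
        show "ennreal (exp (- 12)) * (ennreal (norm x powr (- ?n)) * indicator {a'..b'} (x \<bullet> x)) \<le> ennreal ((u x)\<^sup>2 / norm (x - 0) powr (2 * s))"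
        proof (cases "x \<bullet> x \<in> {a'..b'}")
          case True
          then have xx: "a' \<le> x \<bullet> x" "x \<bullet> x \<le> b'" by auto
          then have x: "x \<noteq> 0" using ab by auto
          have lnx: "ln (x \<bullet> x) = 2 * ln (norm x)" using x by (simp add: power2_norm_eq_inner[symmetric] ln_realpow)
          have "ln a' \<le> ln (x \<bullet> x)" "ln (x \<bullet> x) \<le> ln b'" using xx ab x by simp_all
          then have "2 * ln T + 2 / (3 * \<epsilon>) \<le> 2 * ln (norm x)" "2 * ln (norm x) \<le> 2 * ln T + 4 / (3 * \<epsilon>)"
            using T unfolding lnx a'_def b'_def by (simp_all add: ln_mult ln_realpow)
          moreover have "2 / (3 * \<epsilon>) = 2 * (1 / (3 * \<epsilon>))" "4 / (3 * \<epsilon>) = 2 * (2 / (3 * \<epsilon>))" by simp_all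
          ultimately have "1 / (3 * \<epsilon>) \<le> ln (norm x) - ln T" "ln (norm x) - ln T \<le> 2 / (3 * \<epsilon>)" by linarith+
          then have "\<epsilon> * (1 / (3 * \<epsilon>)) \<le> ar x" "ar x \<le> \<epsilon> * (2 / (3 * \<epsilon>))"
            unfolding ar_def using e by (intro mult_left_mono; simp)+
          then have "1 / 3 \<le> ar x" "ar x \<le> 2 / 3" using e by auto
          then have "exp (- 6) \<le> log_bump (ar x)" by (rule log_bump_lower)
          then have "(exp (- 6))\<^sup>2 \<le> (log_bump (ar x))\<^sup>2" by (intro power_mono) auto
          then have lb: "exp (- 12) \<le> (log_bump (ar x))\<^sup>2" by (simp add: power2_eq_square exp_add[symmetric])
          have "- \<alpha> + - \<alpha> - 2 * s = - ?n" by (simp add: \<alpha>_def)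
          then have w: "norm x powr (- \<alpha>) * norm x powr (- \<alpha>) / norm x powr (2 * s) = norm x powr (- ?n)"
            by (simp only: powr_add[symmetric] powr_diff[symmetric])
          have "exp (- 12) * norm x powr (- ?n) \<le> (log_bump (ar x))\<^sup>2 * norm x powr (- ?n)"
            using lb by (intro mult_right_mono) auto
          also have "\<dots> = (u x)\<^sup>2 / norm (x - 0) powr (2 * s)"
            unfolding w[symmetric] u by (simp add: power2_eq_square)
          finally show ?thesis using True by (simp add: ennreal_mult[symmetric] ennreal_leI)
        qed simp
      qed
      also have "(\<integral>\<^sup>+x. ennreal (exp (- 12)) * (ennreal (norm x powr (- ?n)) * indicator {a'..b'} (x \<bullet> x)) \<partial>(lborel :: 'a measure)) = ennreal (exp (- 12)) * ennreal (j / 3)"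
        unfolding J'[symmetric] by (rule nn_integral_cmult) measurable
      also have "\<dots> = ennreal (exp (- 12) * (j / 3))" using j by (intro ennreal_mult[symmetric]) auto
      finally have "ennreal (exp (- 12) * (j / 3)) \<le> ennreal (hardy_real s 0 u)" unfolding ennreal_hardy_real[OF bs N] .
      then show ?thesis by (simp add: hardy_real_nonneg)
    qed
    have Hpos: "hardy_real s 0 u > 0" using H j by (smt (verit) exp_gt_zero mult_pos_pos divide_pos_pos)
    have "ennreal (energy_real s u) = ennreal G * frac_energy s u"
    proof -
      have "ennreal (enn2real (frac_energy s u)) = frac_energy s u" using Efin by (intro ennreal_enn2real) simp
      then show ?thesis unfolding energy_real_def G_def[symmetric] using G by (simp add: ennreal_mult)
    qed
    also have "\<dots> = ennreal G * ground_energy s v + ennreal \<gamma> * hardy_integral s 0 u"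
      unfolding G_def \<gamma>_def v_def \<alpha>_def
      by (rule ground_state_representation[OF s N bounded_supportD[OF bs] nn_integral_square_finite[OF bs] hardy_integral_finite[OF bs N]])
    also have "\<dots> \<le> ennreal G * ennreal (32 * \<epsilon>\<^sup>2 * D * j) + ennreal \<gamma> * ennreal (hardy_real s 0 u)"
      unfolding ennreal_hardy_real[OF bs N] by (intro add_mono mult_left_mono R) auto
    also have "\<dots> = ennreal (G * (32 * \<epsilon>\<^sup>2 * D * j) + \<gamma> * hardy_real s 0 u)"
      using G \<gamma> D0 j by (simp add: ennreal_mult[symmetric] ennreal_plus[symmetric] hardy_real_nonneg del: ennreal_plus)
    finally have "energy_real s u \<le> G * (32 * \<epsilon>\<^sup>2 * D * j) + \<gamma> * hardy_real s 0 u"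
      using G \<gamma> D0 j by (subst (asm) ennreal_le_iff) (auto intro!: add_nonneg_nonneg mult_nonneg_nonneg hardy_real_nonneg)
    also have "G * (32 * \<epsilon>\<^sup>2 * D * j) \<le> G * (32 * \<epsilon>\<^sup>2 * D * (3 * exp 12 * hardy_real s 0 u))"
    proof -
      have "exp 12 * (exp (- 12) * (j / 3)) \<le> exp 12 * hardy_real s 0 u" using H by (intro mult_left_mono) auto
      then have "j \<le> 3 * exp 12 * hardy_real s 0 u" by (simp add: mult.assoc[symmetric] exp_add[symmetric])
      then show ?thesis using G D0 by (intro mult_left_mono) auto
    qed
    finally have "energy_real s u \<le> (gamma_H DIM('a) s + G * (96 * D * exp 12) * \<epsilon>\<^sup>2) * hardy_real s 0 u"
      by (simp add: \<gamma>_def algebra_simps)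
    then show "\<exists>u :: 'a \<Rightarrow> real. u \<in> C_c_infinity \<and> (\<forall>x. norm x < T \<longrightarrow> u x = 0) \<and> (\<forall>x. T * exp (1 / \<epsilon>) < norm x \<longrightarrow> u x = 0) \<and>
      hardy_real s 0 u > 0 \<and> energy_real s u \<le> (gamma_H DIM('a) s + G * (96 * D * exp 12) * \<epsilon>\<^sup>2) * hardy_real s 0 u"
      using uC near far Hpos by blast
  qed
qed


section \<open>Necessity\<close>

text \<open>A positive number below the infimum supplies \<open>\<eta>\<close>. A positive Hardy
  integral at some point \<open>p\<close> certifies that the test function is not zero almost
  everywhere.\<close>

lemma positive_definite_imp_form_bound:
  fixes a :: "nat \<Rightarrow> real ^ 'n::finite"
  assumes s: "0 < s" "s < 1" and N: "real CARD('n) > 2 * s" and pd: "Q_positive_definite s k lam a"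
  obtains \<eta> where "0 < \<eta>" "\<eta> < 1" "\<And>u p. u \<in> C_c_infinity \<Longrightarrow> 0 < hardy_real s p u \<Longrightarrow>
    (\<Sum>i=1..k. lam i * hardy_real s (a i) u) \<le> (1 - \<eta>) * energy_real s u"
proof -
  have N': "real DIM(real ^ 'n) > 2 * s" using N by simp
  obtain z where z: "0 < ereal z" "ereal z < (INF u \<in> {u \<in> Ds2 s. \<not> (AE x in lborel. u x = 0)}. ereal (Q_form s k lam a u / (Ds2_norm s u)\<^sup>2))"
    using ereal_dense2[OF pd[unfolded Q_positive_definite_def]] by blast
  \<comment> \<open>The cap keeps the factor \<open>1 - \<eta>\<close> positive.\<close>
  define \<eta> where "\<eta> = min z (1 / 2)"
  have \<eta>: "0 < \<eta>" "\<eta> < 1" "\<eta> \<le> z" using z(1) by (auto simp: \<eta>_def)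
  show thesis
  proof (rule that[OF \<eta>(1,2)])
    fix u :: "real ^ 'n \<Rightarrow> real" and p assume u: "u \<in> C_c_infinity" and H: "0 < hardy_real s p u"
    have fe: "finite_energy s u" by (rule test_function_finite_energy[OF s u])
    then have um [measurable]: "u \<in> borel_measurable borel" by (auto simp: finite_energy_def bounded_support_def)
    have nz: "\<not> (AE x in lborel. u x = 0)"
    proof
      assume ae: "AE x in lborel. u x = 0"
      have "hardy_integral s p u = (\<integral>\<^sup>+x. 0 \<partial>(lborel :: (real ^ 'n) measure))"
        unfolding hardy_integral_def by (rule nn_integral_cong_AE, rule AE_mp[OF ae], rule AE_I2) auto
      with H show False by (simp add: hardy_real_def)
    qed
    have "gamma_H DIM(real ^ 'n) s * hardy_real s p u \<le> energy_real s u"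
      by (rule hardy_inequality_real[OF s N' fe])
    then have E: "energy_real s u > 0" using gamma_H_pos[OF s(1) N'] H by (smt (verit) mult_pos_pos)
    have "ereal z < ereal (Q_form s k lam a u / (Ds2_norm s u)\<^sup>2)"
      by (rule less_le_trans[OF z(2)]) (use nz test_function_in_Ds2[OF s u] in \<open>auto intro: INF_lower\<close>)
    then have "\<eta> \<le> Q_form s k lam a u / energy_real s u" using \<eta> by (simp add: Ds2_norm_square[OF s um])
    then have "\<eta> * energy_real s u \<le> Q_form s k lam a u" using E by (simp add: pos_le_divide_eq)
    then show "(\<Sum>i=1..k. lam i * hardy_real s (a i) u) \<le> (1 - \<eta>) * energy_real s u"
      unfolding Q_form_eq[OF s um] by (simp add: algebra_simps)
  qed
qed

text \<open>If a test function has Hardy quotient at most \<open>\<gamma> + \<beta>\<close> and the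
  remaining contributions amount to at most \<open>\<beta>\<close>, then the coefficient that it
  sees is at most \<open>(1 - \<eta>) * (\<gamma> + \<beta>) + \<beta>\<close>. The gap
  \<open>\<eta>\<close> makes this strictly smaller than \<open>\<gamma>\<close>.\<close>

lemma positive_definite_imp_subcritical:
  fixes a :: "nat \<Rightarrow> real ^ 'n::finite"
  assumes s: "0 < s" "s < 1" and N: "real CARD('n) > 2 * s"
    and inj: "inj_on a {1..k}" and pd: "Q_positive_definite s k lam a"
  shows "(\<forall>i\<in>{1..k}. lam i < gamma_H CARD('n) s) \<and> (\<Sum>i=1..k. lam i) < gamma_H CARD('n) s"
proof -
  have N': "real DIM(real ^ 'n) > 2 * s" using N by simp
  define \<gamma> where "\<gamma> = gamma_H CARD('n) s"
  have \<gamma>: "\<gamma> > 0" using gamma_H_pos[OF s(1) N] by (simp add: \<gamma>_def)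
  obtain \<eta> where \<eta>: "0 < \<eta>" "\<eta> < 1" and bound0: "\<And>u p. u \<in> C_c_infinity \<Longrightarrow> 0 < hardy_real s p u \<Longrightarrow>
    (\<Sum>i=1..k. lam i * hardy_real s (a i) u) \<le> (1 - \<eta>) * energy_real s u"
    using positive_definite_imp_form_bound[OF s N pd] by blast
  obtain C where C0: "C \<ge> 0" and C: "\<And>\<epsilon> T. \<epsilon> > 0 \<Longrightarrow> T > 0 \<Longrightarrow> \<exists>u :: real ^ 'n \<Rightarrow> real. u \<in> C_c_infinity \<and>
    (\<forall>x. norm x < T \<longrightarrow> u x = 0) \<and> (\<forall>x. T * exp (1 / \<epsilon>) < norm x \<longrightarrow> u x = 0) \<and> hardy_real s 0 u > 0 \<and>
    energy_real s u \<le> (gamma_H DIM(real ^ 'n) s + C * \<epsilon>\<^sup>2) * hardy_real s 0 u"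
    using almost_optimal_test_function[OF s N'] by blast
  \<comment> \<open>Since \<open>(1 - \<eta>) * \<gamma> = \<gamma> - 3 * \<beta>\<close>, the two
    errors of size \<open>\<beta>\<close> still leave room below \<open>\<gamma>\<close>.\<close>
  define \<beta> where "\<beta> = \<eta> * \<gamma> / 3"
  have \<beta>: "\<beta> > 0" using \<eta> \<gamma> by (simp add: \<beta>_def)
  \<comment> \<open>Makes \<open>C * \<epsilon>^2\<close> at most \<open>\<beta>\<close>; the added
    1 covers \<open>C = 0\<close>.\<close>
  define \<epsilon> where "\<epsilon> = sqrt (\<beta> / (C + 1))"
  have \<epsilon>: "\<epsilon> > 0" using \<beta> C0 by (simp add: \<epsilon>_def)
  have "C * \<epsilon>\<^sup>2 = \<beta> * (C / (C + 1))" using \<beta> C0 by (simp add: \<epsilon>_def)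
  also have "\<dots> \<le> \<beta> * 1" using \<beta> C0 by (intro mult_left_mono) auto
  finally have C\<epsilon>: "C * \<epsilon>\<^sup>2 \<le> \<beta>" by simp
  define E where "E = exp (1 / \<epsilon>)"
  have fin: "(1 - \<eta>) * (\<gamma> + \<beta>) + \<beta> < \<gamma>"
  proof -
    have "(1 - \<eta>) * \<beta> < \<beta>" using \<eta> \<beta> by simp
    moreover have "(1 - \<eta>) * \<gamma> = \<gamma> - 3 * \<beta>" by (simp add: \<beta>_def algebra_simps)
    ultimately show ?thesis using \<beta> by (simp add: distrib_left)
  qed
  have test: "\<exists>u :: real ^ 'n \<Rightarrow> real. u \<in> C_c_infinity \<and> bounded_support u \<and>
    (\<forall>x. norm x < T \<longrightarrow> u x = 0) \<and> (\<forall>x. T * E < norm x \<longrightarrow> u x = 0) \<and> hardy_real s 0 u > 0 \<and>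
    (1 - \<eta>) * energy_real s u \<le> (1 - \<eta>) * (\<gamma> + \<beta>) * hardy_real s 0 u" if T: "T > 0" for T
  proof -
    obtain u :: "real ^ 'n \<Rightarrow> real" where u: "u \<in> C_c_infinity" "\<forall>x. norm x < T \<longrightarrow> u x = 0" "\<forall>x. T * E < norm x \<longrightarrow> u x = 0"
      "hardy_real s 0 u > 0" "energy_real s u \<le> (\<gamma> + C * \<epsilon>\<^sup>2) * hardy_real s 0 u"
      using C[OF \<epsilon> T] by (auto simp: E_def \<gamma>_def)
    have "(\<gamma> + C * \<epsilon>\<^sup>2) * hardy_real s 0 u \<le> (\<gamma> + \<beta>) * hardy_real s 0 u"
      using C\<epsilon> u(4) by (intro mult_right_mono) auto
    then have "energy_real s u \<le> (\<gamma> + \<beta>) * hardy_real s 0 u" using u(5) by linarith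
    then have "(1 - \<eta>) * energy_real s u \<le> (1 - \<eta>) * ((\<gamma> + \<beta>) * hardy_real s 0 u)"
      using \<eta> by (intro mult_left_mono) auto
    moreover have "bounded_support u" using test_function_finite_energy[OF s u(1)] by (simp add: finite_energy_def)
    ultimately show ?thesis using u by (auto simp: mult.assoc)
  qed
  have single: "lam i0 < \<gamma>" if i0: "i0 \<in> {1..k}" for i0
  proof -
    define J where "J = {1..k} - {i0}"
    have J: "finite J" "i0 \<notin> J" "{1..k} = insert i0 J" using i0 by (auto simp: J_def)
    define p where "p i = a i - a i0" for i
    have p: "norm (p i) > 0" if "i \<in> J" for i
    proof -
      have "a i \<noteq> a i0" using that inj_onD[OF inj, of i i0] i0 by (auto simp: J_def)
      then show ?thesis by (simp add: p_def)
    qed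
    define S where "S = (\<Sum>i\<in>J. \<bar>lam i\<bar>)"
    define e where "e = \<beta> / (S + 1)"
    have S0: "S \<ge> 0" by (simp add: S_def sum_nonneg)
    have e: "e > 0" using \<beta> S0 by (simp add: e_def)
    have Se: "S * e \<le> \<beta>" using \<beta> S0 by (simp add: e_def field_simps)
    \<comment> \<open>The inserted 1 covers the case of a single pole, where \<open>J\<close> is
      empty.\<close>
    define m where "m = Min (insert 1 ((\<lambda>i. norm (p i)) ` J))"
    have m: "m > 0" "\<And>i. i \<in> J \<Longrightarrow> m \<le> norm (p i)"
      using J(1) p by (auto simp: m_def)
    define w where "w = 1 + e powr (- (1 / (2 * s)))"
    have w: "w > 0" by (simp add: w_def add_pos_nonneg)
    \<comment> \<open>The support of the test function lies in the ball of radius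
      \<open>T * E\<close>. This choice puts every other pole at a distance of at least
      \<open>w\<close> times that radius, as \<open>hardy_real_near_other_pole\<close>
      requires.\<close>
    define T where "T = m / (E * w)"
    have E: "E > 0" by (simp add: E_def)
    have T: "T > 0" using m w E by (simp add: T_def)
    have TEw: "T * E * w = m" using w E by (simp add: T_def)
    obtain u :: "real ^ 'n \<Rightarrow> real" where u: "u \<in> C_c_infinity" "bounded_support u" "\<forall>x. T * E < norm x \<longrightarrow> u x = 0"
      "hardy_real s 0 u > 0" "(1 - \<eta>) * energy_real s u \<le> (1 - \<eta>) * (\<gamma> + \<beta>) * hardy_real s 0 u"
      using test[OF T] by blast
    have um [measurable]: "u \<in> borel_measurable borel" by (rule bounded_supportD[OF u(2)])
    define v where "v x = u (x - a i0)" for x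
    have vC: "v \<in> C_c_infinity" unfolding v_def by (rule C_c_infinity_translate[OF u(1)])
    have hv: "hardy_real s q v = hardy_real s (q - a i0) u" for q
      unfolding v_def hardy_real_def by (simp add: hardy_integral_translate)
    have Ev: "energy_real s v = energy_real s u"
      unfolding v_def energy_real_def by (simp add: frac_energy_translate)
    have small: "\<bar>lam i * hardy_real s (p i) u\<bar> \<le> \<bar>lam i\<bar> * (e * hardy_real s 0 u)" if i: "i \<in> J" for i
    proof -
      have "hardy_real s (p i) u \<le> e * hardy_real s 0 u"
      proof (rule hardy_real_near_other_pole[OF u(2) s(1) N' e, where r = "T * E"])
        show "T * E * (1 + e powr (- (1 / (2 * s)))) \<le> norm (p i - 0)" using m(2)[OF i] TEw by (simp add: w_def)
      qed (use u(3) T E in auto)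
      then show ?thesis by (simp add: abs_mult hardy_real_nonneg mult_left_mono)
    qed
    have "hardy_real s (a i0) v > 0" using u(4) by (simp add: hv)
    then have "(\<Sum>i=1..k. lam i * hardy_real s (a i) v) \<le> (1 - \<eta>) * energy_real s v" by (rule bound0[OF vC])
    then have le: "lam i0 * hardy_real s 0 u + (\<Sum>i\<in>J. lam i * hardy_real s (p i) u) \<le> (1 - \<eta>) * energy_real s u"
      unfolding J(3) using J(1,2) by (simp add: hv Ev p_def)
    have "- (\<Sum>i\<in>J. lam i * hardy_real s (p i) u) \<le> (\<Sum>i\<in>J. \<bar>lam i\<bar> * (e * hardy_real s 0 u))"
      unfolding sum_negf[symmetric] using small by (intro sum_mono) (auto simp: abs_le_iff)
    also have "\<dots> = S * e * hardy_real s 0 u" by (simp add: S_def sum_distrib_right mult.assoc)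
    also have "\<dots> \<le> \<beta> * hardy_real s 0 u" using Se u(4) by (intro mult_right_mono) auto
    finally have "lam i0 * hardy_real s 0 u \<le> ((1 - \<eta>) * (\<gamma> + \<beta>) + \<beta>) * hardy_real s 0 u"
      using le u(5) by (simp add: distrib_right)
    then have "lam i0 \<le> (1 - \<eta>) * (\<gamma> + \<beta>) + \<beta>" using u(4) by simp
    with fin show ?thesis by linarith
  qed
  have total: "(\<Sum>i=1..k. lam i) < \<gamma>"
  proof -
    obtain R where R: "R > 0" "\<And>w :: real ^ 'n \<Rightarrow> real. bounded_support w \<Longrightarrow> (\<And>x. norm x < R \<Longrightarrow> w x = 0) \<Longrightarrow>
      \<bar>(\<Sum>i=1..k. lam i * hardy_real s (a i) w) - (\<Sum>i=1..k. lam i) * hardy_real s 0 w\<bar> \<le> \<beta> * hardy_real s 0 w"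
      using hardy_sum_far_from_poles[OF _ s(1) N' \<beta>, of "{1..k}" lam a] by auto
    \<comment> \<open>The free inner radius is set to \<open>R\<close>, so that merging all poles at
      the origin costs at most \<open>\<beta>\<close> times the Hardy integral.\<close>
    obtain u :: "real ^ 'n \<Rightarrow> real" where u: "u \<in> C_c_infinity" "bounded_support u" "\<forall>x. norm x < R \<longrightarrow> u x = 0"
      "hardy_real s 0 u > 0" "(1 - \<eta>) * energy_real s u \<le> (1 - \<eta>) * (\<gamma> + \<beta>) * hardy_real s 0 u"
      using test[OF R(1)] by blast
    have "(\<Sum>i=1..k. lam i * hardy_real s (a i) u) \<le> (1 - \<eta>) * energy_real s u" by (rule bound0[OF u(1,4)])
    moreover have "(\<Sum>i=1..k. lam i) * hardy_real s 0 u - \<beta> * hardy_real s 0 u \<le> (\<Sum>i=1..k. lam i * hardy_real s (a i) u)"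
      using R(2)[OF u(2)] u(3) by (simp add: abs_le_iff)
    ultimately have "(\<Sum>i=1..k. lam i) * hardy_real s 0 u \<le> ((1 - \<eta>) * (\<gamma> + \<beta>) + \<beta>) * hardy_real s 0 u"
      using u(5) by (simp add: distrib_right)
    then have "(\<Sum>i=1..k. lam i) \<le> (1 - \<eta>) * (\<gamma> + \<beta>) + \<beta>" using u(4) by simp
    with fin show ?thesis by linarith
  qed
  show ?thesis using single total by (simp add: \<gamma>_def)
qed

theorem theorem1p4:
  fixes s :: real and k :: nat and lam :: "nat \<Rightarrow> real"
  assumes "0 < s" and "s < 1" and "real CARD('n::finite) > 2 * s" and "k \<ge> 1"
  shows "((\<forall>i\<in>{1..k}. lam i < gamma_H CARD('n) s) \<and> (\<Sum>i=1..k. lam i) < gamma_H CARD('n) s)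
    \<longleftrightarrow> (\<exists>a :: nat \<Rightarrow> real ^ 'n. inj_on a {1..k} \<and> Q_positive_definite s k lam a)"
proof
  assume l: "(\<forall>i\<in>{1..k}. lam i < gamma_H CARD('n) s) \<and> (\<Sum>i=1..k. lam i) < gamma_H CARD('n) s"
  have "\<exists>a :: nat \<Rightarrow> real ^ 'n. inj_on a {1..k} \<and> strictly_subcritical s {1..k} lam a"
    by (rule exists_strictly_subcritical_configuration) (use assms l in auto)
  then show "\<exists>a :: nat \<Rightarrow> real ^ 'n. inj_on a {1..k} \<and> Q_positive_definite s k lam a"
    using strictly_subcritical_imp_positive_definite[OF assms(1-3)] by blast
next
  assume "\<exists>a :: nat \<Rightarrow> real ^ 'n. inj_on a {1..k} \<and> Q_positive_definite s k lam a"
  then show "(\<forall>i\<in>{1..k}. lam i < gamma_H CARD('n) s) \<and> (\<Sum>i=1..k. lam i) < gamma_H CARD('n) s"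
    using positive_definite_imp_subcritical[OF assms(1-3)] by blast
qed

end
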